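(* Let $b,p\in(0,\infty)$ and $\kappa\in\mathbb{N}$, and let $\mathrm D\in\{\mathrm L,\mathrm G\}$; if $\mathrm D=\mathrm G$ assume in addition $p\le1$. Then, as $N\to\infty$, the pair $\frac1N(A_N,S_N)$ satisfies under $\mathbb{P}^{(N)}_{\mathrm{D,MC}}$ a large-deviation principle with speed $N$ and rate function $I_{\mathrm{D,MC}}$, i.e., for every closed $F\subset[0,\infty)^2$ and every (relatively) open $G\subset[0,\infty)^2$, $$\limsup_{N\to\infty}\frac1N\log\mathbb{P}^{(N)}_{\mathrm{D,MC}}\Big(\tfrac1N(A_N,S_N)\in F\Big)\le-\inf_F I_{\mathrm{D,MC}},\qquad \liminf_{N\to\infty}\frac1N\log\mathbb{P}^{(N)}_{\mathrm{D,MC}}\Big(\tfrac1N(A_N,S_N)\in G\Big)\ge-\inf_G I_{\mathrm{D,MC}}.$$ Here $$I_{\mathrm{L,MC}}(a,s)=\inf\Big\{H(\nu|M)\colon\nu\in\mathcal M_1(\Xi),\ \sum_{(i,j)\in\Xi}\nu(i,j)\,i=a,\ \sum_{(i,j)\in\Xi}\nu(i,j)\,j=s\Big\},$$ where $\Xi=\{(i,j)\in\mathbb{N}_0^2\colon j\le i\text{ and }j\le\kappa\}$ and $M$ is the probability measure on $\Xi$ given by $$M(i,j)=\mathrm{Poi}_{bp/\kappa}^{\otimes\kappa}\Big(\sum_{k=1}^{\kappa}X_k=i,\ \sum_{k=1}^{\kappa}\mathbf 1_{\{X_k=1\}}=j\Big),$$ with $X_1,\dots,X_\kappa$ i.i.d.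 $\mathrm{Poi}_{bp/\kappa}$-distributed random variables under $\mathrm{Poi}_{bp/\kappa}^{\otimes\kappa}$, and $$I_{\mathrm{G,MC}}(a,s)=\kappa\inf\Big\{H(\mu|\mathrm{Poi}_{bp/\kappa})\colon\mu\in\mathcal M_1(\mathbb{N}_0),\ \sum_{g\in\mathbb{N}_0}\mu(g)g=\frac a\kappa,\ \mu(\{1\})=\frac s\kappa\Big\}+a-bp+(b-a)\log\frac{1-\frac ab}{1-p}.$$
   Context: Model. For $N\in\mathbb{N}$ there are $bN$ participants (to be read as $\lfloor bN\rfloor$) and $N$ time slots. Attempts to send messages are made according to one of two access rules. Rule (L) (local; $p\in(0,\infty)$, $N\ge p$): in each time slot each participant makes a transmission attempt with probability $p/N$, independently over all participants and all slots. Rule (G) (global; $p\in(0,1]$): each participant independently decides with probability $p$ to make exactly one attempt (otherwise none), and then each attempt is assigned to one of the $N$ slots, uniformly at random and independently. Success rule (MC) (multi-channel, with $\kappa\in\mathbb{N}$ channels): in each slot each attempt chooses one of the $\kappa$ channels uniformly at random, independently over all attempts and slots. An attempt is successful if no other attempt in the same slot chooses the same channel; all other attempts are unsuccessful. $A_N$ is the total number of attempts in all $N$ slots and $S_N$ the total number of successful attempts. $\mathbb{P}^{(N)}_{\mathrm{D,MC}}$ is the probability measure for access Rule (D), $\mathrm D\in\{\mathrm L,\mathrm G\}$, with success rule (MC). Notation. $\mathbb{N}_0=\{0,1,2,\dots\}$; $\mathcal M_1(\mathcal X)$ is the set of probability measures on a discrete set $\mathcal X$; $\mathrm{Poi}_\alpha(k)=e^{-\alpha}\alpha^k/k!$;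 $H(\mu|\nu)=\sum_{x}\mu(x)\log\frac{\mu(x)}{\nu(x)}$ (relative entropy, with $0\log0=0$, and $+\infty$ if $\mu\not\ll\nu$). $\inf\emptyset=+\infty$. Conventions for $I_{\mathrm{G,MC}}$: it is $+\infty$ for $a>b$; the term $(b-a)\log\frac{1-a/b}{1-p}$ is $0$ for $a=b$, and is $+\infty$ if $p=1$ and $a<b$. *)

theory Defs
  imports "HOL-Probability.Probability"
begin

section \<open>The access model\<close>

datatype access_rule = Local | Global

definition participants :: "real \<Rightarrow> nat \<Rightarrow> nat" where
  "participants b N = nat \<lfloor>b * real N\<rfloor>"

text \<open>
  An attempt is a pair (participant, slot). An access rule is given by the distribution of the random
  finite set of attempts that are made.
\<close>

type_synonym attempt = "nat \<times> nat"

text \<open>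
  For \<open>N < p\<close> the parameter \<open>p / N\<close> is not a probability, and for \<open>N = 0\<close> there are no slots; the
  distributions are then junk values, which are irrelevant in the limit \<open>N \<rightarrow> \<infinity>\<close>.
\<close>

definition local_access :: "real \<Rightarrow> real \<Rightarrow> nat \<Rightarrow> attempt set pmf" where
  "local_access b p N =
     map_pmf (\<lambda>f. {x \<in> {..<participants b N} \<times> {..<N}. f x})
       (Pi_pmf ({..<participants b N} \<times> {..<N}) False (\<lambda>_. bernoulli_pmf (p / real N)))"

definition global_access :: "real \<Rightarrow> real \<Rightarrow> nat \<Rightarrow> attempt set pmf" where
  "global_access b p N =
     bind_pmf (Pi_pmf {..<participants b N} False (\<lambda>_. bernoulli_pmf p)) (\<lambda>d.
     let J = {i \<in> {..<participants b N}. d i} in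
     map_pmf (\<lambda>t. (\<lambda>i. (i, t i)) ` J) (Pi_pmf J 0 (\<lambda>_. pmf_of_set {..<N})))"

fun access :: "access_rule \<Rightarrow> real \<Rightarrow> real \<Rightarrow> nat \<Rightarrow> attempt set pmf" where
  "access Local b p N = local_access b p N"
| "access Global b p N = global_access b p N"

text \<open>
  An outcome of the multi-channel model consists of the set of attempts and the channel in
  \<open>{..<\<kappa>}\<close> chosen by each attempt; the channel function is 0 outside the set of attempts.
\<close>

type_synonym outcome = "attempt set \<times> (attempt \<Rightarrow> nat)"

definition MC_pmf :: "access_rule \<Rightarrow> real \<Rightarrow> real \<Rightarrow> nat \<Rightarrow> nat \<Rightarrow> outcome pmf" where
  "MC_pmf D b p \<kappa> N =
     bind_pmf (access D b p N) (\<lambda>T.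
     map_pmf (\<lambda>c. (T, c)) (Pi_pmf T 0 (\<lambda>_. pmf_of_set {..<\<kappa>})))"

definition attempts :: "outcome \<Rightarrow> nat" where
  "attempts = (\<lambda>(T, c). card T)"

definition successes :: "outcome \<Rightarrow> nat" where
  "successes = (\<lambda>(T, c). card {x \<in> T. \<forall>y \<in> T. y \<noteq> x \<longrightarrow> snd y = snd x \<longrightarrow> c y \<noteq> c x})"

definition empirical_pair :: "nat \<Rightarrow> outcome \<Rightarrow> real \<times> real" where
  "empirical_pair N \<omega> = (real (attempts \<omega>) / real N, real (successes \<omega>) / real N)"

text \<open>Logarithm of a probability, with \<open>log 0 = -\<infinity>\<close> (whereas \<open>ln 0 = 0\<close> in the library).\<close>

definition elog :: "real \<Rightarrow> ereal" where
  "elog x = (if x > 0 then ereal (ln x) else -\<infinity>)"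

section \<open>The rate functions\<close>

text \<open>
  If the support of \<open>\<mu>\<close> is contained in that of \<open>\<nu>\<close>, the negative parts of the terms of the series
  are always summable, since \<open>t ln t \<ge> -1/e\<close>. Hence the series either converges absolutely or
  diverges to \<open>+\<infinity>\<close>. (The library's \<open>KL_divergence\<close> is real-valued and does not provide the
  value \<open>+\<infinity>\<close>.)
\<close>

definition rel_entropy :: "'a pmf \<Rightarrow> 'a pmf \<Rightarrow> ereal" where
  "rel_entropy \<mu> \<nu> =
     (if set_pmf \<mu> \<subseteq> set_pmf \<nu> \<and> (\<lambda>x. pmf \<mu> x * ln (pmf \<mu> x / pmf \<nu> x)) summable_on UNIV
      then ereal (\<Sum>\<^sub>\<infinity>x. pmf \<mu> x * ln (pmf \<mu> x / pmf \<nu> x))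
      else \<infinity>)"

definition Xi :: "nat \<Rightarrow> (nat \<times> nat) set" where
  "Xi \<kappa> = {(i, j). j \<le> i \<and> j \<le> \<kappa>}"

definition M_pmf :: "real \<Rightarrow> real \<Rightarrow> nat \<Rightarrow> (nat \<times> nat) pmf" where
  "M_pmf b p \<kappa> =
     map_pmf (\<lambda>X. (\<Sum>k<\<kappa>. X k, \<Sum>k<\<kappa>. of_bool (X k = 1)))
       (Pi_pmf {..<\<kappa>} 0 (\<lambda>_. poisson_pmf (b * p / real \<kappa>)))"

text \<open>
  A probability measure on \<open>\<Xi>\<close> is a \<open>pmf\<close> on pairs that is supported in \<open>\<Xi>\<close>. The predicate
  \<open>has_sum\<close> includes the finiteness of the first moments.
\<close>

definition rate_L :: "real \<Rightarrow> real \<Rightarrow> nat \<Rightarrow> real \<times> real \<Rightarrow> ereal" where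
  "rate_L b p \<kappa> = (\<lambda>(a, s).
     Inf {rel_entropy \<nu> (M_pmf b p \<kappa>) | \<nu>.
            set_pmf \<nu> \<subseteq> Xi \<kappa> \<and>
            ((\<lambda>(i, j). pmf \<nu> (i, j) * real i) has_sum a) (Xi \<kappa>) \<and>
            ((\<lambda>(i, j). pmf \<nu> (i, j) * real j) has_sum s) (Xi \<kappa>)})"

text \<open>The term \<open>(b - a) log ((1 - a/b) / (1 - p))\<close> with its conventions, for \<open>a \<le> b\<close>.\<close>

definition idle_cost :: "real \<Rightarrow> real \<Rightarrow> real \<Rightarrow> ereal" where
  "idle_cost b p a =
     (if a = b then 0
      else if p = 1 then \<infinity>
      else ereal ((b - a) * ln ((1 - a / b) / (1 - p))))"

definition rate_G :: "real \<Rightarrow> real \<Rightarrow> nat \<Rightarrow> real \<times> real \<Rightarrow> ereal" where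
  "rate_G b p \<kappa> = (\<lambda>(a, s).
     if a > b then \<infinity>
     else ereal (real \<kappa>) *
            Inf {rel_entropy \<mu> (poisson_pmf (b * p / real \<kappa>)) | \<mu>.
                   ((\<lambda>g. pmf \<mu> g * real g) has_sum (a / real \<kappa>)) UNIV \<and>
                   pmf \<mu> 1 = s / real \<kappa>}
          + ereal (a - b * p) + idle_cost b p a)"

fun rate :: "access_rule \<Rightarrow> real \<Rightarrow> real \<Rightarrow> nat \<Rightarrow> real \<times> real \<Rightarrow> ereal" where
  "rate Local b p \<kappa> = rate_L b p \<kappa>"
| "rate Global b p \<kappa> = rate_G b p \<kappa>"

end

theory Submission
  imports Defs "HOL-Real_Asymp.Real_Asymp"
begin

text \<open>
  Both models are compared with independent Poisson variables of mean \<open>b p / \<kappa>\<close>, one for each of the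
  \<open>\<kappa> N\<close> boxes (slot, channel). The number of attempts is the sum of the occupation numbers of the
  boxes and the number of successes is the number of boxes with exactly one attempt.

  Under global access, each participant throws a ball into a uniform box with probability \<open>p\<close>. The
  multinomial formula shows that the law of the occupation numbers has a density with respect to the
  Poisson variables that depends on the total number \<open>n\<close> of attempts only, and by Stirling's formula
  this density is \<open>exp (- N g (n / N) + o(N))\<close>, where \<open>g\<close> is the part of the rate function
  outside the infimum (\<open>pmf_occ_Global\<close>, \<open>global_ratio_upper\<close>, \<open>global_ratio_lower\<close>).
  Under local access the slots are independent, and the pair (attempts, successes) in one slot has a
  density with respect to \<open>M\<close> that tends to 1 and whose product over all slots stays bounded as
  long as the number of attempts is of order \<open>N\<close> (\<open>pmf_slot\<close>, \<open>local_ratio_le\<close>,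
  \<open>local_ratio_limit\<close>). So in both cases one needs the large deviations of two sums over
  \<open>K\<close> independent letters, \<open>K = \<kappa> N\<close> boxes or \<open>K = N\<close> slots, stable under
  multiplication with a density; these are \<open>ldp_upper_bound\<close> and \<open>ldp_lower_bound\<close>.

  For the upper bound let \<open>q\<close> be the probability that the two sums are \<open>n\<close> and \<open>m\<close>. The law of
  the word of letters conditioned on this event has relative entropy \<open>- ln q\<close>. Relative entropy with
  respect to a product is at least \<open>K\<close> times that of the averaged marginal, and this marginal has the
  means \<open>n / K\<close> and \<open>m / K\<close>; hence \<open>q \<le> exp (- K J (n / K) (m / K))\<close>
  (\<open>prob_totals_le\<close>). There are only polynomially many relevant pairs \<open>(n, m)\<close>, so this
  bounds the probability of every set; a compactness argument, which uses that \<open>J\<close> is lower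
  semicontinuous (\<open>J_lower_semicontinuous\<close>) and that large sums are exponentially unlikely
  (\<open>exponential_tightness\<close>), gives the bound for closed sets. Lower semicontinuity is essential for
  \<open>p = 1\<close>: there the number of attempts is \<open>\<lfloor>b N\<rfloor>\<close>, whereas the rate is finite for
  \<open>a = b\<close> only.

  For the lower bound a competitor \<open>\<mu>\<close> in the infimum is replaced by a nearby measure of finite
  support (\<open>finite_support_approximation\<close>), and one counts the words in which each letter occurs with
  the frequency that this measure prescribes (\<open>type_class_lower_bound\<close>). The total size of these
  words is exactly \<open>\<lfloor>a N\<rfloor>\<close>, which again matters for \<open>p = 1\<close>.
\<close>

section \<open>Probability mass functions\<close>

text \<open>
  Large-deviation bounds are moved between laws by this comparison and its two-sided form
  \<open>prob_scale\<close>: it is enough to bound the density on the event.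
\<close>

lemma prob_le_of_pmf_le:
  assumes "\<And>w. w \<in> E \<Longrightarrow> pmf P w \<le> C * pmf Q w"
  shows "measure_pmf.prob P E \<le> C * measure_pmf.prob Q E"
proof -
  have "infsetsum (pmf P) E \<le> infsetsum (\<lambda>w. C * pmf Q w) E"
    using assms by (intro infsetsum_mono abs_summable_on_cmult_right pmf_abs_summable) auto
  also have "\<dots> = C * infsetsum (pmf Q) E"
    by (intro infsetsum_cmult_right pmf_abs_summable)
  finally show ?thesis by (simp add: measure_pmf_conv_infsetsum)
qed

lemma has_sum_pmf: "(pmf p has_sum 1) UNIV"
proof -
  have "(pmf p has_sum infsetsum (pmf p) UNIV) UNIV"
    by (metis abs_summable_equivalent abs_summable_summable has_sum_infsum infsetsum_infsum
        pmf_abs_summable)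
  then show ?thesis using infsetsum_pmf_eq_1[of p UNIV] by simp
qed

lemma ex_pmf_of_has_sum:
  assumes nonneg: "\<And>x. (f x :: real) \<ge> 0" and sum1: "(f has_sum 1) UNIV"
  shows "\<exists>p. pmf p = f"
proof -
  have "(\<lambda>x. norm (f x)) summable_on UNIV"
    using sum1 nonneg by (simp add: has_sum_imp_summable)
  then have abs: "Infinite_Set_Sum.abs_summable_on f UNIV"
    using abs_summable_equivalent by blast
  have "infsetsum f UNIV = 1"
    using infsetsum_infsum[OF abs] sum1 by (simp add: infsumI)
  then have "(\<integral>\<^sup>+x. ennreal (f x) \<partial>count_space UNIV) = 1"
    using nn_integral_conv_infsetsum[OF abs nonneg] by simp
  then have "pmf (embed_pmf f) = f"
    using nonneg by (intro ext pmf_embed_pmf) auto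
  then show ?thesis by blast
qed

lemma prob_bind_pmf:
  "measure_pmf.prob (bind_pmf M N) A = measure_pmf.expectation M (\<lambda>y. measure_pmf.prob (N y) A)"
proof -
  have *: "measure_pmf.prob P A = pmf (map_pmf (\<lambda>w. w \<in> A) P) True" for P
    by (simp add: pmf_map vimage_def)
  show ?thesis unfolding * by (simp add: map_bind_pmf pmf_bind)
qed

lemma prob_scale:
  assumes "\<And>w. w \<in> E \<Longrightarrow> pmf P w = C * pmf Q w"
  shows "measure_pmf.prob P E = C * measure_pmf.prob Q E"
proof -
  have "infsetsum (pmf P) E = infsetsum (\<lambda>w. C * pmf Q w) E"
    using assms by (intro infsetsum_cong) auto
  also have "\<dots> = C * infsetsum (pmf Q) E"
    by (intro infsetsum_cmult_right pmf_abs_summable)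
  finally show ?thesis by (simp add: measure_pmf_conv_infsetsum)
qed

lemma integrable_measure_pmf_iff:
  fixes f :: "'a \<Rightarrow> real"
  shows "integrable (measure_pmf p) f \<longleftrightarrow> (\<lambda>x. pmf p x * f x) summable_on UNIV"
proof -
  have "integrable (measure_pmf p) f \<longleftrightarrow> integrable (count_space UNIV) (\<lambda>x. pmf p x * f x)"
    unfolding measure_pmf_eq_density by (subst integrable_density) auto
  also have "\<dots> \<longleftrightarrow> Infinite_Set_Sum.abs_summable_on (\<lambda>x. pmf p x * f x) UNIV"
    by (simp add: Infinite_Set_Sum.abs_summable_on_def)
  also have "\<dots> \<longleftrightarrow> Infinite_Sum.abs_summable_on (\<lambda>x. pmf p x * f x) UNIV"
    by (rule abs_summable_equivalent[symmetric])
  also have "\<dots> \<longleftrightarrow> (\<lambda>x. pmf p x * f x) summable_on UNIV"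
    by (rule summable_on_iff_abs_summable_on_real[symmetric])
  finally show ?thesis .
qed

section \<open>Relative entropy\<close>

text \<open>
  The summand of the relative entropy, modified by \<open>- u + v\<close>. This does not change the sum over
  two probability measures, but makes every summand nonnegative, so that the relative entropy becomes
  a supremum of finite sums, even when it is infinite.
\<close>

definition kl_term :: "real \<Rightarrow> real \<Rightarrow> real" where
  "kl_term u v = u * ln (u / v) - u + v"

lemma kl_term_nonneg:
  assumes "u \<ge> 0" "v > 0"
  shows "kl_term u v \<ge> 0"
proof (cases "u = 0")
  case False
  then have "ln (v / u) \<le> v / u - 1" using assms by (intro ln_le_minus_one) auto
  then have "u * ln (v / u) \<le> u * (v / u - 1)" using assms by (intro mult_left_mono) auto
  also have "\<dots> = v - u" using False by (simp add: field_simps)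
  also have "u * ln (v / u) = - (u * ln (u / v))"
    using assms False by (simp add: ln_div algebra_simps)
  finally show ?thesis unfolding kl_term_def by simp
qed (use assms in \<open>simp add: kl_term_def\<close>)

text \<open>
  The convex conjugate of \<open>u \<mapsto> kl_term u v\<close> is \<open>t \<mapsto> v (exp t - 1)\<close>. Summed over a set of
  letters, this Young inequality turns bounds on the entropy into bounds on means.
\<close>

lemma kl_term_young:
  assumes "u \<ge> 0" "v > 0"
  shows "u * t \<le> kl_term u v + v * (exp t - 1)"
proof (cases "u = 0")
  case False
  have "0 \<le> kl_term u (v * exp t)" using assms by (intro kl_term_nonneg) auto
  also have "\<dots> = kl_term u v - u * t + v * (exp t - 1)"
    using assms False by (simp add: kl_term_def ln_div ln_mult algebra_simps)
  finally show ?thesis by simp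
qed (use assms in \<open>simp add: kl_term_def algebra_simps\<close>)

lemma kl_term_pmf_nonneg:
  assumes "set_pmf \<mu> \<subseteq> set_pmf \<nu>"
  shows "kl_term (pmf \<mu> g) (pmf \<nu> g) \<ge> 0"
proof (cases "pmf \<nu> g = 0")
  case True
  then have "pmf \<mu> g = 0" using assms by (auto simp: set_pmf_iff)
  then show ?thesis using True by (simp add: kl_term_def)
qed (auto intro!: kl_term_nonneg simp: pmf_pos pmf_nonneg less_le)

lemma rel_entropy_eq_iff:
  "rel_entropy \<mu> \<nu> = ereal h \<longleftrightarrow>
     set_pmf \<mu> \<subseteq> set_pmf \<nu> \<and> ((\<lambda>g. kl_term (pmf \<mu> g) (pmf \<nu> g)) has_sum h) UNIV"
proof -
  let ?f = "\<lambda>g. pmf \<mu> g * ln (pmf \<mu> g / pmf \<nu> g)"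
  have "(?f has_sum h) UNIV \<longleftrightarrow> ((\<lambda>g. kl_term (pmf \<mu> g) (pmf \<nu> g)) has_sum h) UNIV"
  proof
    assume "(?f has_sum h) UNIV"
    from has_sum_add[OF this has_sum_add[OF has_sum_uminus[THEN iffD2] has_sum_pmf[of \<nu>]], of "pmf \<mu>" "-1"]
    show "((\<lambda>g. kl_term (pmf \<mu> g) (pmf \<nu> g)) has_sum h) UNIV"
      using has_sum_pmf[of \<mu>] by (simp add: kl_term_def algebra_simps)
  next
    assume "((\<lambda>g. kl_term (pmf \<mu> g) (pmf \<nu> g)) has_sum h) UNIV"
    from has_sum_add[OF this has_sum_add[OF has_sum_uminus[THEN iffD2] has_sum_pmf[of \<mu>]], of "pmf \<nu>" "-1"]
    show "(?f has_sum h) UNIV"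
      using has_sum_pmf[of \<nu>] by (simp add: kl_term_def algebra_simps)
  qed
  then show ?thesis
    unfolding rel_entropy_def by (auto simp: has_sum_iff)
qed

lemma rel_entropy_nonneg: "rel_entropy \<mu> \<nu> \<ge> 0"
proof (cases "rel_entropy \<mu> \<nu> = \<infinity>")
  case False
  then obtain h where h: "rel_entropy \<mu> \<nu> = ereal h"
    unfolding rel_entropy_def by (auto split: if_splits)
  then have "h \<ge> 0"
    unfolding rel_entropy_eq_iff by (auto intro: has_sum_nonneg kl_term_pmf_nonneg)
  with h show ?thesis by simp
qed simp

text \<open>
  This form passes to pointwise limits of \<open>\<mu>\<close>, because only finite sums occur.
\<close>

lemma rel_entropy_le_iff:
  "rel_entropy \<mu> \<nu> \<le> ereal c \<longleftrightarrow>
     set_pmf \<mu> \<subseteq> set_pmf \<nu> \<and> (\<forall>Y. finite Y \<longrightarrow> (\<Sum>g\<in>Y. kl_term (pmf \<mu> g) (pmf \<nu> g)) \<le> c)"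
    (is "_ \<longleftrightarrow> _ \<and> ?fin")
proof
  assume le: "rel_entropy \<mu> \<nu> \<le> ereal c"
  then obtain h where h: "rel_entropy \<mu> \<nu> = ereal h"
    using rel_entropy_nonneg[of \<mu> \<nu>] by (cases "rel_entropy \<mu> \<nu>") auto
  then have sub: "set_pmf \<mu> \<subseteq> set_pmf \<nu>" 
    and sum: "((\<lambda>g. kl_term (pmf \<mu> g) (pmf \<nu> g)) has_sum h) UNIV"
    unfolding rel_entropy_eq_iff by auto
  have "(\<Sum>g\<in>Y. kl_term (pmf \<mu> g) (pmf \<nu> g)) \<le> c" if "finite Y" for Y
  proof -
    have "(\<Sum>g\<in>Y. kl_term (pmf \<mu> g) (pmf \<nu> g)) \<le> h"
      using sum that by (rule finite_sum_le_has_sum) (auto intro!: kl_term_pmf_nonneg[OF sub])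
    also have "h \<le> c" using le h by simp
    finally show ?thesis .
  qed
  with sub show "set_pmf \<mu> \<subseteq> set_pmf \<nu> \<and> ?fin" by blast
next
  assume asm: "set_pmf \<mu> \<subseteq> set_pmf \<nu> \<and> ?fin"
  let ?k = "\<lambda>g. kl_term (pmf \<mu> g) (pmf \<nu> g)"
  have "?k summable_on UNIV"
    by (rule nonneg_bdd_above_summable_on)
       (use asm in \<open>auto intro!: kl_term_pmf_nonneg bdd_aboveI[of _ c]\<close>)
  then have "(?k has_sum infsum ?k UNIV) UNIV" by simp
  moreover from this have "infsum ?k UNIV \<le> c"
    using asm by (intro infsum_le_finite_sums) (auto simp: has_sum_imp_summable)
  ultimately show "rel_entropy \<mu> \<nu> \<le> ereal c"
    using asm rel_entropy_eq_iff[of \<mu> \<nu> "infsum ?k UNIV"] by simp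
qed

lemma rel_entropy_finite_support:
  assumes "finite \<Gamma>" "set_pmf \<mu> \<subseteq> \<Gamma>" "set_pmf \<mu> \<subseteq> set_pmf \<nu>"
  shows "rel_entropy \<mu> \<nu> = ereal (\<Sum>g\<in>\<Gamma>. pmf \<mu> g * ln (pmf \<mu> g / pmf \<nu> g))"
proof -
  have "((\<lambda>g. pmf \<mu> g * ln (pmf \<mu> g / pmf \<nu> g)) has_sum
          (\<Sum>g\<in>\<Gamma>. pmf \<mu> g * ln (pmf \<mu> g / pmf \<nu> g))) UNIV"
    by (rule has_sum_finite_neutralI) (use assms in \<open>auto simp: set_pmf_iff\<close>)
  then show ?thesis using assms(3) unfolding rel_entropy_def by (auto simp: has_sum_iff)
qed

lemma isCont_xlnx: "isCont (\<lambda>x::real. x * ln x) c"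
proof (cases "c = 0")
  case True
  have *: "((\<lambda>x::real. x * ln x) \<longlongrightarrow> 0) (at_right 0)" by real_asymp
  have "((\<lambda>x::real. (-x) * ln (-x)) \<longlongrightarrow> 0) (at_right 0)"
    unfolding ln_minus using tendsto_minus[OF *] by simp
  then have "((\<lambda>x::real. x * ln x) \<longlongrightarrow> 0) (at_left 0)"
    by (simp add: filterlim_at_left_to_right)
  with * show ?thesis using True by (simp add: isCont_def filterlim_split_at)
next
  case False
  then show ?thesis by (intro continuous_intros) auto
qed

lemma isCont_kl_term: "isCont (\<lambda>u. kl_term u v) c"
proof (cases "v = 0")
  case False
  have eq: "(\<lambda>u. kl_term u v) = (\<lambda>u. v * ((u / v) * ln (u / v)) - u + v)"
    using False by (auto simp: kl_term_def)
  show ?thesis unfolding eq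
    by (intro continuous_add continuous_diff continuous_const continuous_ident
          continuous_mult[OF continuous_const] isCont_o2[OF _ isCont_xlnx] continuous_divide)
       (use False in auto)
qed (simp add: kl_term_def)

section \<open>Words of independent letters\<close>

text \<open>
  A letter describes what happens in one box (global access) or in one slot (local access); its size
  \<open>sz\<close> is the number of attempts and its score \<open>sc\<close> the number of successes. The designated
  letters \<open>letter n\<close> make every total size attainable with positive probability; they absorb
  rounding errors in the lower bound.
\<close>

locale letters =
  fixes \<nu> :: "'g pmf" and sz sc :: "'g \<Rightarrow> nat" and letter :: "nat \<Rightarrow> 'g"
  assumes finite_sz: "finite {g \<in> set_pmf \<nu>. sz g \<le> n}"
    and sc_le_sz: "g \<in> set_pmf \<nu> \<Longrightarrow> sc g \<le> sz g"
    and letter_in: "letter n \<in> set_pmf \<nu>"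
    and sz_letter: "sz (letter n) = n"
    and exp_moment: "(\<lambda>g. pmf \<nu> g * exp (\<theta> * real (sz g))) summable_on UNIV"
begin

definition moments :: "'g pmf \<Rightarrow> real \<Rightarrow> real \<Rightarrow> bool" where
  "moments \<mu> x y \<longleftrightarrow> ((\<lambda>g. pmf \<mu> g * real (sz g)) has_sum x) UNIV \<and>
                     ((\<lambda>g. pmf \<mu> g * real (sc g)) has_sum y) UNIV"

text \<open>
  The rate function of Cramer's theorem for the mean size and the mean score of independent letters,
  written as a contraction of Sanov's rate function.
\<close>

definition J :: "real \<Rightarrow> real \<Rightarrow> ereal" where
  "J x y = Inf {rel_entropy \<mu> \<nu> | \<mu>. moments \<mu> x y}"

lemma J_nonneg: "J x y \<ge> 0"
  unfolding J_def by (auto intro!: Inf_greatest rel_entropy_nonneg)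

text \<open>
  Let \<open>P\<close> be the law of the word conditioned on its totals and \<open>\<mu>\<close> the average of its marginals.
  Then \<open>\<mu>\<close> has the prescribed means, and Gibbs' inequality for \<open>P\<close> against the product
  \<open>\<mu>\<^sup>K\<close> says that \<open>- ln q\<close>, the relative entropy of \<open>P\<close>, is at least \<open>K\<close> times that of
  \<open>\<mu>\<close>. The bound holds without any error term.
\<close>

lemma prob_totals_le:
  assumes I: "finite I" "I \<noteq> {}"
    and q: "q = measure_pmf.prob (Pi_pmf I d (\<lambda>_. \<nu>)) {w. (\<Sum>t\<in>I. sz (w t)) = n \<and> (\<Sum>t\<in>I. sc (w t)) = s}"
    and q_pos: "q > 0"
  shows "\<exists>\<mu> h. moments \<mu> (real n / real (card I)) (real s / real (card I)) \<and>
            rel_entropy \<mu> \<nu> = ereal h \<and> q \<le> exp (- (real (card I) * h))"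
proof -
  let ?Q = "Pi_pmf I d (\<lambda>_. \<nu>)" and ?K = "real (card I)"
  define \<Gamma> where "\<Gamma> = {g \<in> set_pmf \<nu>. sz g \<le> n}"
  define E where "E = {w \<in> PiE_dflt I d (\<lambda>_. \<Gamma>). (\<Sum>t\<in>I. sz (w t)) = n \<and> (\<Sum>t\<in>I. sc (w t)) = s}"
  have K_pos: "?K > 0" using I by (simp add: card_gt_0_iff)
  have fin\<Gamma>: "finite \<Gamma>" unfolding \<Gamma>_def by (rule finite_sz)
  have finE: "finite E" unfolding E_def using I fin\<Gamma> by (auto intro!: finite_subset[OF _ finite_PiE_dflt])
  have in\<Gamma>: "w t \<in> \<Gamma>" if "w \<in> E" "t \<in> I" for w t
    using that by (auto simp: E_def PiE_dflt_def)
  have sub\<nu>: "\<Gamma> \<subseteq> set_pmf \<nu>" by (auto simp: \<Gamma>_def)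
  have \<nu>_pos: "pmf \<nu> g > 0" if "g \<in> \<Gamma>" for g using that sub\<nu> by (auto simp: pmf_positive)
  have pmfQ: "pmf (Pi_pmf I d (\<lambda>_. \<rho>)) w = (\<Prod>t\<in>I. pmf \<rho> (w t))" if "w \<in> E" for w and \<rho> :: "'g pmf"
    using that I by (intro pmf_Pi') (auto simp: E_def PiE_dflt_def)
  have "q = measure_pmf.prob ?Q E"
    unfolding q
  proof (rule measure_prob_cong_0)
    fix w assume w: "w \<in> {w. (\<Sum>t\<in>I. sz (w t)) = n \<and> (\<Sum>t\<in>I. sc (w t)) = s} - E"
    show "pmf ?Q w = 0"
    proof (rule ccontr)
      assume "pmf ?Q w \<noteq> 0"
      then have "w \<in> PiE_dflt I d (\<lambda>_. set_pmf \<nu>)"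
        using I set_Pi_pmf[of I d "\<lambda>_. \<nu>"] by (auto simp: set_pmf_iff o_def)
      moreover have "sz (w t) \<le> n" if "t \<in> I" for t
        using that w member_le_sum[of t I "\<lambda>t. sz (w t)"] I by auto
      ultimately have "w \<in> PiE_dflt I d (\<lambda>_. \<Gamma>)" by (auto simp: PiE_dflt_def \<Gamma>_def)
      with w show False by (auto simp: E_def)
    qed
  qed (auto simp: E_def)
  then have q_sum: "q = (\<Sum>w\<in>E. \<Prod>t\<in>I. pmf \<nu> (w t))"
    using finE by (simp add: measure_measure_pmf_finite pmfQ)
  define P where "P w = (\<Prod>t\<in>I. pmf \<nu> (w t)) / q" for w
  have P_pos: "P w > 0" if "w \<in> E" for w
    unfolding P_def using q_pos that by (auto intro!: divide_pos_pos prod_pos \<nu>_pos in\<Gamma>)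
  have P_sum: "(\<Sum>w\<in>E. P w) = 1"
    unfolding P_def using q_pos q_sum by (simp flip: sum_divide_distrib)
  \<comment> \<open>\<open>m\<close> is the average over \<open>t\<close> of the law of \<open>w t\<close> under \<open>P\<close>.\<close>
  define m where "m g = (\<Sum>w\<in>E. P w * (\<Sum>t\<in>I. of_bool (w t = g))) / ?K" for g
  have m_sum: "(\<Sum>g\<in>\<Gamma>. m g * f g) = (\<Sum>w\<in>E. P w * (\<Sum>t\<in>I. f (w t))) / ?K" for f :: "'g \<Rightarrow> real"
  proof -
    have "(\<Sum>g\<in>\<Gamma>. m g * f g) = (\<Sum>g\<in>\<Gamma>. \<Sum>w\<in>E. \<Sum>t\<in>I. P w * (of_bool (w t = g) * f g)) / ?K"
      unfolding m_def by (simp add: sum_divide_distrib sum_distrib_left sum_distrib_right mult_ac)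
    also have "(\<Sum>g\<in>\<Gamma>. \<Sum>w\<in>E. \<Sum>t\<in>I. P w * (of_bool (w t = g) * f g)) =
        (\<Sum>w\<in>E. \<Sum>t\<in>I. \<Sum>g\<in>\<Gamma>. P w * (of_bool (w t = g) * f g))"
      by (subst sum.swap, intro sum.cong refl, subst sum.swap, simp)
    also have "\<dots> = (\<Sum>w\<in>E. \<Sum>t\<in>I. P w * f (w t))"
    proof (intro sum.cong refl)
      fix w t assume "w \<in> E" "t \<in> I"
      then have "w t \<in> \<Gamma>" by (rule in\<Gamma>)
      moreover have "(\<Sum>g\<in>\<Gamma>. P w * (of_bool (w t = g) * f g)) = (\<Sum>g\<in>\<Gamma>. if g = w t then P w * f g else 0)"
        by (intro sum.cong) auto
      ultimately show "(\<Sum>g\<in>\<Gamma>. P w * (of_bool (w t = g) * f g)) = P w * f (w t)"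
        using fin\<Gamma> by simp
    qed
    finally show ?thesis by (simp add: sum_distrib_left)
  qed
  have m_nonneg: "m g \<ge> 0" for g
    unfolding m_def by (intro divide_nonneg_nonneg sum_nonneg mult_nonneg_nonneg less_imp_le[OF P_pos]) auto
  have m_out: "m g = 0" if "g \<notin> \<Gamma>" for g
  proof -
    have "w t \<noteq> g" if "w \<in> E" "t \<in> I" for w t using in\<Gamma>[OF that] \<open>g \<notin> \<Gamma>\<close> by auto
    then show ?thesis unfolding m_def by (auto intro!: sum.neutral)
  qed
  have "(m has_sum 1) UNIV"
    by (rule has_sum_finite_neutralI[OF fin\<Gamma>])
       (use m_out m_sum[of "\<lambda>_. 1"] P_sum K_pos in \<open>simp_all flip: sum_distrib_right\<close>)
  then obtain \<mu> where \<mu>: "pmf \<mu> = m" using ex_pmf_of_has_sum[of m] m_nonneg by blast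
  have sub: "set_pmf \<mu> \<subseteq> \<Gamma>" by (rule subsetI, rule ccontr) (simp add: set_pmf_iff m_out \<mu>)
  have mom: "((\<lambda>g. pmf \<mu> g * real (f g)) has_sum (real k / ?K)) UNIV"
    if "\<And>w. w \<in> E \<Longrightarrow> (\<Sum>t\<in>I. f (w t)) = k" for f :: "'g \<Rightarrow> nat" and k
  proof (rule has_sum_finite_neutralI[OF fin\<Gamma>])
    have "(\<Sum>w\<in>E. P w * (\<Sum>t\<in>I. real (f (w t)))) = (\<Sum>w\<in>E. P w * real k)"
      by (intro sum.cong refl) (simp add: that flip: of_nat_sum)
    then show "real k / ?K = (\<Sum>g\<in>\<Gamma>. pmf \<mu> g * real (f g))"
      using m_sum[of "\<lambda>g. real (f g)"] P_sum by (simp add: \<mu> flip: sum_distrib_right)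
  qed (use m_out \<mu> in auto)
  have moments: "moments \<mu> (real n / ?K) (real s / ?K)"
    unfolding moments_def by (intro conjI mom) (auto simp: E_def)
  define h where "h = (\<Sum>g\<in>\<Gamma>. pmf \<mu> g * ln (pmf \<mu> g / pmf \<nu> g))"
  have ent: "rel_entropy \<mu> \<nu> = ereal h"
    unfolding h_def using fin\<Gamma> sub sub\<nu> by (intro rel_entropy_finite_support) auto
  have \<mu>_pos: "pmf \<mu> (w t) > 0" if w: "w \<in> E" "t \<in> I" for w t
  proof -
    have "0 < P w * of_bool (w t = w t)" using P_pos w by simp
    also have "\<dots> \<le> P w * (\<Sum>t'\<in>I. of_bool (w t' = w t))"
      using P_pos[OF w(1)] I w by (intro mult_left_mono member_le_sum) auto
    also have "\<dots> \<le> (\<Sum>w'\<in>E. P w' * (\<Sum>t'\<in>I. of_bool (w' t' = w t)))"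
      using P_pos finE w
      by (intro member_le_sum[of w E "\<lambda>w'. P w' * (\<Sum>t'\<in>I. of_bool (w' t' = w t))"])
         (auto intro!: mult_nonneg_nonneg sum_nonneg simp: less_imp_le)
    finally show ?thesis unfolding \<mu> m_def using K_pos by simp
  qed
  \<comment> \<open>Gibbs' inequality is the nonnegativity of \<open>kl_term\<close>, summed over the words in \<open>E\<close>.\<close>
  have "(\<Sum>w\<in>E. \<Prod>t\<in>I. pmf \<mu> (w t)) = measure_pmf.prob (Pi_pmf I d (\<lambda>_. \<mu>)) E"
    using finE by (simp add: measure_measure_pmf_finite pmfQ)
  then have "(\<Sum>w\<in>E. \<Prod>t\<in>I. pmf \<mu> (w t)) \<le> 1" by simp
  then have "0 \<le> (\<Sum>w\<in>E. P w - (\<Prod>t\<in>I. pmf \<mu> (w t)))"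
    using P_sum by (simp add: sum_subtractf)
  also have "\<dots> \<le> (\<Sum>w\<in>E. P w * (- ln q) + P w * (\<Sum>t\<in>I. ln (pmf \<nu> (w t)) - ln (pmf \<mu> (w t))))"
  proof (rule sum_mono)
    fix w assume w: "w \<in> E"
    let ?p = "\<Prod>t\<in>I. pmf \<mu> (w t)"
    have p: "?p > 0" using \<mu>_pos w by (intro prod_pos) auto
    have "0 \<le> kl_term (P w) ?p" by (rule kl_term_nonneg) (use P_pos[OF w] p in auto)
    also have "\<dots> = P w * (ln (P w) - ln ?p) - (P w - ?p)"
      using P_pos[OF w] p by (simp add: kl_term_def ln_div)
    also have "ln (P w) = (\<Sum>t\<in>I. ln (pmf \<nu> (w t))) - ln q"
    proof -
      have "(\<Prod>t\<in>I. pmf \<nu> (w t)) > 0" using w by (intro prod_pos) (auto intro!: \<nu>_pos in\<Gamma>)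
      moreover have "ln (\<Prod>t\<in>I. pmf \<nu> (w t)) = (\<Sum>t\<in>I. ln (pmf \<nu> (w t)))"
        using w I(1) by (intro ln_prod) (use \<nu>_pos[OF in\<Gamma>[OF w]] in force)+
      ultimately show ?thesis unfolding P_def using q_pos by (simp add: ln_div)
    qed
    also have "ln ?p = (\<Sum>t\<in>I. ln (pmf \<mu> (w t)))"
      using w I(1) by (intro ln_prod) (use \<mu>_pos[OF w] in force)+
    finally show "P w - ?p \<le> P w * (- ln q) + P w * (\<Sum>t\<in>I. ln (pmf \<nu> (w t)) - ln (pmf \<mu> (w t)))"
      by (simp add: sum_subtractf algebra_simps)
  qed
  also have "\<dots> = - ln q + (\<Sum>w\<in>E. P w * (\<Sum>t\<in>I. ln (pmf \<nu> (w t)) - ln (pmf \<mu> (w t))))"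
    using P_sum sum_distrib_right[of P E "ln q", symmetric] by (simp add: sum.distrib sum_subtractf sum_negf)
  also have "(\<Sum>w\<in>E. P w * (\<Sum>t\<in>I. ln (pmf \<nu> (w t)) - ln (pmf \<mu> (w t)))) =
      ?K * (\<Sum>g\<in>\<Gamma>. pmf \<mu> g * (ln (pmf \<nu> g) - ln (pmf \<mu> g)))"
    using m_sum[of "\<lambda>g. ln (pmf \<nu> g) - ln (pmf \<mu> g)"] K_pos by (simp add: \<mu>)
  also have "(\<Sum>g\<in>\<Gamma>. pmf \<mu> g * (ln (pmf \<nu> g) - ln (pmf \<mu> g))) = - h"
    unfolding h_def sum_negf[symmetric]
  proof (intro sum.cong refl)
    fix g assume "g \<in> \<Gamma>"
    then show "pmf \<mu> g * (ln (pmf \<nu> g) - ln (pmf \<mu> g)) = - (pmf \<mu> g * ln (pmf \<mu> g / pmf \<nu> g))"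
      using \<nu>_pos[of g] by (cases "pmf \<mu> g = 0") (auto simp: ln_div algebra_simps)
  qed
  finally have "ln q \<le> - (?K * h)" by simp
  then have "q \<le> exp (- (?K * h))" using q_pos by (metis exp_le_cancel_iff exp_ln)
  with moments ent show ?thesis by blast
qed

end

section \<open>Lower semicontinuity of the rate function\<close>

context letters
begin

text \<open>
  Measures of bounded entropy have uniformly integrable sizes. Young's inequality with slope \<open>\<theta>\<close>
  bounds \<open>\<theta>\<close> times the tail mean by the entropy plus a tail of an exponential moment of \<open>\<nu>\<close>;
  one chooses \<open>\<theta>\<close> large and then the tail far out.
\<close>

lemma entropy_tail:
  assumes "\<epsilon> > 0" "v \<ge> 0"
  shows "\<exists>R. \<forall>\<mu> Y. rel_entropy \<mu> \<nu> \<le> ereal v \<longrightarrow> finite Y \<longrightarrow> (\<forall>g\<in>Y. sz g > R) \<longrightarrow>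
           (\<Sum>g\<in>Y. pmf \<mu> g * real (sz g)) \<le> \<epsilon>"
proof -
  define \<theta> where "\<theta> = (v + 1) / \<epsilon>"
  have \<theta>: "\<theta> > 0" unfolding \<theta>_def using assms by simp
  let ?e = "\<lambda>g. pmf \<nu> g * exp (\<theta> * real (sz g))"
  have sum: "(?e has_sum infsum ?e UNIV) UNIV" using exp_moment by simp
  obtain Y0 where Y0: "finite Y0" "dist (sum ?e Y0) (infsum ?e UNIV) \<le> 1"
    using has_sum_finite_approximation[OF sum, of 1] by auto
  define R where "R = (\<Sum>g\<in>Y0. sz g)"
  have "(\<Sum>g\<in>Y. pmf \<mu> g * real (sz g)) \<le> \<epsilon>"
    if ent: "rel_entropy \<mu> \<nu> \<le> ereal v" and Y: "finite Y" "\<forall>g\<in>Y. sz g > R" for \<mu> Y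
  proof -
    have disj: "Y0 \<inter> Y = {}"
      using Y(2) member_le_sum[of _ Y0 sz] Y0(1) by (fastforce simp: R_def)
    have "sum ?e (Y0 \<union> Y) \<le> infsum ?e UNIV"
      using sum Y0(1) Y(1) by (intro finite_sum_le_has_sum) auto
    then have tail: "sum ?e Y \<le> 1"
      using Y0 Y(1) disj by (simp add: sum.union_disjoint dist_real_def)
    have sub: "set_pmf \<mu> \<subseteq> set_pmf \<nu>" and kl: "(\<Sum>g\<in>Y. kl_term (pmf \<mu> g) (pmf \<nu> g)) \<le> v"
      using ent Y(1) unfolding rel_entropy_le_iff by auto
    have "(\<Sum>g\<in>Y. pmf \<mu> g * (\<theta> * real (sz g))) \<le> (\<Sum>g\<in>Y. kl_term (pmf \<mu> g) (pmf \<nu> g) + ?e g)"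
    proof (rule sum_mono)
      fix g
      show "pmf \<mu> g * (\<theta> * real (sz g)) \<le> kl_term (pmf \<mu> g) (pmf \<nu> g) + ?e g"
      proof (cases "g \<in> set_pmf \<nu>")
        case True
        then have "pmf \<mu> g * (\<theta> * real (sz g)) \<le>
            kl_term (pmf \<mu> g) (pmf \<nu> g) + pmf \<nu> g * (exp (\<theta> * real (sz g)) - 1)"
          by (intro kl_term_young) (auto simp: pmf_positive)
        then show ?thesis using pmf_nonneg[of \<nu> g] unfolding right_diff_distrib by linarith
      next
        case False
        then have "pmf \<mu> g = 0" "pmf \<nu> g = 0" using sub by (auto simp: set_pmf_iff)
        then show ?thesis by (simp add: kl_term_def)
      qed
    qed
    also have "\<dots> \<le> v + 1" using kl tail by (simp add: sum.distrib)
    also have "(\<Sum>g\<in>Y. pmf \<mu> g * (\<theta> * real (sz g))) = \<theta> * (\<Sum>g\<in>Y. pmf \<mu> g * real (sz g))"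
      by (simp add: sum_distrib_left mult_ac)
    finally have "(\<Sum>g\<in>Y. pmf \<mu> g * real (sz g)) \<le> (v + 1) / \<theta>"
      using \<theta> by (simp add: field_simps)
    also have "\<dots> = \<epsilon>" using assms by (simp add: \<theta>_def)
    finally show ?thesis .
  qed
  then show ?thesis by blast
qed

text \<open>
  By Tychonoff's theorem the densities have a cluster point \<open>f\<close> for pointwise convergence; the filter
  \<open>F\<close> below consists of the indices along which they converge to it. Uniform integrability keeps
  total mass and both means in the limit, and the entropy is lower semicontinuous as a supremum of
  continuous functions.
\<close>

lemma entropy_level_compact:
  fixes \<mu> :: "nat \<Rightarrow> 'g pmf"
  assumes mom: "\<And>k. moments (\<mu> k) (x k) (y k)" and ent: "\<And>k. rel_entropy (\<mu> k) \<nu> \<le> ereal v"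
    and xlim: "x \<longlonglongrightarrow> X" and ylim: "y \<longlonglongrightarrow> Y"
  shows "\<exists>\<rho>. moments \<rho> X Y \<and> rel_entropy \<rho> \<nu> \<le> ereal v"
proof -
  define U where "U = PiE (UNIV :: 'g set) (\<lambda>_. {0..1 :: real})"
  have "compactin (product_topology (\<lambda>_::'g. euclidean :: real topology) UNIV) U"
    unfolding U_def compactin_PiE by simp
  then have U: "compact U" by (simp add: euclidean_product_topology)
  let ?m = "\<lambda>k. pmf (\<mu> k)"
  have inU: "?m k \<in> U" for k by (auto simp: U_def pmf_le_1)
  obtain f where f: "f \<in> U" "inf (nhds f) (filtermap ?m sequentially) \<noteq> bot"
    using U[unfolded compact_filter, rule_format, of "filtermap ?m sequentially"] inU
    by (auto simp: filtermap_bot_iff eventually_filtermap)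
  define F where "F = inf sequentially (filtercomap ?m (nhds f))"
  have F: "F \<noteq> bot"
  proof
    assume "F = bot"
    then have "eventually (\<lambda>_. False) F" by simp
    then obtain P Q where PQ: "eventually P sequentially" "eventually Q (filtercomap ?m (nhds f))"
      "\<And>k. P k \<Longrightarrow> Q k \<Longrightarrow> False"
      unfolding F_def eventually_inf by blast
    then obtain S where S: "eventually S (nhds f)" "\<And>k. S (?m k) \<Longrightarrow> Q k"
      unfolding eventually_filtercomap by blast
    have "eventually (\<lambda>h. \<not> S h) (filtermap ?m sequentially)"
      unfolding eventually_filtermap using PQ(1) by eventually_elim (use PQ(3) S(2) in blast)
    then have "eventually (\<lambda>_. False) (inf (nhds f) (filtermap ?m sequentially))"
      unfolding eventually_inf using S(1) by blast
    then show False using f(2) by (simp add: eventually_False)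
  qed
  have lim: "((\<lambda>k. ?m k g) \<longlongrightarrow> f g) F" for g
  proof -
    have "filterlim ?m (nhds f) F"
      unfolding F_def by (intro filterlim_mono[OF filterlim_filtercomap order_refl] inf_le2)
    moreover have "((\<lambda>h::'g \<Rightarrow> real. h g) \<longlongrightarrow> f g) (nhds f)"
    proof (rule topological_tendstoI)
      fix S :: "real set" assume "open S" "f g \<in> S"
      then show "eventually (\<lambda>h. h g \<in> S) (nhds f)"
        using open_vimage[OF _ continuous_on_product_coordinates[of g], of S]
        by (auto simp: eventually_nhds)
    qed
    ultimately show ?thesis by (rule filterlim_compose[rotated])
  qed
  have Fseq: "F \<le> sequentially" by (simp add: F_def)
  have v: "v \<ge> 0" using order_trans[OF rel_entropy_nonneg[of "\<mu> 0" \<nu>] ent[of 0]] by simp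
  have sub: "set_pmf (\<mu> k) \<subseteq> set_pmf \<nu>" for k using ent[of k] by (simp add: rel_entropy_le_iff)
  have limit_sum: "((\<lambda>g. f g * h g) has_sum Z) UNIV"
    if h: "\<And>g. h g \<ge> 0" "\<And>g. g \<in> set_pmf \<nu> \<Longrightarrow> sz g \<ge> 1 \<Longrightarrow> h g \<le> real (sz g)"
      and hs: "\<And>k. ((\<lambda>g. ?m k g * h g) has_sum z k) UNIV" and z: "z \<longlonglongrightarrow> Z"
    for h :: "'g \<Rightarrow> real" and z Z
    unfolding has_sum_def tendsto_iff eventually_finite_subsets_at_top
  proof (intro allI impI)
    fix \<epsilon> :: real assume \<epsilon>: "\<epsilon> > 0"
    obtain R where R: "\<And>k W. finite W \<Longrightarrow> \<forall>g\<in>W. sz g > R \<Longrightarrow> (\<Sum>g\<in>W. ?m k g * real (sz g)) \<le> \<epsilon> / 2"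
      using entropy_tail[of "\<epsilon> / 2" v] \<epsilon> v ent by (metis half_gt_zero)
    define Y0 where "Y0 = {g \<in> set_pmf \<nu>. sz g \<le> R}"
    have "dist (\<Sum>g\<in>W. f g * h g) Z < \<epsilon>" if W: "finite W" "Y0 \<subseteq> W" for W
    proof -
      have "\<bar>(\<Sum>g\<in>W. ?m k g * h g) - z k\<bar> \<le> \<epsilon> / 2" for k
      proof -
        have "(\<Sum>g\<in>W. ?m k g * h g) \<le> z k"
          using hs W(1) by (rule finite_sum_le_has_sum) (auto intro: mult_nonneg_nonneg h(1))
        moreover have "z k \<le> (\<Sum>g\<in>W. ?m k g * h g) + \<epsilon> / 2"
          using hs
        proof (rule has_sum_le_finite_sums)
          fix V :: "'g set" assume V: "finite V"
          let ?V = "(V - W) \<inter> set_pmf \<nu>"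
          have "(\<Sum>g\<in>V. ?m k g * h g) = (\<Sum>g\<in>V \<inter> set_pmf \<nu>. ?m k g * h g)"
            using V sub[of k] by (intro sum.mono_neutral_right) (auto simp: set_pmf_iff)
          also have "\<dots> \<le> (\<Sum>g\<in>W \<union> ?V. ?m k g * h g)"
            using V W(1) by (intro sum_mono2) (auto intro!: mult_nonneg_nonneg h(1))
          also have "\<dots> = (\<Sum>g\<in>W. ?m k g * h g) + (\<Sum>g\<in>?V. ?m k g * h g)"
            using V W(1) by (intro sum.union_disjoint) auto
          also have "(\<Sum>g\<in>?V. ?m k g * h g) \<le> (\<Sum>g\<in>?V. ?m k g * real (sz g))"
            using W(2) by (intro sum_mono mult_left_mono h(2)) (auto simp: Y0_def)
          also have "\<dots> \<le> \<epsilon> / 2"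
            using V W(2) by (intro R) (auto simp: Y0_def not_le)
          finally show "(\<Sum>g\<in>V. ?m k g * h g) \<le> (\<Sum>g\<in>W. ?m k g * h g) + \<epsilon> / 2" by simp
        qed
        ultimately show ?thesis using \<epsilon> by (auto simp: abs_le_iff)
      qed
      moreover have "((\<lambda>k. \<bar>(\<Sum>g\<in>W. ?m k g * h g) - z k\<bar>) \<longlongrightarrow> \<bar>(\<Sum>g\<in>W. f g * h g) - Z\<bar>) F"
        by (intro tendsto_intros lim tendsto_mono[OF Fseq z])
      ultimately have "\<bar>(\<Sum>g\<in>W. f g * h g) - Z\<bar> \<le> \<epsilon> / 2"
        using F by (intro tendsto_upperbound) auto
      then show ?thesis using \<epsilon> by (simp add: dist_real_def)
    qed
    then show "\<exists>X. finite X \<and> X \<subseteq> UNIV \<and>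
        (\<forall>W. finite W \<and> X \<subseteq> W \<and> W \<subseteq> UNIV \<longrightarrow> dist (\<Sum>g\<in>W. f g * h g) Z < \<epsilon>)"
      using finite_sz[of R] unfolding Y0_def by blast
  qed
  have "((\<lambda>g. f g * 1) has_sum 1) UNIV"
    by (rule limit_sum[where z = "\<lambda>_. 1"]) (auto simp: has_sum_pmf)
  moreover have f0: "f g \<ge> 0" for g using f(1) by (auto simp: U_def PiE_iff)
  ultimately obtain \<rho> where \<rho>: "pmf \<rho> = f" using ex_pmf_of_has_sum[of f] by auto
  have "moments \<rho> X Y"
    unfolding moments_def \<rho>
  proof
    show "((\<lambda>g. f g * real (sz g)) has_sum X) UNIV"
      by (rule limit_sum[OF _ _ _ xlim]) (use mom in \<open>auto simp: moments_def\<close>)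
    show "((\<lambda>g. f g * real (sc g)) has_sum Y) UNIV"
      by (rule limit_sum[OF _ _ _ ylim]) (use mom sc_le_sz in \<open>auto simp: moments_def\<close>)
  qed
  moreover have "rel_entropy \<rho> \<nu> \<le> ereal v"
    unfolding rel_entropy_le_iff
  proof (intro conjI allI impI subsetI)
    fix g assume "g \<in> set_pmf \<rho>"
    show "g \<in> set_pmf \<nu>"
    proof (rule ccontr)
      assume "g \<notin> set_pmf \<nu>"
      then have "?m k g = 0" for k using sub[of k] by (auto simp: set_pmf_iff)
      then have "f g = 0" using lim[of g] F by (simp add: tendsto_const_iff)
      then show False using \<open>g \<in> set_pmf \<rho>\<close> \<rho> by (simp add: set_pmf_iff)
    qed
  next
    fix W :: "'g set" assume W: "finite W"
    have "((\<lambda>k. \<Sum>g\<in>W. kl_term (?m k g) (pmf \<nu> g)) \<longlongrightarrow> (\<Sum>g\<in>W. kl_term (f g) (pmf \<nu> g))) F"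
      by (intro tendsto_sum isCont_tendsto_compose[OF isCont_kl_term] lim)
    then show "(\<Sum>g\<in>W. kl_term (pmf \<rho> g) (pmf \<nu> g)) \<le> v"
      unfolding \<rho> by (rule tendsto_upperbound) (use F ent W in \<open>auto simp: rel_entropy_le_iff\<close>)
  qed
  ultimately show ?thesis by blast
qed

lemma J_lower_semicontinuous:
  assumes v: "ereal v < J x y"
  shows "\<exists>\<delta>>0. \<forall>x' y'. \<bar>x' - x\<bar> < \<delta> \<longrightarrow> \<bar>y' - y\<bar> < \<delta> \<longrightarrow> ereal v < J x' y'"
proof (rule ccontr)
  assume neg: "\<not> ?thesis"
  obtain v' where v': "v < v'" "ereal v' < J x y"
    using ereal_dense2[OF v] by auto
  have "\<exists>x' y' \<mu>. \<bar>x' - x\<bar> < 1 / real (Suc k) \<and> \<bar>y' - y\<bar> < 1 / real (Suc k) \<and>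
          moments \<mu> x' y' \<and> rel_entropy \<mu> \<nu> \<le> ereal v'" for k
  proof -
    from neg have "\<exists>x' y'. \<bar>x' - x\<bar> < 1 / real (Suc k) \<and> \<bar>y' - y\<bar> < 1 / real (Suc k) \<and> \<not> ereal v < J x' y'"
      by (metis of_nat_0_less_iff zero_less_Suc zero_less_divide_1_iff)
    then obtain x' y' where xy: "\<bar>x' - x\<bar> < 1 / real (Suc k)" "\<bar>y' - y\<bar> < 1 / real (Suc k)"
      "J x' y' \<le> ereal v" by (auto simp: not_less)
    then have "J x' y' < ereal v'" using v'(1) by (auto intro: le_less_trans)
    then obtain \<mu> where "moments \<mu> x' y'" "rel_entropy \<mu> \<nu> < ereal v'"
      unfolding J_def Inf_less_iff by auto
    with xy show ?thesis by (blast intro: less_imp_le)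
  qed
  then obtain x' y' \<mu> where seq: "\<And>k. \<bar>x' k - x\<bar> < 1 / real (Suc k)" "\<And>k. \<bar>y' k - y\<bar> < 1 / real (Suc k)"
      "\<And>k. moments (\<mu> k) (x' k) (y' k)" "\<And>k. rel_entropy (\<mu> k) \<nu> \<le> ereal v'"
    by metis
  have conv: "z \<longlonglongrightarrow> l" if "\<And>k. \<bar>z k - l\<bar> < 1 / real (Suc k)" for z :: "nat \<Rightarrow> real" and l
    using that LIMSEQ_Suc[OF lim_1_over_n[where 'a = real]]
    by (intro Lim_transform_bound[of "\<lambda>k. z k - l", THEN LIM_zero_cancel]) (auto intro!: always_eventually less_imp_le)
  obtain \<rho> where "moments \<rho> x y" "rel_entropy \<rho> \<nu> \<le> ereal v'"
    using entropy_level_compact[OF seq(3,4) conv[OF seq(1)] conv[OF seq(2)]] by blast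
  then have "J x y \<le> ereal v'" unfolding J_def by (auto intro: Inf_lower2)
  with v'(2) show False by simp
qed

end

section \<open>Multinomial law and Stirling's formula\<close>

text \<open>
  Induction on the index set: revealing the letter at one more index lowers the count of this letter
  by one, and the factors \<open>x y\<close> that arise add up to the number of indices. The law serves twice,
  for the words of a given composition and for the occupation numbers of the access model. It is
  stated without division.
\<close>

lemma multinomial_law:
  assumes "finite I" "finite \<Gamma>" "(\<Sum>b\<in>\<Gamma>. x b) = card I"
  shows "measure_pmf.prob (Pi_pmf I d (\<lambda>_. \<rho>)) {w. \<forall>b\<in>\<Gamma>. card {e\<in>I. w e = b} = x b} * (\<Prod>b\<in>\<Gamma>. fact (x b))
           = fact (card I) * (\<Prod>b\<in>\<Gamma>. pmf \<rho> b ^ x b)"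
  using assms(1,3)
proof (induction I arbitrary: x rule: finite_induct)
  case empty
  then have "\<forall>b\<in>\<Gamma>. x b = 0" using assms(2) by simp
  then show ?case by simp
next
  case (insert e I)
  let ?ev = "\<lambda>I x. {w. \<forall>b\<in>\<Gamma>. card {e\<in>I. w e = b} = x b}"
  let ?P = "Pi_pmf I d (\<lambda>_. \<rho>)"
  let ?p = "\<lambda>y. measure_pmf.prob (map_pmf (\<lambda>f. f(e := y)) ?P) (?ev (insert e I) x)"
  have card_ins: "card {e' \<in> insert e I. (f(e := y)) e' = b} = of_bool (y = b) + card {e'\<in>I. f e' = b}" for f y b
  proof -
    have "{e' \<in> insert e I. (f(e := y)) e' = b} = (if y = b then insert e {e'\<in>I. f e' = b} else {e'\<in>I. f e' = b})"
      using insert.hyps by auto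
    then show ?thesis using insert.hyps by auto
  qed
  have count_le: "(\<Sum>b\<in>\<Gamma>. card {e'\<in>I. f e' = b}) \<le> card I" for f
  proof -
    have "(\<Sum>b\<in>\<Gamma>. card {e'\<in>I. f e' = b}) = card (\<Union>b\<in>\<Gamma>. {e'\<in>I. f e' = b})"
      using insert.hyps assms(2) by (intro card_UN_disjoint[symmetric]) auto
    also have "\<dots> \<le> card I" using insert.hyps by (intro card_mono) auto
    finally show ?thesis .
  qed
  have p: "?p y = measure_pmf.prob ?P {f. \<forall>b\<in>\<Gamma>. of_bool (y = b) + card {e'\<in>I. f e' = b} = x b}" for y
    unfolding measure_map_pmf vimage_def mem_Collect_eq card_ins ..
  have p_out: "?p y = 0" if "y \<notin> \<Gamma>" for y
  proof -
    have False if a: "\<forall>b\<in>\<Gamma>. of_bool (y = b) + card {e'\<in>I. f e' = b} = x b" for f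
    proof -
      have "(\<Sum>b\<in>\<Gamma>. x b) = (\<Sum>b\<in>\<Gamma>. card {e'\<in>I. f e' = b})"
      proof (intro sum.cong refl)
        fix b assume b: "b \<in> \<Gamma>"
        then have "y \<noteq> b" using \<open>y \<notin> \<Gamma>\<close> by auto
        then show "x b = card {e'\<in>I. f e' = b}" using bspec[OF a b] by simp
      qed
      also have "\<dots> \<le> card I" by (rule count_le)
      finally show False unfolding insert.prems card_insert_disjoint[OF insert.hyps] by simp
    qed
    then have "{f. \<forall>b\<in>\<Gamma>. of_bool (y = b) + card {e'\<in>I. f e' = b} = x b} = {}" by blast
    then show ?thesis unfolding p by (simp only: measure_empty)
  qed
  have p_in: "pmf \<rho> y * ?p y * (\<Prod>b\<in>\<Gamma>. fact (x b)) =
      real (x y) * (fact (card I) * (\<Prod>b\<in>\<Gamma>. pmf \<rho> b ^ x b))" if y: "y \<in> \<Gamma>" for y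
  proof (cases "x y = 0")
    case True
    have False if a: "\<forall>b\<in>\<Gamma>. of_bool (y = b) + card {e'\<in>I. f e' = b} = x b" for f
      using bspec[OF a y] True by simp
    then have "{f. \<forall>b\<in>\<Gamma>. of_bool (y = b) + card {e'\<in>I. f e' = b} = x b} = {}" by blast
    then show ?thesis unfolding p True by (simp only: measure_empty of_nat_0 mult_zero_left mult_zero_right)
  next
    case False
    define x' where "x' = x(y := x y - 1)"
    have "of_bool (y = b) + c = x b \<longleftrightarrow> c = x' b" for b c
      using False by (auto simp: x'_def)
    then have "{f. \<forall>b\<in>\<Gamma>. of_bool (y = b) + card {e'\<in>I. f e' = b} = x b} = ?ev I x'"
      by (simp only:)
    then have py: "?p y = measure_pmf.prob ?P (?ev I x')" unfolding p by (rule arg_cong)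
    have rem: "(\<Sum>b\<in>\<Gamma>. x b) = x y + (\<Sum>b\<in>\<Gamma>-{y}. x b)"
      "(\<Sum>b\<in>\<Gamma>. x' b) = x' y + (\<Sum>b\<in>\<Gamma>-{y}. x' b)"
      using y assms(2) by (auto intro: sum.remove)
    have "(\<Sum>b\<in>\<Gamma>-{y}. x' b) = (\<Sum>b\<in>\<Gamma>-{y}. x b)" by (intro sum.cong) (auto simp: x'_def)
    then have sum': "(\<Sum>b\<in>\<Gamma>. x' b) = card I"
      using rem insert.prems insert.hyps False by (simp add: x'_def)
    have "(\<Prod>b\<in>\<Gamma>. fact (x b) :: real) = fact (x y) * (\<Prod>b\<in>\<Gamma>-{y}. fact (x b))"
      "(\<Prod>b\<in>\<Gamma>. fact (x' b) :: real) = fact (x' y) * (\<Prod>b\<in>\<Gamma>-{y}. fact (x' b))"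
      using y assms(2) by (auto intro: prod.remove)
    moreover have "(\<Prod>b\<in>\<Gamma>-{y}. fact (x' b) :: real) = (\<Prod>b\<in>\<Gamma>-{y}. fact (x b))"
      by (intro prod.cong) (auto simp: x'_def)
    moreover have "(fact (x y) :: real) = real (x y) * fact (x' y)"
      using False by (simp add: x'_def fact_reduce)
    ultimately have f: "(\<Prod>b\<in>\<Gamma>. fact (x b) :: real) = real (x y) * (\<Prod>b\<in>\<Gamma>. fact (x' b))"
      by simp
    have "(\<Prod>b\<in>\<Gamma>. pmf \<rho> b ^ x b) = pmf \<rho> y ^ x y * (\<Prod>b\<in>\<Gamma>-{y}. pmf \<rho> b ^ x b)"
      "(\<Prod>b\<in>\<Gamma>. pmf \<rho> b ^ x' b) = pmf \<rho> y ^ x' y * (\<Prod>b\<in>\<Gamma>-{y}. pmf \<rho> b ^ x' b)"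
      using y assms(2) by (auto intro: prod.remove)
    moreover have "(\<Prod>b\<in>\<Gamma>-{y}. pmf \<rho> b ^ x' b) = (\<Prod>b\<in>\<Gamma>-{y}. pmf \<rho> b ^ x b)"
      by (intro prod.cong) (auto simp: x'_def)
    moreover have "pmf \<rho> y ^ x y = pmf \<rho> y * pmf \<rho> y ^ x' y"
      using False by (cases "x y") (simp_all add: x'_def)
    ultimately have g: "(\<Prod>b\<in>\<Gamma>. pmf \<rho> b ^ x b) = pmf \<rho> y * (\<Prod>b\<in>\<Gamma>. pmf \<rho> b ^ x' b)"
      by simp
    have "pmf \<rho> y * ?p y * (\<Prod>b\<in>\<Gamma>. fact (x b)) =
        pmf \<rho> y * real (x y) * (measure_pmf.prob ?P (?ev I x') * (\<Prod>b\<in>\<Gamma>. fact (x' b)))"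
      unfolding f py by (simp add: mult_ac)
    also have "\<dots> = pmf \<rho> y * real (x y) * (fact (card I) * (\<Prod>b\<in>\<Gamma>. pmf \<rho> b ^ x' b))"
      by (subst insert.IH[OF sum']) (rule refl)
    finally show ?thesis unfolding g by (simp add: mult_ac)
  qed
  have "measure_pmf.prob (Pi_pmf (insert e I) d (\<lambda>_. \<rho>)) (?ev (insert e I) x) = measure_pmf.expectation \<rho> ?p"
    using insert.hyps by (simp add: Pi_pmf_insert' prob_bind_pmf flip: map_pmf_def)
  also have "\<dots> = (\<Sum>y\<in>\<Gamma>. ?p y * pmf \<rho> y)"
    by (rule integral_measure_pmf_real[OF assms(2)]) (rule ccontr, erule notE, rule p_out)
  finally have sum: "measure_pmf.prob (Pi_pmf (insert e I) d (\<lambda>_. \<rho>)) (?ev (insert e I) x) =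
      (\<Sum>y\<in>\<Gamma>. ?p y * pmf \<rho> y)" .
  have "measure_pmf.prob (Pi_pmf (insert e I) d (\<lambda>_. \<rho>)) (?ev (insert e I) x) * (\<Prod>b\<in>\<Gamma>. fact (x b)) =
      (\<Sum>y\<in>\<Gamma>. pmf \<rho> y * ?p y * (\<Prod>b\<in>\<Gamma>. fact (x b)))"
    unfolding sum sum_distrib_right by (intro sum.cong refl) (simp only: mult_ac)
  also have "\<dots> = (\<Sum>y\<in>\<Gamma>. real (x y) * (fact (card I) * (\<Prod>b\<in>\<Gamma>. pmf \<rho> b ^ x b)))"
    by (intro sum.cong refl p_in)
  also have "\<dots> = real (\<Sum>y\<in>\<Gamma>. x y) * (fact (card I) * (\<Prod>b\<in>\<Gamma>. pmf \<rho> b ^ x b))"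
    by (simp add: sum_distrib_right)
  finally show ?case
    unfolding insert.prems card_insert_disjoint[OF insert.hyps] fact_Suc by (simp only: mult_ac of_nat_mult)
qed

lemma ln_fact_lower: "real j * ln (real j) - real j \<le> ln (fact j)"
proof (cases "j = 0")
  case False
  have "sum (\<lambda>n. real j ^ n /\<^sub>R fact n) {j} \<le> (\<Sum>n. real j ^ n /\<^sub>R fact n)"
    by (intro sum_le_suminf sums_summable[OF exp_converges]) auto
  then have "real j ^ j / fact j \<le> exp (real j)"
    unfolding sums_unique[OF exp_converges, symmetric] by (simp add: divide_inverse mult.commute)
  then have "ln (real j ^ j / fact j) \<le> ln (exp (real j))"
    using False by (subst ln_le_cancel_iff) auto
  then show ?thesis using False by (simp add: ln_div ln_realpow)
qed simp

lemma ln_fact_upper: "ln (fact j) \<le> (real j + 1) * ln (real j + 1) - real j"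
proof (induction j)
  case (Suc j)
  have "ln ((real j + 1) / (real j + 2)) \<le> (real j + 1) / (real j + 2) - 1"
    by (intro ln_le_minus_one) simp
  then have "(real j + 2) * ln ((real j + 1) / (real j + 2)) \<le> (real j + 2) * ((real j + 1) / (real j + 2) - 1)"
    by (intro mult_left_mono) auto
  also have "\<dots> = - 1" by (simp add: field_simps)
  also have "ln ((real j + 1) / (real j + 2)) = ln (real j + 1) - ln (real j + 2)"
    by (simp add: ln_div)
  finally have "(real j + 2) * ln (real j + 1) + 1 \<le> (real j + 2) * ln (real j + 2)"
    by (simp add: algebra_simps)
  moreover have "ln (fact (Suc j) :: real) = ln (real j + 1) + ln (fact j)"
    by (simp add: ln_mult add_ac)
  ultimately show ?case using Suc by (simp add: algebra_simps)
qed simp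

text \<open>
  Stirling's formula on the exponential scale, for a number \<open>j\<close> of order \<open>T\<close>. The limit includes
  \<open>c = 0\<close>, where \<open>j\<close> may stay bounded or grow more slowly than \<open>T\<close>.
\<close>

lemma stirling_scaled:
  fixes T :: "'i \<Rightarrow> real" and j :: "'i \<Rightarrow> nat"
  assumes T: "filterlim T at_top F" and j: "((\<lambda>i. real (j i) / T i) \<longlongrightarrow> c) F"
  shows "((\<lambda>i. ln (fact (j i)) / T i - real (j i) / T i * ln (T i)) \<longlongrightarrow> c * ln c - c) F"
proof (rule tendsto_sandwich)
  have pos: "eventually (\<lambda>i. T i > 0) F" using T by (simp add: filterlim_at_top_dense)
  let ?x = "\<lambda>u::real. u * ln u"
  show "eventually (\<lambda>i. ?x (real (j i) / T i) - real (j i) / T i \<le>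
      ln (fact (j i)) / T i - real (j i) / T i * ln (T i)) F"
    using pos
  proof eventually_elim
    case (elim i)
    have "?x (real (j i) / T i) - real (j i) / T i =
        (real (j i) * ln (real (j i)) - real (j i)) / T i - real (j i) / T i * ln (T i)"
      using elim by (cases "j i = 0") (auto simp: ln_div field_simps)
    also have "\<dots> \<le> ln (fact (j i)) / T i - real (j i) / T i * ln (T i)"
      using elim by (intro diff_right_mono divide_right_mono ln_fact_lower) auto
    finally show ?case .
  qed
  show "eventually (\<lambda>i. ln (fact (j i)) / T i - real (j i) / T i * ln (T i) \<le>
      ?x (real (j i) / T i + 1 / T i) + ln (T i) / T i - real (j i) / T i) F"
    using pos
  proof eventually_elim
    case (elim i)
    have "real (j i) / T i + 1 / T i = (real (j i) + 1) / T i" by (simp add: add_divide_distrib)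
    then have "?x (real (j i) / T i + 1 / T i) + ln (T i) / T i - real (j i) / T i =
        ((real (j i) + 1) * ln (real (j i) + 1) - real (j i)) / T i - real (j i) / T i * ln (T i)"
      using elim by (simp add: ln_div field_simps)
    moreover have "\<dots> \<ge> ln (fact (j i)) / T i - real (j i) / T i * ln (T i)"
      using elim by (intro diff_right_mono divide_right_mono ln_fact_upper) auto
    ultimately show ?case by simp
  qed
  show "((\<lambda>i. ?x (real (j i) / T i) - real (j i) / T i) \<longlongrightarrow> c * ln c - c) F"
    by (intro tendsto_diff isCont_tendsto_compose[OF isCont_xlnx] j)
  have "((\<lambda>i. ?x (real (j i) / T i + 1 / T i) + ln (T i) / T i - real (j i) / T i) \<longlongrightarrow> ?x (c + 0) + 0 - c) F"
  proof (intro tendsto_diff tendsto_add isCont_tendsto_compose[OF isCont_xlnx] j)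
    have "((\<lambda>t::real. 1 / t) \<longlongrightarrow> 0) at_top" "((\<lambda>t::real. ln t / t) \<longlongrightarrow> 0) at_top" by real_asymp+
    from this[THEN filterlim_compose, OF T]
    show "((\<lambda>i. 1 / T i) \<longlongrightarrow> 0) F" "((\<lambda>i. ln (T i) / T i) \<longlongrightarrow> 0) F" .
  qed
  then show "((\<lambda>i. ?x (real (j i) / T i + 1 / T i) + ln (T i) / T i - real (j i) / T i) \<longlongrightarrow> c * ln c - c) F"
    by simp
qed

lemma le_exp_of_ln_le: "0 < x \<Longrightarrow> ln x \<le> y \<Longrightarrow> x \<le> exp (y::real)"
  by (metis exp_le_cancel_iff exp_ln)

lemma exp_le_of_le_ln: "0 < x \<Longrightarrow> y \<le> ln x \<Longrightarrow> exp y \<le> (x::real)"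
  by (metis exp_le_cancel_iff exp_ln)

lemma sum_over_word:
  assumes "finite I" "finite \<Gamma>" and w: "\<forall>b\<in>\<Gamma>. card {t\<in>I. w t = b} = c b" and c: "(\<Sum>b\<in>\<Gamma>. c b) = card I"
  shows "\<forall>t\<in>I. w t \<in> \<Gamma>" "(\<Sum>t\<in>I. f (w t)) = (\<Sum>b\<in>\<Gamma>. c b * f b :: nat)"
proof -
  have "card (\<Union>b\<in>\<Gamma>. {t\<in>I. w t = b}) = (\<Sum>b\<in>\<Gamma>. card {t\<in>I. w t = b})"
    using assms by (intro card_UN_disjoint) auto
  also have "\<dots> = card I" unfolding c[symmetric] using w by (intro sum.cong) auto
  finally have "(\<Union>b\<in>\<Gamma>. {t\<in>I. w t = b}) = I" using assms(1) by (intro card_subset_eq) auto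
  then show in\<Gamma>: "\<forall>t\<in>I. w t \<in> \<Gamma>" by blast
  have "(\<Sum>t\<in>I. f (w t)) = (\<Sum>b\<in>\<Gamma>. \<Sum>t\<in>{t\<in>I. w t = b}. f (w t))"
    using assms in\<Gamma> by (intro sum.group[symmetric]) auto
  also have "\<dots> = (\<Sum>b\<in>\<Gamma>. card {t\<in>I. w t = b} * f b)" by (intro sum.cong refl) simp
  also have "\<dots> = (\<Sum>b\<in>\<Gamma>. c b * f b)" using w by (intro sum.cong) auto
  finally show "(\<Sum>t\<in>I. f (w t)) = (\<Sum>b\<in>\<Gamma>. c b * f b)" .
qed

lemma ln_multinomial_prob:
  fixes d :: 'b and \<rho> :: "'b pmf" and c :: "'b \<Rightarrow> nat"
  assumes I: "finite I" "card I > 0" and \<Gamma>: "finite \<Gamma>" "\<Gamma> \<subseteq> set_pmf \<rho>" and c: "(\<Sum>b\<in>\<Gamma>. c b) = card I"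
  defines "P \<equiv> measure_pmf.prob (Pi_pmf I d (\<lambda>_. \<rho>)) {w. \<forall>b\<in>\<Gamma>. card {t\<in>I. w t = b} = c b}"
    and "A \<equiv> \<lambda>j. ln (fact j) / real (card I) - real j / real (card I) * ln (real (card I))"
  shows "P > 0" "ln P / real (card I) = A (card I) - (\<Sum>b\<in>\<Gamma>. A (c b)) + (\<Sum>b\<in>\<Gamma>. real (c b) / real (card I) * ln (pmf \<rho> b))"
proof -
  let ?K = "real (card I)" and ?p = "\<Prod>b\<in>\<Gamma>. pmf \<rho> b ^ c b" and ?f = "\<Prod>b\<in>\<Gamma>. fact (c b) :: real"
  have pos: "pmf \<rho> g > 0" if "g \<in> \<Gamma>" for g using that \<Gamma>(2) by (auto simp: pmf_positive)
  then have p: "?p > 0" and f: "?f > 0" by (auto intro!: prod_pos)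
  have P: "P = fact (card I) * ?p / ?f"
    using multinomial_law[OF I(1) \<Gamma>(1) c, of d \<rho>] f unfolding P_def by (simp add: field_simps)
  then show "P > 0" using p f by simp
  have "ln ?p = (\<Sum>b\<in>\<Gamma>. real (c b) * ln (pmf \<rho> b))"
    using pos \<Gamma>(1) by (subst ln_prod) (force simp: ln_realpow intro!: sum.cong)+
  moreover have "ln ?f = (\<Sum>b\<in>\<Gamma>. ln (fact (c b)))" using \<Gamma>(1) by (intro ln_prod) auto
  ultimately have "ln P = ln (fact (card I)) + (\<Sum>b\<in>\<Gamma>. real (c b) * ln (pmf \<rho> b)) - (\<Sum>b\<in>\<Gamma>. ln (fact (c b)))"
    unfolding P using p f by (simp add: ln_div ln_mult)
  moreover have "(\<Sum>b\<in>\<Gamma>. real (c b) / ?K * ln ?K) = ln ?K"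
    using I c by (simp flip: sum_distrib_right sum_divide_distrib of_nat_sum)
  ultimately show "ln P / ?K = A (card I) - (\<Sum>b\<in>\<Gamma>. A (c b)) + (\<Sum>b\<in>\<Gamma>. real (c b) / ?K * ln (pmf \<rho> b))"
    using I card_gt_0_iff[of I] unfolding A_def by (simp add: sum_subtractf add_divide_distrib diff_divide_distrib sum_divide_distrib)
qed

section \<open>Words of a given composition\<close>

context letters
begin

lemma has_sum_imp_tendsto_sz:
  assumes "(f has_sum s) UNIV" "\<And>g. g \<notin> set_pmf \<nu> \<Longrightarrow> f g = 0"
  shows "(\<lambda>R. \<Sum>g | g \<in> set_pmf \<nu> \<and> sz g \<le> R. f g) \<longlonglongrightarrow> (s :: real)"
proof -
  have "(f has_sum s) (set_pmf \<nu>)"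
    using assms by (subst has_sum_cong_neutral[where T = UNIV and g = f]) auto
  then have "(sum f \<longlongrightarrow> s) (finite_subsets_at_top (set_pmf \<nu>))" by (simp add: has_sum_def)
  moreover have "filterlim (\<lambda>R. {g \<in> set_pmf \<nu>. sz g \<le> R}) (finite_subsets_at_top (set_pmf \<nu>)) sequentially"
    unfolding filterlim_finite_subsets_at_top
  proof (intro allI impI)
    fix Y assume Y: "finite Y \<and> Y \<subseteq> set_pmf \<nu>"
    show "\<forall>\<^sub>F R in sequentially. finite {g \<in> set_pmf \<nu>. sz g \<le> R} \<and>
        Y \<subseteq> {g \<in> set_pmf \<nu>. sz g \<le> R} \<and> {g \<in> set_pmf \<nu>. sz g \<le> R} \<subseteq> set_pmf \<nu>"
      using eventually_ge_at_top[of "sum sz Y"]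
    proof eventually_elim
      case (elim R)
      have "sz g \<le> R" if "g \<in> Y" for g
        using member_le_sum[of g Y sz] Y that elim by auto
      then show ?case using Y finite_sz by auto
    qed
  qed
  ultimately show ?thesis by (rule filterlim_compose)
qed

text \<open>
  If the support of \<open>\<mu>\<close> is infinite, it contains letters of two different sizes. Cutting off the
  large letters loses a little mass and a little mean; changing the weights of these two letters
  restores both exactly. Since the two weights are positive before the change, they stay so, and the
  entropy changes only slightly.
\<close>

lemma finite_support_approximation:
  assumes mom: "moments \<mu> x y" and ent: "rel_entropy \<mu> \<nu> = ereal h" and \<epsilon>: "\<epsilon> > 0"
  shows "\<exists>\<Gamma> m. finite \<Gamma> \<and> \<Gamma> \<subseteq> set_pmf \<nu> \<and> (\<forall>g. m g \<ge> 0) \<and> (\<Sum>g\<in>\<Gamma>. m g) = 1 \<and>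
           (\<Sum>g\<in>\<Gamma>. m g * real (sz g)) = x \<and> \<bar>(\<Sum>g\<in>\<Gamma>. m g * real (sc g)) - y\<bar> < \<epsilon> \<and>
           (\<Sum>g\<in>\<Gamma>. m g * ln (m g / pmf \<nu> g)) < h + \<epsilon>"
proof (cases "finite (set_pmf \<mu>)")
  case True
  have sub: "set_pmf \<mu> \<subseteq> set_pmf \<nu>" using ent by (simp add: rel_entropy_eq_iff)
  have hs: "((\<lambda>g. pmf \<mu> g * f g) has_sum (\<Sum>g\<in>set_pmf \<mu>. pmf \<mu> g * f g)) UNIV" for f :: "'g \<Rightarrow> real"
    by (rule has_sum_finite_neutralI[OF True]) (auto simp: set_pmf_iff)
  have "(\<Sum>g\<in>set_pmf \<mu>. pmf \<mu> g * real (sz g)) = x" "(\<Sum>g\<in>set_pmf \<mu>. pmf \<mu> g * real (sc g)) = y"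
    using mom has_sum_unique[OF hs] unfolding moments_def by auto
  moreover have "(\<Sum>g\<in>set_pmf \<mu>. pmf \<mu> g * ln (pmf \<mu> g / pmf \<nu> g)) = h"
    using rel_entropy_finite_support[OF True order_refl sub] ent by simp
  moreover have "(\<Sum>g\<in>set_pmf \<mu>. pmf \<mu> g) = 1" using sum_pmf_eq_1[OF True order_refl] .
  ultimately show ?thesis using True sub \<epsilon> by (intro exI[of _ "set_pmf \<mu>"] exI[of _ "pmf \<mu>"]) auto
next
  case False
  have sub: "set_pmf \<mu> \<subseteq> set_pmf \<nu>" using ent by (simp add: rel_entropy_eq_iff)
  have \<mu>0: "pmf \<mu> g = 0" if "g \<notin> set_pmf \<nu>" for g using that sub by (auto simp: set_pmf_iff)
  \<comment> \<open>The two letters whose weights absorb the truncation; they exist since only finitely many letters have size at most \<open>sz g0\<close>.\<close>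
  obtain g0 where g0: "g0 \<in> set_pmf \<mu>" using set_pmf_not_empty[of \<mu>] by blast
  obtain g1 where g1: "g1 \<in> set_pmf \<mu>" "sz g1 > sz g0"
  proof (rule ccontr)
    assume "\<not> thesis"
    note * = that
    have "\<not> sz g0 < sz g" if "g \<in> set_pmf \<mu>" for g using *[of g] that \<open>\<not> thesis\<close> by blast
    then have "set_pmf \<mu> \<subseteq> {g \<in> set_pmf \<nu>. sz g \<le> sz g0}" using sub by (auto simp: not_less)
    then show False using False finite_sz[of "sz g0"] finite_subset by blast
  qed
  have g01: "g0 \<noteq> g1" using g1 by auto
  define \<Gamma> where "\<Gamma> R = {g \<in> set_pmf \<nu>. sz g \<le> R}" for R
  have fin: "finite (\<Gamma> R)" for R unfolding \<Gamma>_def by (rule finite_sz)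
  define d where "d = real (sz g1) - real (sz g0)"
  have d: "d > 0" using g1 by (simp add: d_def)
  define e where "e R = 1 - (\<Sum>g\<in>\<Gamma> R. pmf \<mu> g)" for R
  define M where "M R = x - (\<Sum>g\<in>\<Gamma> R. pmf \<mu> g * real (sz g))" for R
  define \<beta> where "\<beta> R = (M R - real (sz g0) * e R) / d" for R
  define \<alpha> where "\<alpha> R = e R - \<beta> R" for R
  define m where "m R g = pmf \<mu> g + (if g = g0 then \<alpha> R else if g = g1 then \<beta> R else 0)" for R g
  have lim: "(\<lambda>R. \<Sum>g\<in>\<Gamma> R. f g) \<longlonglongrightarrow> s"
    if "(f has_sum s) UNIV" "\<And>g. g \<notin> set_pmf \<nu> \<Longrightarrow> f g = 0" for f :: "'g \<Rightarrow> real" and s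
    unfolding \<Gamma>_def by (rule has_sum_imp_tendsto_sz[OF that])
  have "(\<lambda>R. 1 - (\<Sum>g\<in>\<Gamma> R. pmf \<mu> g)) \<longlonglongrightarrow> 1 - 1"
    by (intro tendsto_intros lim has_sum_pmf \<mu>0)
  then have e0: "e \<longlonglongrightarrow> 0" unfolding e_def by simp
  have "(\<lambda>R. x - (\<Sum>g\<in>\<Gamma> R. pmf \<mu> g * real (sz g))) \<longlonglongrightarrow> x - x"
    by (intro tendsto_intros lim) (use mom \<mu>0 in \<open>auto simp: moments_def\<close>)
  then have M0: "M \<longlonglongrightarrow> 0" unfolding M_def by simp
  have "(\<lambda>R. (M R - real (sz g0) * e R) / d) \<longlonglongrightarrow> (0 - real (sz g0) * 0) / d"
    using d by (intro tendsto_intros M0 e0) auto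
  then have \<beta>0: "\<beta> \<longlonglongrightarrow> 0" unfolding \<beta>_def by simp
  have "(\<lambda>R. e R - \<beta> R) \<longlonglongrightarrow> 0 - 0" by (intro tendsto_intros e0 \<beta>0)
  then have \<alpha>0: "\<alpha> \<longlonglongrightarrow> 0" unfolding \<alpha>_def by simp
  have m_sum: "(\<Sum>g\<in>\<Gamma> R. \<phi> g (m R g)) = (\<Sum>g\<in>\<Gamma> R. \<phi> g (pmf \<mu> g)) +
      (\<phi> g0 (pmf \<mu> g0 + \<alpha> R) - \<phi> g0 (pmf \<mu> g0)) + (\<phi> g1 (pmf \<mu> g1 + \<beta> R) - \<phi> g1 (pmf \<mu> g1))"
    if R: "R \<ge> sz g1" for R and \<phi> :: "'g \<Rightarrow> real \<Rightarrow> real"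
  proof -
    have in\<Gamma>: "g0 \<in> \<Gamma> R" "g1 \<in> \<Gamma> R" using R g0 g1 sub by (auto simp: \<Gamma>_def)
    have split: "(\<Sum>g\<in>\<Gamma> R. f g) = f g0 + f g1 + (\<Sum>g\<in>\<Gamma> R - {g0} - {g1}. f g)" for f :: "'g \<Rightarrow> real"
      using in\<Gamma> g01 fin[of R] by (simp add: sum.remove[of _ g0] sum.remove[of _ g1])
    have "(\<Sum>g\<in>\<Gamma> R - {g0} - {g1}. \<phi> g (m R g)) = (\<Sum>g\<in>\<Gamma> R - {g0} - {g1}. \<phi> g (pmf \<mu> g))"
      by (intro sum.cong) (auto simp: m_def)
    then show ?thesis
      unfolding split[of "\<lambda>g. \<phi> g (m R g)"] split[of "\<lambda>g. \<phi> g (pmf \<mu> g)"]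
      using g01 by (simp add: m_def)
  qed
  have lim_m: "(\<lambda>R. \<Sum>g\<in>\<Gamma> R. \<phi> g (m R g)) \<longlonglongrightarrow> s"
    if "((\<lambda>g. \<phi> g (pmf \<mu> g)) has_sum s) UNIV" "\<And>g. \<phi> g 0 = 0" "\<And>g u. isCont (\<phi> g) u"
    for \<phi> :: "'g \<Rightarrow> real \<Rightarrow> real" and s
  proof -
    have "(\<lambda>R. (\<Sum>g\<in>\<Gamma> R. \<phi> g (pmf \<mu> g)) +
      (\<phi> g0 (pmf \<mu> g0 + \<alpha> R) - \<phi> g0 (pmf \<mu> g0)) + (\<phi> g1 (pmf \<mu> g1 + \<beta> R) - \<phi> g1 (pmf \<mu> g1)))
      \<longlonglongrightarrow> s + (\<phi> g0 (pmf \<mu> g0 + 0) - \<phi> g0 (pmf \<mu> g0)) + (\<phi> g1 (pmf \<mu> g1 + 0) - \<phi> g1 (pmf \<mu> g1))"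
      by (intro tendsto_add tendsto_diff tendsto_const isCont_tendsto_compose[OF that(3)] \<alpha>0 \<beta>0 lim that(1))
         (simp add: \<mu>0 that(2))
    moreover have "\<forall>\<^sub>F R in sequentially. (\<Sum>g\<in>\<Gamma> R. \<phi> g (pmf \<mu> g)) +
      (\<phi> g0 (pmf \<mu> g0 + \<alpha> R) - \<phi> g0 (pmf \<mu> g0)) + (\<phi> g1 (pmf \<mu> g1 + \<beta> R) - \<phi> g1 (pmf \<mu> g1)) =
      (\<Sum>g\<in>\<Gamma> R. \<phi> g (m R g))"
      using eventually_ge_at_top[of "sz g1"] by eventually_elim (simp add: m_sum)
    ultimately show ?thesis by (simp add: filterlim_cong)
  qed
  have "(\<lambda>R. \<Sum>g\<in>\<Gamma> R. m R g * real (sc g)) \<longlonglongrightarrow> y"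
    using mom by (intro lim_m[where \<phi> = "\<lambda>g u. u * real (sc g)"]) (auto simp: moments_def)
  then have ev_y: "\<forall>\<^sub>F R in sequentially. \<bar>(\<Sum>g\<in>\<Gamma> R. m R g * real (sc g)) - y\<bar> < \<epsilon>"
    using \<epsilon> by (simp add: tendsto_iff dist_real_def)
  have "(\<lambda>R. \<Sum>g\<in>\<Gamma> R. m R g * ln (m R g / pmf \<nu> g)) \<longlonglongrightarrow> h"
  proof (rule lim_m[where \<phi> = "\<lambda>g u. u * ln (u / pmf \<nu> g)"])
    show "((\<lambda>g. pmf \<mu> g * ln (pmf \<mu> g / pmf \<nu> g)) has_sum h) UNIV"
      using ent unfolding rel_entropy_def by (auto simp: has_sum_iff split: if_splits)
    show "isCont (\<lambda>u. u * ln (u / pmf \<nu> g)) u" for g u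
    proof -
      have "(\<lambda>u. u * ln (u / pmf \<nu> g)) = (\<lambda>u. kl_term u (pmf \<nu> g) + u - pmf \<nu> g)"
        by (auto simp: kl_term_def)
      then show ?thesis by (simp add: isCont_kl_term)
    qed
  qed simp
  then have ev_h: "\<forall>\<^sub>F R in sequentially. (\<Sum>g\<in>\<Gamma> R. m R g * ln (m R g / pmf \<nu> g)) < h + \<epsilon>"
    using \<epsilon> by (intro order_tendstoD) auto
  have ev_pos: "\<forall>\<^sub>F R in sequentially. \<alpha> R > - pmf \<mu> g0" "\<forall>\<^sub>F R in sequentially. \<beta> R > - pmf \<mu> g1"
    using order_tendstoD(1)[OF \<alpha>0] order_tendstoD(1)[OF \<beta>0] g0 g1 by (auto simp: pmf_positive)
  have "\<forall>\<^sub>F R in sequentially. R \<ge> sz g1 \<and> \<bar>(\<Sum>g\<in>\<Gamma> R. m R g * real (sc g)) - y\<bar> < \<epsilon> \<and>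
      (\<Sum>g\<in>\<Gamma> R. m R g * ln (m R g / pmf \<nu> g)) < h + \<epsilon> \<and> \<alpha> R > - pmf \<mu> g0 \<and> \<beta> R > - pmf \<mu> g1"
    by (intro eventually_conj ev_y ev_h ev_pos eventually_ge_at_top)
  then obtain R where R: "R \<ge> sz g1" "\<bar>(\<Sum>g\<in>\<Gamma> R. m R g * real (sc g)) - y\<bar> < \<epsilon>"
      "(\<Sum>g\<in>\<Gamma> R. m R g * ln (m R g / pmf \<nu> g)) < h + \<epsilon>" "\<alpha> R > - pmf \<mu> g0" "\<beta> R > - pmf \<mu> g1"
    using eventually_happens by fastforce
  have "(\<Sum>g\<in>\<Gamma> R. m R g) = 1"
    using m_sum[OF R(1), of "\<lambda>g u. u"] by (simp add: \<alpha>_def e_def)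
  moreover have "(\<Sum>g\<in>\<Gamma> R. m R g * real (sz g)) = x"
  proof -
    have "(\<Sum>g\<in>\<Gamma> R. m R g * real (sz g)) =
        (\<Sum>g\<in>\<Gamma> R. pmf \<mu> g * real (sz g)) + \<alpha> R * real (sz g0) + \<beta> R * real (sz g1)"
      using m_sum[OF R(1), of "\<lambda>g u. u * real (sz g)"] by (simp add: algebra_simps)
    moreover have "\<alpha> R * real (sz g0) + \<beta> R * real (sz g1) = real (sz g0) * e R + \<beta> R * d"
      by (simp add: \<alpha>_def d_def algebra_simps)
    moreover have "\<beta> R * d = M R - real (sz g0) * e R" using d by (simp add: \<beta>_def)
    ultimately show ?thesis by (simp add: M_def)
  qed
  moreover have "\<forall>g. m R g \<ge> 0" using R(4,5) g01 by (auto simp: m_def)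
  ultimately show ?thesis
    using R(2,3) fin by (intro exI[of _ "\<Gamma> R"] exI[of _ "m R"]) (auto simp: \<Gamma>_def)
qed

text \<open>
  Letter \<open>g\<close> is given \<open>\<lfloor>K m g\<rfloor>\<close> positions. If positions remain, one of them receives a letter
  whose size is the missing part of the total size and the others receive a letter of size 0. The
  missing part is nonnegative, because the integer total of the rounded counts cannot exceed
  \<open>\<lfloor>K x\<rfloor>\<close>, and it is bounded independently of \<open>K\<close>, so that finitely many letters suffice.
\<close>

lemma rounded_composition:
  assumes \<Gamma>: "finite \<Gamma>" and m: "\<And>g. m g \<ge> 0" "(\<Sum>g\<in>\<Gamma>. m g) = 1"
    and mx: "(\<Sum>g\<in>\<Gamma>. m g * real (sz g)) = x"
  shows "\<exists>c. (\<Sum>g\<in>\<Gamma> \<union> letter ` {..\<Sum>g\<in>\<Gamma>. sz g}. c g) = K \<and>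
    (\<Sum>g\<in>\<Gamma> \<union> letter ` {..\<Sum>g\<in>\<Gamma>. sz g}. c g * sz g) = nat \<lfloor>real K * x\<rfloor> \<and>
    (\<forall>g. \<bar>real (c g) - real K * (if g \<in> \<Gamma> then m g else 0)\<bar> \<le> real (card \<Gamma>) + 2)"
proof -
  define B where "B = (\<Sum>g\<in>\<Gamma>. sz g)"
  let ?\<Gamma>' = "\<Gamma> \<union> letter ` {..B}"
  define c0 where "c0 g = (if g \<in> \<Gamma> then nat \<lfloor>real K * m g\<rfloor> else 0)" for g
  define r where "r = K - (\<Sum>g\<in>\<Gamma>. c0 g)"
  define n where "n = nat \<lfloor>real K * x\<rfloor>"
  define q where "q = n - (\<Sum>g\<in>\<Gamma>. c0 g * sz g)"
  have c0_le: "real (c0 g) \<le> real K * m g" for g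
    unfolding c0_def using m(1)[of g] by (auto intro!: of_nat_floor)
  have c0_ge: "real (c0 g) \<ge> real K * m g - 1" if "g \<in> \<Gamma>" for g
    using that m(1)[of g] unfolding c0_def by simp
  have mass: "(\<Sum>g\<in>\<Gamma>. real K * m g) = real K" by (simp only: sum_distrib_left[symmetric] m(2) mult_1_right)
  have mean: "(\<Sum>g\<in>\<Gamma>. real K * m g * real (sz g)) = real K * x"
    unfolding mx[symmetric] by (simp add: sum_distrib_left mult_ac)
  have "real (\<Sum>g\<in>\<Gamma>. c0 g) \<le> (\<Sum>g\<in>\<Gamma>. real K * m g)"
    unfolding of_nat_sum by (intro sum_mono c0_le)
  also note mass
  finally have r_eq: "(\<Sum>g\<in>\<Gamma>. c0 g) + r = K" unfolding of_nat_le_iff r_def by (rule le_add_diff_inverse)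
  have "real K - real (card \<Gamma>) = (\<Sum>g\<in>\<Gamma>. real K * m g - 1)" using mass by (simp add: sum_subtractf)
  also have "\<dots> \<le> (\<Sum>g\<in>\<Gamma>. real (c0 g))" by (intro sum_mono c0_ge)
  finally have "real K \<le> real ((\<Sum>g\<in>\<Gamma>. c0 g) + card \<Gamma>)" by simp
  then have r_le: "r \<le> card \<Gamma>" unfolding of_nat_le_iff using r_eq by linarith
  have "real (\<Sum>g\<in>\<Gamma>. c0 g * sz g) \<le> real K * x"
    unfolding mean[symmetric] of_nat_sum of_nat_mult by (intro sum_mono mult_right_mono c0_le) auto
  then have q_eq: "(\<Sum>g\<in>\<Gamma>. c0 g * sz g) + q = n" unfolding q_def n_def by (simp add: le_nat_floor)
  have "x \<ge> 0" unfolding mx[symmetric] using m(1) by (intro sum_nonneg) auto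
  then have "real n \<le> real K * x" unfolding n_def by (intro of_nat_floor) auto
  also have "\<dots> \<le> (\<Sum>g\<in>\<Gamma>. (real (c0 g) + 1) * real (sz g))"
    unfolding mean[symmetric] using c0_ge by (intro sum_mono mult_right_mono) force+
  also have "\<dots> = real ((\<Sum>g\<in>\<Gamma>. c0 g * sz g) + B)" by (simp add: B_def sum.distrib distrib_right)
  finally have q_le: "q \<le> B" unfolding of_nat_le_iff using q_eq by linarith
  have q0: "q = 0" if "r = 0"
  proof -
    have "(\<Sum>g\<in>\<Gamma>. real K * m g - real (c0 g)) = 0"
      using r_eq that mass by (simp add: sum_subtractf flip: of_nat_sum)
    then have "\<forall>g\<in>\<Gamma>. real K * m g - real (c0 g) = 0"
      using \<Gamma> c0_le by (subst (asm) sum_nonneg_eq_0_iff) auto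
    then have "real K * x = real (\<Sum>g\<in>\<Gamma>. c0 g * sz g)"
      unfolding mean[symmetric] of_nat_sum of_nat_mult by (intro sum.cong) auto
    then show ?thesis unfolding q_def n_def by (simp only: floor_of_nat nat_int diff_self_eq_0)
  qed
  define c where "c g = c0 g + (if r = 0 then 0 else (r - 1) * of_bool (g = letter 0) + of_bool (g = letter q))" for g
  have c_sum: "(\<Sum>g\<in>?\<Gamma>'. c g * f g) = (\<Sum>g\<in>\<Gamma>. c0 g * f g) +
      (if r = 0 then 0 else (r - 1) * f (letter 0) + f (letter q))" for f :: "'g \<Rightarrow> nat"
  proof -
    have "(\<Sum>g\<in>?\<Gamma>'. c0 g * f g) = (\<Sum>g\<in>\<Gamma>. c0 g * f g)"
      using \<Gamma> by (intro sum.mono_neutral_right) (auto simp: c0_def)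
    moreover have "(\<Sum>g\<in>?\<Gamma>'. c g * f g) = (\<Sum>g\<in>?\<Gamma>'. c0 g * f g + (if r = 0 then 0 else
        (if g = letter 0 then (r - 1) * f (letter 0) else 0) + (if g = letter q then f (letter q) else 0)))"
      by (intro sum.cong refl) (auto simp: c_def algebra_simps)
    ultimately show ?thesis using q_le \<Gamma> by (auto simp: sum.distrib)
  qed
  have "(\<Sum>g\<in>?\<Gamma>'. c g) = K" using c_sum[of "\<lambda>_. 1"] r_eq by (auto split: if_splits)
  moreover have "(\<Sum>g\<in>?\<Gamma>'. c g * sz g) = n" using c_sum[of sz] q_eq q0 by (auto simp: sz_letter split: if_splits)
  moreover have "\<bar>real (c g) - real K * (if g \<in> \<Gamma> then m g else 0)\<bar> \<le> real (card \<Gamma>) + 2" for g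
  proof -
    have "\<bar>real (c0 g) - real K * (if g \<in> \<Gamma> then m g else 0)\<bar> \<le> 1"
    proof (cases "g \<in> \<Gamma>")
      case True
      then show ?thesis using c0_le[of g] c0_ge[OF True] by simp
    qed (simp add: c0_def)
    moreover have "c g - c0 g \<le> card \<Gamma> + 1" using r_le by (auto simp: c_def of_bool_def)
    moreover have "c0 g \<le> c g" by (simp add: c_def)
    ultimately show ?thesis by linarith
  qed
  ultimately show ?thesis unfolding B_def n_def by blast
qed

text \<open>
  \<open>C\<close> consists of the words with the rounded composition. As the counts differ from \<open>K m g\<close> by a
  bounded amount only, Stirling's formula turns the multinomial probability into the exponential of
  the relative entropy. Letters outside \<open>\<Gamma>\<close> have limiting frequency 0 and do not contribute to
  the rate.
\<close>

lemma type_class_lower_bound: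
  assumes \<Gamma>: "finite \<Gamma>" "\<Gamma> \<subseteq> set_pmf \<nu>" and m: "\<And>g. m g \<ge> 0" "(\<Sum>g\<in>\<Gamma>. m g) = 1"
    and mx: "(\<Sum>g\<in>\<Gamma>. m g * real (sz g)) = x" and my: "(\<Sum>g\<in>\<Gamma>. m g * real (sc g)) = y"
    and k: "k \<ge> 1" and I: "\<And>N. finite (I N)" "\<And>N. card (I N) = k * N" and \<epsilon>: "\<epsilon> > 0"
  shows "\<exists>\<Gamma>'. finite \<Gamma>' \<and> \<Gamma>' \<subseteq> set_pmf \<nu> \<and> (\<forall>\<^sub>F N in sequentially. \<exists>C.
      (\<forall>w\<in>C. (\<forall>t\<in>I N. w t \<in> \<Gamma>') \<and> (\<Sum>t\<in>I N. sz (w t)) = nat \<lfloor>real (k * N) * x\<rfloor> \<and>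
              \<bar>real (\<Sum>t\<in>I N. sc (w t)) / real N - real k * y\<bar> < \<epsilon>) \<and>
      measure_pmf.prob (Pi_pmf (I N) d (\<lambda>_. \<nu>)) C \<ge>
        exp (- ((real k * (\<Sum>g\<in>\<Gamma>. m g * ln (m g / pmf \<nu> g)) + \<epsilon>) * real N)))"
proof -
  define \<Gamma>' where "\<Gamma>' = \<Gamma> \<union> letter ` {..\<Sum>g\<in>\<Gamma>. sz g}"
  have \<Gamma>': "finite \<Gamma>'" "\<Gamma>' \<subseteq> set_pmf \<nu>" "\<Gamma> \<subseteq> \<Gamma>'" unfolding \<Gamma>'_def using \<Gamma> letter_in by auto
  define m' where "m' g = (if g \<in> \<Gamma> then m g else 0)" for g
  let ?K = "\<lambda>N. real (k * N)"
  have "\<forall>N. \<exists>c. (\<Sum>g\<in>\<Gamma>'. c g) = k * N \<and> (\<Sum>g\<in>\<Gamma>'. c g * sz g) = nat \<lfloor>?K N * x\<rfloor> \<and>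
      (\<forall>g. \<bar>real (c g) - ?K N * m' g\<bar> \<le> real (card \<Gamma>) + 2)"
    unfolding \<Gamma>'_def m'_def by (intro allI rounded_composition \<Gamma>(1) m mx)
  from choice[OF this] obtain c where c: "\<And>N. (\<Sum>g\<in>\<Gamma>'. c N g) = k * N" "\<And>N. (\<Sum>g\<in>\<Gamma>'. c N g * sz g) = nat \<lfloor>?K N * x\<rfloor>"
      "\<And>N g. \<bar>real (c N g) - ?K N * m' g\<bar> \<le> real (card \<Gamma>) + 2" by blast
  have K_top: "filterlim ?K at_top sequentially"
    using k by (intro filterlim_compose[OF filterlim_real_sequentially] filterlim_subseq) (auto simp: strict_mono_def)
  have c_lim: "(\<lambda>N. real (c N g) / ?K N) \<longlonglongrightarrow> m' g" for g
  proof (rule Lim_null[THEN iffD2], rule Lim_null_comparison)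
    show "(\<lambda>N. (real (card \<Gamma>) + 2) / ?K N) \<longlonglongrightarrow> 0"
      by (intro tendsto_divide_0[OF tendsto_const] filterlim_at_top_imp_at_infinity K_top)
    show "\<forall>\<^sub>F N in sequentially. norm (real (c N g) / ?K N - m' g) \<le> (real (card \<Gamma>) + 2) / ?K N"
      using eventually_gt_at_top[of 0]
    proof eventually_elim
      case (elim N)
      then have K: "?K N > 0" using k by simp
      have "real (c N g) / ?K N - m' g = (real (c N g) - ?K N * m' g) / ?K N"
        by (simp only: diff_divide_distrib nonzero_mult_div_cancel_left[OF less_imp_neq[OF K, symmetric]])
      then show ?case using c(3)[of N g] K by (simp add: divide_right_mono)
    qed
  qed
  define C where "C N = {w. \<forall>b\<in>\<Gamma>'. card {t\<in>I N. w t = b} = c N b}" for N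
  let ?P = "\<lambda>N. measure_pmf.prob (Pi_pmf (I N) d (\<lambda>_. \<nu>)) (C N)"
  have C_sum: "\<forall>t\<in>I N. w t \<in> \<Gamma>'" "(\<Sum>t\<in>I N. f (w t)) = (\<Sum>g\<in>\<Gamma>'. c N g * f g)"
    if "w \<in> C N" for w N and f :: "'g \<Rightarrow> nat"
    using sum_over_word[OF I(1) \<Gamma>'(1), of N w "c N"] that c(1)[of N] unfolding C_def I(2) by auto
  let ?A = "\<lambda>j N. ln (fact j) / ?K N - real j / ?K N * ln (?K N)"
  let ?h = "\<Sum>g\<in>\<Gamma>. m g * ln (m g / pmf \<nu> g)"
  have "(\<lambda>N. ?A (k * N) N - (\<Sum>b\<in>\<Gamma>'. ?A (c N b) N) + (\<Sum>b\<in>\<Gamma>'. real (c N b) / ?K N * ln (pmf \<nu> b))) \<longlonglongrightarrow>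
      (1 * ln 1 - 1) - (\<Sum>b\<in>\<Gamma>'. m' b * ln (m' b) - m' b) + (\<Sum>b\<in>\<Gamma>'. m' b * ln (pmf \<nu> b))"
  proof (rule tendsto_add[OF tendsto_diff[OF _ tendsto_sum] tendsto_sum])
    have "(\<lambda>N. ?K N / ?K N) \<longlonglongrightarrow> 1"
      using k by (intro tendsto_eventually eventually_sequentiallyI[of 1]) auto
    then show "(\<lambda>N. ?A (k * N) N) \<longlonglongrightarrow> 1 * ln 1 - 1" by (rule stirling_scaled[OF K_top])
  qed (rule stirling_scaled[OF K_top c_lim], rule tendsto_mult_right[OF c_lim])
  also have "(1 * ln 1 - 1) - (\<Sum>b\<in>\<Gamma>'. m' b * ln (m' b) - m' b) + (\<Sum>b\<in>\<Gamma>'. m' b * ln (pmf \<nu> b)) = - ?h"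
  proof -
    have *: "(\<Sum>b\<in>\<Gamma>'. m' b * f b) = (\<Sum>b\<in>\<Gamma>. m b * f b)" for f :: "'g \<Rightarrow> real"
      using \<Gamma>' by (intro sum.mono_neutral_cong_right) (auto simp: m'_def)
    have "(\<Sum>b\<in>\<Gamma>'. m' b * ln (m' b)) = (\<Sum>b\<in>\<Gamma>. m b * ln (m b))"
      unfolding * by (intro sum.cong) (auto simp: m'_def)
    moreover have "(\<Sum>b\<in>\<Gamma>'. m' b) = 1" using *[of "\<lambda>_. 1"] m(2) by simp
    moreover have "?h = (\<Sum>b\<in>\<Gamma>. m b * ln (m b) - m b * ln (pmf \<nu> b))"
    proof (intro sum.cong refl)
      fix b assume "b \<in> \<Gamma>"
      then have "pmf \<nu> b > 0" using \<Gamma>(2) by (auto simp: pmf_positive)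
      then show "m b * ln (m b / pmf \<nu> b) = m b * ln (m b) - m b * ln (pmf \<nu> b)"
        by (cases "m b = 0") (auto simp: ln_div algebra_simps)
    qed
    ultimately show ?thesis using *[of "\<lambda>b. ln (pmf \<nu> b)"] by (simp add: sum_subtractf)
  qed
  finally have "\<forall>\<^sub>F N in sequentially. ?A (k * N) N - (\<Sum>b\<in>\<Gamma>'. ?A (c N b) N)
      + (\<Sum>b\<in>\<Gamma>'. real (c N b) / ?K N * ln (pmf \<nu> b)) > - ?h - \<epsilon> / real k"
    using \<epsilon> k by (intro order_tendstoD(1)) auto
  then have ev_P: "\<forall>\<^sub>F N in sequentially. ?P N \<ge> exp (- ((real k * ?h + \<epsilon>) * real N))"
    using eventually_gt_at_top[of 0]
  proof eventually_elim
    case (elim N)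
    have "card (I N) > 0" using elim k by (simp add: I)
    note P = ln_multinomial_prob[OF I(1) this \<Gamma>'(1,2), of "c N" d, unfolded I(2), OF c(1), folded C_def]
    have "ln (?P N) > (- ?h - \<epsilon> / real k) * ?K N"
      using elim k unfolding P(2)[symmetric] by (simp add: pos_less_divide_eq)
    also have "(- ?h - \<epsilon> / real k) * ?K N = - ((real k * ?h + \<epsilon>) * real N)"
      using k by (simp add: field_simps)
    finally show ?case by (intro exp_le_of_le_ln P(1) less_imp_le)
  qed
  have "(\<lambda>N. real k * (\<Sum>g\<in>\<Gamma>'. real (c N g) / ?K N * real (sc g))) \<longlonglongrightarrow> real k * (\<Sum>g\<in>\<Gamma>'. m' g * real (sc g))"
    by (intro tendsto_intros c_lim)
  also have "(\<Sum>g\<in>\<Gamma>'. m' g * real (sc g)) = y"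
    unfolding my[symmetric] using \<Gamma>' by (intro sum.mono_neutral_cong_right) (auto simp: m'_def)
  finally have "\<forall>\<^sub>F N in sequentially. \<bar>real k * (\<Sum>g\<in>\<Gamma>'. real (c N g) / ?K N * real (sc g)) - real k * y\<bar> < \<epsilon>"
    using \<epsilon> by (simp add: tendsto_iff dist_real_def)
  then have "\<forall>\<^sub>F N in sequentially. \<exists>C.
      (\<forall>w\<in>C. (\<forall>t\<in>I N. w t \<in> \<Gamma>') \<and> (\<Sum>t\<in>I N. sz (w t)) = nat \<lfloor>?K N * x\<rfloor> \<and>
              \<bar>real (\<Sum>t\<in>I N. sc (w t)) / real N - real k * y\<bar> < \<epsilon>) \<and>
      measure_pmf.prob (Pi_pmf (I N) d (\<lambda>_. \<nu>)) C \<ge> exp (- ((real k * ?h + \<epsilon>) * real N))"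
    using ev_P eventually_gt_at_top[of 0]
  proof eventually_elim
    case (elim N)
    have sc: "real (\<Sum>t\<in>I N. sc (w t)) / real N = real k * (\<Sum>g\<in>\<Gamma>'. real (c N g) / ?K N * real (sc g))"
      if "w \<in> C N" for w
    proof -
      have "real (\<Sum>t\<in>I N. sc (w t)) = (\<Sum>g\<in>\<Gamma>'. real (c N g) * real (sc g))" using C_sum(2)[OF that] by simp
      then show ?thesis using elim(3) k by (simp add: sum_divide_distrib sum_distrib_left)
    qed
    have "\<forall>w\<in>C N. (\<forall>t\<in>I N. w t \<in> \<Gamma>') \<and> (\<Sum>t\<in>I N. sz (w t)) = nat \<lfloor>?K N * x\<rfloor> \<and>
              \<bar>real (\<Sum>t\<in>I N. sc (w t)) / real N - real k * y\<bar> < \<epsilon>"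
    proof (intro ballI conjI)
      fix w assume w: "w \<in> C N"
      show "w t \<in> \<Gamma>'" if "t \<in> I N" for t using C_sum(1)[OF w] that by blast
      show "(\<Sum>t\<in>I N. sz (w t)) = nat \<lfloor>?K N * x\<rfloor>" by (simp only: C_sum(2)[OF w] c(2))
      show "\<bar>real (\<Sum>t\<in>I N. sc (w t)) / real N - real k * y\<bar> < \<epsilon>" by (simp only: sc[OF w] elim(1))
    qed
    with elim(2) show ?case by blast
  qed
  with \<Gamma>'(1,2) show ?thesis by blast
qed

end

section \<open>Large deviations of comparable laws\<close>

text \<open>
  A strict lower bound for a sum of extended reals, either of which may be infinite, is distributed
  over the two summands.
\<close>

lemma ereal_less_add_split:
  assumes "ereal r < A + B" "A \<noteq> -\<infinity>" "B \<noteq> -\<infinity>"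
  shows "\<exists>u v. ereal u < A \<and> ereal v < B \<and> r \<le> u + v"
proof (cases A; cases B)
  fix a b assume ab: "A = ereal a" "B = ereal b"
  then have "r < a + b" using assms(1) by simp
  then show ?thesis using ab by (intro exI[of _ "a - (a + b - r) / 2"] exI[of _ "b - (a + b - r) / 2"]) (auto simp: field_simps)
next
  fix a assume "A = ereal a" "B = \<infinity>"
  then show ?thesis by (intro exI[of _ "a - 1"] exI[of _ "r - a + 1"]) auto
next
  fix b assume "A = \<infinity>" "B = ereal b"
  then show ?thesis by (intro exI[of _ "r - b + 1"] exI[of _ "b - 1"]) auto
next
  assume "A = \<infinity>" "B = \<infinity>"
  then show ?thesis by (intro exI[of _ r] exI[of _ 0]) auto
qed (use assms in auto)

lemma elog_le: "x \<le> y \<Longrightarrow> y > 0 \<Longrightarrow> elog x \<le> ereal (ln y)"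
  unfolding elog_def by auto

lemma elog_ge: "x \<ge> exp y \<Longrightarrow> elog x \<ge> ereal y"
  unfolding elog_def using exp_gt_zero[of y] by (auto simp: ln_ge_iff simp del: exp_gt_zero)

lemma floor_mult_over_nat_tendsto: "(\<lambda>N. real_of_int \<lfloor>a * real N\<rfloor> / real N) \<longlonglongrightarrow> a"
proof (rule Lim_null[THEN iffD2], rule Lim_null_comparison[OF _ lim_1_over_n])
  show "\<forall>\<^sub>F N in sequentially. norm (real_of_int \<lfloor>a * real N\<rfloor> / real N - a) \<le> 1 / real N"
    using eventually_gt_at_top[of 0]
  proof eventually_elim
    case (elim N)
    then have "real_of_int \<lfloor>a * real N\<rfloor> / real N - a = (real_of_int \<lfloor>a * real N\<rfloor> - a * real N) / real N"
      by (simp add: diff_divide_distrib)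
    moreover have "\<bar>real_of_int \<lfloor>a * real N\<rfloor> - a * real N\<bar> \<le> 1" by linarith
    ultimately show ?case by (simp add: divide_right_mono)
  qed
qed

context letters
begin

text \<open>
  The rate function at speed \<open>N\<close> for \<open>k N\<close> letters whose law is multiplied with a density of
  order \<open>exp (- N g a)\<close> at total size \<open>a N\<close>.
\<close>

definition rate_fun :: "nat \<Rightarrow> (real \<Rightarrow> ereal) \<Rightarrow> real \<times> real \<Rightarrow> ereal" where
  "rate_fun k g = (\<lambda>(a, s). ereal (real k) * J (a / real k) (s / real k) + g a)"

end

text \<open>
  The law \<open>W N\<close> of a word over \<open>k N\<close> positions is compared with independent letters; its density
  is of order \<open>exp (- N g a)\<close> if the total size is about \<open>a N\<close>. The upper bound must be locally
  uniform in the total size, and large totals need the crude exponential bound. The lower bound is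
  only demanded for words over a finite alphabet and for one total size for each \<open>N\<close>: for global
  access with \<open>p = 1\<close> every other total near \<open>b N\<close> has density 0.
\<close>

locale comparable_laws = letters \<nu> sz sc letter
  for \<nu> :: "'g pmf" and sz sc :: "'g \<Rightarrow> nat" and letter :: "nat \<Rightarrow> 'g" +
  fixes k :: nat and I :: "nat \<Rightarrow> 't set" and d :: 'g and W :: "nat \<Rightarrow> ('t \<Rightarrow> 'g) pmf"
    and g :: "real \<Rightarrow> ereal" and c :: real
  assumes k: "k \<ge> 1" and I: "finite (I N)" "card (I N) = k * N" and g: "g a \<noteq> -\<infinity>"
    and density_upper: "a \<ge> 0 \<Longrightarrow> ereal u < g a \<Longrightarrow> \<exists>\<delta>>0. \<forall>\<^sub>F N in sequentially. \<forall>w.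
        \<bar>real (\<Sum>t\<in>I N. sz (w t)) / real N - a\<bar> < \<delta> \<longrightarrow>
        pmf (W N) w \<le> exp (- (u * real N)) * pmf (Pi_pmf (I N) d (\<lambda>_. \<nu>)) w"
    and density_growth: "\<forall>\<^sub>F N in sequentially. \<forall>w. pmf (W N) w \<le>
        exp (c * (real N + real (\<Sum>t\<in>I N. sz (w t)))) * pmf (Pi_pmf (I N) d (\<lambda>_. \<nu>)) w"
    and density_lower: "a \<ge> 0 \<Longrightarrow> g a = ereal \<gamma> \<Longrightarrow> \<epsilon> > 0 \<Longrightarrow> finite \<Gamma> \<Longrightarrow> \<Gamma> \<subseteq> set_pmf \<nu> \<Longrightarrow>
        \<forall>\<^sub>F N in sequentially. \<forall>w. (\<forall>t\<in>I N. w t \<in> \<Gamma>) \<longrightarrow> (\<Sum>t\<in>I N. sz (w t)) = nat \<lfloor>a * real N\<rfloor> \<longrightarrow>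
          pmf (Pi_pmf (I N) d (\<lambda>_. \<nu>)) w \<le> exp ((\<gamma> + \<epsilon>) * real N) * pmf (W N) w"
begin

abbreviation total :: "('g \<Rightarrow> nat) \<Rightarrow> nat \<Rightarrow> ('t \<Rightarrow> 'g) \<Rightarrow> nat" where
  "total f N w \<equiv> \<Sum>t\<in>I N. f (w t)"

abbreviation iid :: "nat \<Rightarrow> ('t \<Rightarrow> 'g) pmf" where
  "iid N \<equiv> Pi_pmf (I N) d (\<lambda>_. \<nu>)"

abbreviation event :: "(real \<times> real) set \<Rightarrow> nat \<Rightarrow> ('t \<Rightarrow> 'g) set" where
  "event A N \<equiv> {w. (real (total sz N w) / real N, real (total sc N w) / real N) \<in> A}"

text \<open>
  The exact bound for single values of the totals is combined with the bound for the density; by lower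
  semicontinuity of \<open>J\<close> the result is uniform over all totals close to \<open>(a N, s N)\<close>.
\<close>

lemma local_upper_bound:
  assumes a: "a \<ge> 0" and r: "ereal r < rate_fun k g (a, s)"
  shows "\<exists>\<delta>>0. \<forall>\<^sub>F N in sequentially. \<forall>n m. \<bar>real n / real N - a\<bar> < \<delta> \<longrightarrow> \<bar>real m / real N - s\<bar> < \<delta> \<longrightarrow>
           measure_pmf.prob (W N) {w. total sz N w = n \<and> total sc N w = m} \<le> exp (- (r * real N))"
proof -
  let ?a = "a / real k" and ?s = "s / real k"
  have kJ: "ereal (real k) * J ?a ?s \<noteq> -\<infinity>" using J_nonneg[of ?a ?s] by (cases "J ?a ?s") auto
  then obtain v u where v: "ereal v < ereal (real k) * J ?a ?s" and u: "ereal u < g a" and r_le: "r \<le> v + u"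
    using ereal_less_add_split[OF r[unfolded rate_fun_def prod.case] kJ g] by blast
  have "ereal (v / real k) < J ?a ?s"
    using v k by (cases "J ?a ?s") (auto simp: field_simps)
  then obtain \<delta>1 where \<delta>1: "\<delta>1 > 0" "\<And>x' y'. \<bar>x' - ?a\<bar> < \<delta>1 \<Longrightarrow> \<bar>y' - ?s\<bar> < \<delta>1 \<Longrightarrow> ereal (v / real k) < J x' y'"
    using J_lower_semicontinuous by blast
  obtain \<delta>2 where \<delta>2: "\<delta>2 > 0" "\<forall>\<^sub>F N in sequentially. \<forall>w.
        \<bar>real (total sz N w) / real N - a\<bar> < \<delta>2 \<longrightarrow>
        pmf (W N) w \<le> exp (- (u * real N)) * pmf (iid N) w"
    using density_upper[OF a u] by blast
  have "\<forall>\<^sub>F N in sequentially. \<forall>n m. \<bar>real n / real N - a\<bar> < min \<delta>1 \<delta>2 \<longrightarrow> \<bar>real m / real N - s\<bar> < min \<delta>1 \<delta>2 \<longrightarrow>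
           measure_pmf.prob (W N) {w. total sz N w = n \<and> total sc N w = m} \<le> exp (- (r * real N))"
    using \<delta>2(2) eventually_gt_at_top[of 0]
  proof (eventually_elim, intro allI impI)
    fix N n m :: nat
    let ?E = "{w. total sz N w = n \<and> total sc N w = m}"
    let ?q = "measure_pmf.prob (iid N) ?E"
    assume up: "\<forall>w. \<bar>real (total sz N w) / real N - a\<bar> < \<delta>2 \<longrightarrow>
        pmf (W N) w \<le> exp (- (u * real N)) * pmf (iid N) w"
      and N: "0 < N" and n: "\<bar>real n / real N - a\<bar> < min \<delta>1 \<delta>2" and m: "\<bar>real m / real N - s\<bar> < min \<delta>1 \<delta>2"
    have "measure_pmf.prob (W N) ?E \<le> exp (- (u * real N)) * ?q"
      by (rule prob_le_of_pmf_le) (use up n in auto)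
    also have "?q \<le> exp (- (v * real N))"
    proof (cases "?q > 0")
      case True
      have "I N \<noteq> {}" using I(2)[of N] N k by auto
      then obtain \<mu> h where mu: "moments \<mu> (real n / real (k * N)) (real m / real (k * N))"
        "rel_entropy \<mu> \<nu> = ereal h" "?q \<le> exp (- (real (k * N) * h))"
        using prob_totals_le[OF I(1) _ refl True] unfolding I(2) by blast
      have scale: "\<bar>real j / real (k * N) - b / real k\<bar> < \<delta>1" if "\<bar>real j / real N - b\<bar> < \<delta>1" for j b
      proof -
        have "real j / real (k * N) - b / real k = (real j / real N - b) / real k"
          by (simp add: diff_divide_distrib mult.commute)
        then have "\<bar>real j / real (k * N) - b / real k\<bar> = \<bar>real j / real N - b\<bar> / real k" by simp
        also have "\<dots> \<le> \<bar>real j / real N - b\<bar>" using k by (simp add: divide_le_eq mult_le_cancel_left1)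
        finally show ?thesis using that by simp
      qed
      have "ereal (v / real k) < J (real n / real (k * N)) (real m / real (k * N))"
        using n m by (intro \<delta>1(2) scale) auto
      also have "\<dots> \<le> ereal h" unfolding J_def mu(2)[symmetric] using mu(1) by (auto intro: Inf_lower)
      finally have "v \<le> h * real k" using k by (simp add: divide_less_eq)
      then have "v * real N \<le> h * real k * real N" by (intro mult_right_mono) auto
      then have "exp (- (real (k * N) * h)) \<le> exp (- (v * real N))" by (simp add: mult_ac)
      with mu(3) show ?thesis by (rule order_trans)
    next
      case False
      then have "?q = 0" using measure_nonneg[of _ ?E] by (simp add: less_le)
      then show ?thesis by simp
    qed
    also have "exp (- (u * real N)) * exp (- (v * real N)) = exp (- ((v + u) * real N))"
      by (simp add: algebra_simps flip: exp_add)
    also have "\<dots> \<le> exp (- (r * real N))" using r_le by (simp add: mult_right_mono)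
    finally show "measure_pmf.prob (W N) ?E \<le> exp (- (r * real N))" by simp
  qed
  then show ?thesis using \<delta>1(1) \<delta>2(1) by (intro exI[of _ "min \<delta>1 \<delta>2"]) auto
qed

text \<open>
  Chernoff's bound: weighting the letters with \<open>exp ((c + 1) sz)\<close> absorbs the growth
  \<open>exp (c sz)\<close> of the density and leaves a factor \<open>exp (- sz)\<close>, which is small when the total
  size is large.
\<close>

lemma exponential_tightness:
  "\<exists>C>0. \<forall>\<^sub>F N in sequentially.
    measure_pmf.prob (W N) {w. real (total sz N w) > C * real N} \<le> exp (- (r * real N))"
proof -
  let ?e = "\<lambda>g. pmf \<nu> g * exp ((c + 1) * real (sz g))"
  define Z where "Z = infsum ?e UNIV"
  have Z: "(?e has_sum Z) UNIV" unfolding Z_def using exp_moment by simp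
  have Z_pos: "Z > 0"
  proof -
    have "0 < ?e (letter 0)" using letter_in by (simp add: pmf_positive)
    also have "\<dots> = sum ?e {letter 0}" by simp
    also have "\<dots> \<le> Z" using Z by (rule finite_sum_le_has_sum) auto
    finally show ?thesis .
  qed
  \<comment> \<open>\<open>\<tau>\<close> is \<open>\<nu>\<close> tilted towards large sizes.\<close>
  have "((\<lambda>g. ?e g / Z) has_sum 1) UNIV"
    using has_sum_cmult_left[OF Z, of "1 / Z"] Z_pos by simp
  then obtain \<tau> where \<tau>: "pmf \<tau> = (\<lambda>g. ?e g / Z)"
    using ex_pmf_of_has_sum[of "\<lambda>g. ?e g / Z"] Z_pos by auto
  define C where "C = max 1 (c + real k * ln Z + r)"
  have "\<forall>\<^sub>F N in sequentially. measure_pmf.prob (W N) {w. real (total sz N w) > C * real N} \<le> exp (- (r * real N))"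
    using density_growth
  proof eventually_elim
    case (elim N)
    have "measure_pmf.prob (W N) {w. real (total sz N w) > C * real N} \<le>
        exp (- (r * real N)) * measure_pmf.prob (Pi_pmf (I N) d (\<lambda>_. \<tau>)) {w. real (total sz N w) > C * real N}"
    proof (rule prob_le_of_pmf_le)
      fix w assume "w \<in> {w. real (total sz N w) > C * real N}"
      then have big: "real (total sz N w) \<ge> C * real N" by simp
      show "pmf (W N) w \<le> exp (- (r * real N)) * pmf (Pi_pmf (I N) d (\<lambda>_. \<tau>)) w"
      proof (cases "\<forall>t. t \<notin> I N \<longrightarrow> w t = d")
        case True
        have "(\<Prod>t\<in>I N. pmf \<tau> (w t)) =
            (\<Prod>t\<in>I N. pmf \<nu> (w t)) * exp ((c + 1) * real (total sz N w)) / Z ^ (k * N)"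
          unfolding \<tau> by (simp add: prod_dividef prod.distrib I sum_distrib_left flip: exp_sum[OF I(1)])
        then have "(\<Prod>t\<in>I N. pmf \<nu> (w t)) =
            Z ^ (k * N) * exp (- ((c + 1) * real (total sz N w))) * (\<Prod>t\<in>I N. pmf \<tau> (w t))"
          using Z_pos by (simp add: exp_minus)
        then have "pmf (W N) w \<le> exp (c * (real N + real (total sz N w))) *
            (Z ^ (k * N) * exp (- ((c + 1) * real (total sz N w))) * (\<Prod>t\<in>I N. pmf \<tau> (w t)))"
          using elim[rule_format, of w] True I(1) by (simp add: pmf_Pi')
        also have "\<dots> = exp (c * real N + real k * real N * ln Z - real (total sz N w)) * (\<Prod>t\<in>I N. pmf \<tau> (w t))"
        proof -
          have "Z ^ (k * N) = exp (real k * real N * ln Z)"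
            using Z_pos exp_of_nat_mult[of "k * N" "ln Z"] by simp
          then show ?thesis by (simp add: algebra_simps flip: exp_add)
        qed
        also have "\<dots> \<le> exp (- (r * real N)) * (\<Prod>t\<in>I N. pmf \<tau> (w t))"
        proof -
          have "(c + real k * ln Z + r) * real N \<le> C * real N" unfolding C_def by (intro mult_right_mono) auto
          then have "c * real N + real k * real N * ln Z - real (total sz N w) \<le> - (r * real N)"
            using big by (simp add: algebra_simps)
          then show ?thesis by (intro mult_right_mono) (auto intro: prod_nonneg)
        qed
        finally show ?thesis using True I(1) by (simp add: pmf_Pi')
      next
        case False
        then have "pmf (iid N) w = 0" using I(1) by (intro pmf_Pi_outside) auto
        then show ?thesis using elim[rule_format, of w] by simp
      qed
    qed
    also have "\<dots> \<le> exp (- (r * real N)) * 1" by (intro mult_left_mono) auto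
    finally show ?case by simp
  qed
  moreover have "C > 0" by (simp add: C_def)
  ultimately show ?thesis by blast
qed

text \<open>
  The part of the closed set in a large square is covered by finitely many balls on which
  \<open>local_upper_bound\<close> holds, and the square contains only polynomially many pairs of totals.
\<close>

lemma ldp_upper_bound:
  assumes F: "closedin (top_of_set ({0..} \<times> {0..})) F"
  shows "limsup (\<lambda>N. elog (measure_pmf.prob (W N) (event F N)) / ereal (real N)) \<le> - (INF x\<in>F. rate_fun k g x)"
    (is "?L \<le> - ?inf")
proof -
  have Fsub: "F \<subseteq> {0..} \<times> {0..}" using F closedin_imp_subset by blast
  have Fclosed: "closed F" using F by (rule closedin_closed_trans) (intro closed_Times closed_atLeast)
  have main: "?L \<le> - ereal r" if r: "ereal r < ?inf" for r
  proof -
    obtain C where C: "C > 0" and tail: "\<forall>\<^sub>F N in sequentially.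
        measure_pmf.prob (W N) {w. real (total sz N w) > C * real N} \<le> exp (- (r * real N))"
      using exponential_tightness by blast
    define K where "K = F \<inter> ({0..C} \<times> {0..C})"
    have K: "compact K" unfolding K_def using Fclosed by (intro closed_Int_compact compact_Times compact_Icc)
    let ?good = "\<lambda>x \<delta>. \<forall>\<^sub>F N in sequentially. \<forall>n m. \<bar>real n / real N - fst x\<bar> < \<delta> \<longrightarrow> \<bar>real m / real N - snd x\<bar> < \<delta> \<longrightarrow>
           measure_pmf.prob (W N) {w. total sz N w = n \<and> total sc N w = m} \<le> exp (- (r * real N))"
    have "\<exists>\<delta>>0. ?good x \<delta>" if "x \<in> K" for x
    proof -
      have x: "x \<in> F" "fst x \<ge> 0" using that Fsub by (auto simp: K_def)
      have "ereal r < rate_fun k g (fst x, snd x)"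
        using r x(1) by (auto intro: less_le_trans INF_lower)
      from local_upper_bound[OF x(2) this] show ?thesis .
    qed
    then have "\<exists>\<delta>. \<forall>x\<in>K. \<delta> x > 0 \<and> ?good x (\<delta> x)" by (intro bchoice) blast
    then obtain \<delta> where \<delta>: "\<And>x. x \<in> K \<Longrightarrow> \<delta> x > 0" "\<And>x. x \<in> K \<Longrightarrow> ?good x (\<delta> x)" by blast
    obtain D where D: "D \<subseteq> K" "finite D" "K \<subseteq> (\<Union>x\<in>D. ball x (\<delta> x))"
    proof (rule compactE_image[OF K, of K "\<lambda>x. ball x (\<delta> x)"])
      show "K \<subseteq> (\<Union>x\<in>K. ball x (\<delta> x))" using \<delta>(1) by auto
    qed auto
    have "\<forall>\<^sub>F N in sequentially. \<forall>x\<in>D. \<forall>n m. \<bar>real n / real N - fst x\<bar> < \<delta> x \<longrightarrow> \<bar>real m / real N - snd x\<bar> < \<delta> x \<longrightarrow>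
           measure_pmf.prob (W N) {w. total sz N w = n \<and> total sc N w = m} \<le> exp (- (r * real N))"
      using D \<delta>(2) by (intro eventually_ball_finite) auto
    then have loc: "\<forall>\<^sub>F N in sequentially. \<forall>n m. (real n / real N, real m / real N) \<in> K \<longrightarrow>
           measure_pmf.prob (W N) {w. total sz N w = n \<and> total sc N w = m} \<le> exp (- (r * real N))"
    proof (eventually_elim, intro allI impI)
      fix N n m
      assume h: "\<forall>x\<in>D. \<forall>n m. \<bar>real n / real N - fst x\<bar> < \<delta> x \<longrightarrow> \<bar>real m / real N - snd x\<bar> < \<delta> x \<longrightarrow>
           measure_pmf.prob (W N) {w. total sz N w = n \<and> total sc N w = m} \<le> exp (- (r * real N))"
        and "(real n / real N, real m / real N) \<in> K"
      then obtain x where x: "x \<in> D" "dist x (real n / real N, real m / real N) < \<delta> x" using D(3) by auto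
      have "\<bar>real n / real N - fst x\<bar> < \<delta> x" "\<bar>real m / real N - snd x\<bar> < \<delta> x"
        using dist_fst_le[of x "(real n / real N, real m / real N)"]
          dist_snd_le[of x "(real n / real N, real m / real N)"] x(2) by (auto simp: dist_real_def)
      then show "measure_pmf.prob (W N) {w. total sz N w = n \<and> total sc N w = m} \<le> exp (- (r * real N))"
        using h x(1) by blast
    qed
    let ?b = "\<lambda>N::nat. 1 + (C * real N + 1)\<^sup>2"
    have "\<forall>\<^sub>F N in sequentially. measure_pmf.prob (W N) (event F N) \<le> exp (- (r * real N)) * ?b N"
      using loc tail density_growth eventually_gt_at_top[of 0]
    proof eventually_elim
      case (elim N)
      let ?l = "{..nat \<lfloor>C * real N\<rfloor>}"
      let ?L = "{(n, m) \<in> ?l \<times> ?l. (real n / real N, real m / real N) \<in> K}"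
      have finL: "finite ?L" by (rule finite_subset[of _ "?l \<times> ?l"]) auto
      have "event F N \<inter> set_pmf (W N) \<subseteq> {w. real (total sz N w) > C * real N} \<union> (\<Union>(n, m)\<in>?L. {w. total sz N w = n \<and> total sc N w = m})"
      proof
        fix w assume w: "w \<in> event F N \<inter> set_pmf (W N)"
        then have "pmf (iid N) w \<noteq> 0"
          using elim(3)[rule_format, of w] by (auto simp: set_pmf_iff)
        then have "w \<in> PiE_dflt (I N) d (\<lambda>_. set_pmf \<nu>)"
          using I(1) set_Pi_pmf[of "I N" d "\<lambda>_. \<nu>"] by (auto simp: set_pmf_iff o_def)
        then have sc: "total sc N w \<le> total sz N w" by (intro sum_mono sc_le_sz) (auto simp: PiE_dflt_def)
        show "w \<in> {w. real (total sz N w) > C * real N} \<union> (\<Union>(n, m)\<in>?L. {w. total sz N w = n \<and> total sc N w = m})"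
        proof (cases "real (total sz N w) > C * real N")
          case False
          then have "total sz N w \<le> nat \<lfloor>C * real N\<rfloor>" by (simp add: le_nat_floor)
          moreover have "real (total sz N w) / real N \<le> C" using False elim(4) by (simp add: divide_le_eq)
          moreover have "real (total sc N w) / real N \<le> real (total sz N w) / real N"
            using sc by (intro divide_right_mono) (simp_all only: of_nat_le_iff of_nat_0_le_iff)
          ultimately have "(total sz N w, total sc N w) \<in> ?L" using w sc by (auto simp: K_def simp del: of_nat_sum)
          then show ?thesis by blast
        qed auto
      qed
      then have "measure_pmf.prob (W N) (event F N) \<le> measure_pmf.prob (W N)
          ({w. real (total sz N w) > C * real N} \<union> (\<Union>(n, m)\<in>?L. {w. total sz N w = n \<and> total sc N w = m}))"
        by (subst measure_Int_set_pmf[symmetric]) (intro measure_pmf.finite_measure_mono, auto)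
      also have "\<dots> \<le> measure_pmf.prob (W N) {w. real (total sz N w) > C * real N} +
          measure_pmf.prob (W N) (\<Union>(n, m)\<in>?L. {w. total sz N w = n \<and> total sc N w = m})"
        by (intro measure_Un_le) auto
      also have "measure_pmf.prob (W N) (\<Union>(n, m)\<in>?L. {w. total sz N w = n \<and> total sc N w = m}) \<le>
          (\<Sum>x\<in>?L. measure_pmf.prob (W N) (case x of (n, m) \<Rightarrow> {w. total sz N w = n \<and> total sc N w = m}))"
        using finL by (intro measure_UNION_le) auto
      also have "\<dots> \<le> (\<Sum>x\<in>?L. exp (- (r * real N)))"
        using elim(1) by (intro sum_mono) auto
      also have "\<dots> = real (card ?L) * exp (- (r * real N))" by simp
      also have "real (card ?L) \<le> (C * real N + 1)\<^sup>2"
      proof -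
        have "card ?L \<le> card (?l \<times> ?l)" by (intro card_mono) auto
        also have "\<dots> = (nat \<lfloor>C * real N\<rfloor> + 1)\<^sup>2" by (simp add: power2_eq_square)
        finally have "real (card ?L) \<le> real ((nat \<lfloor>C * real N\<rfloor> + 1)\<^sup>2)" by (rule of_nat_mono)
        also have "\<dots> = (real (nat \<lfloor>C * real N\<rfloor>) + 1)\<^sup>2" by simp
        also have "\<dots> \<le> (C * real N + 1)\<^sup>2" using C by (intro power_mono add_right_mono of_nat_floor) auto
        finally show ?thesis .
      qed
      finally show ?case using elim(2) by (simp add: algebra_simps)
    qed
    then have "\<forall>\<^sub>F N in sequentially. elog (measure_pmf.prob (W N) (event F N)) / ereal (real N) \<le>
        ereal (- r + ln (?b N) / real N)"
      using eventually_gt_at_top[of 0]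
    proof eventually_elim
      case (elim N)
      have b: "?b N > 0" by (intro add_pos_nonneg) auto
      have "elog (measure_pmf.prob (W N) (event F N)) \<le> ereal (ln (exp (- (r * real N)) * ?b N))"
        using elim(1) b by (intro elog_le) auto
      also have "ln (exp (- (r * real N)) * ?b N) = - (r * real N) + ln (?b N)"
        using b by (simp add: ln_mult)
      finally have "elog (measure_pmf.prob (W N) (event F N)) / ereal (real N) \<le> ereal (- (r * real N) + ln (?b N)) / ereal (real N)"
        using elim(2) by (intro ereal_divide_right_mono) auto
      also have "\<dots> = ereal (- r + ln (?b N) / real N)" using elim(2) by (simp add: add_divide_distrib diff_divide_distrib)
      finally show ?case .
    qed
    then have "?L \<le> limsup (\<lambda>N. ereal (- r + ln (?b N) / real N))" by (rule Limsup_mono)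
    also have "\<dots> = ereal (- r)"
    proof (rule lim_imp_Limsup)
      have "(\<lambda>N::nat. - r + ln (?b N) / real N) \<longlonglongrightarrow> - r" using C by real_asymp
      then show "(\<lambda>N. ereal (- r + ln (?b N) / real N)) \<longlonglongrightarrow> ereal (- r)" by simp
    qed simp
    finally show ?thesis by simp
  qed
  have "?inf \<le> - ?L"
  proof (rule dense_le)
    fix z assume z: "z < ?inf"
    show "z \<le> - ?L"
    proof (cases z)
      case (real r)
      have "- (- ereal r) \<le> - ?L" unfolding ereal_minus_le_minus by (rule main) (use z real in simp)
      then show ?thesis unfolding real ereal_uminus_uminus .
    qed (use z in auto)
  qed
  then have "- (- ?L) \<le> - ?inf" unfolding ereal_minus_le_minus .
  then show ?thesis unfolding ereal_uminus_uminus .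
qed

lemma ldp_lower_bound:
  assumes G: "openin (top_of_set ({0..} \<times> {0..})) G"
  shows "liminf (\<lambda>N. elog (measure_pmf.prob (W N) (event G N)) / ereal (real N)) \<ge> - (INF x\<in>G. rate_fun k g x)"
    (is "?L \<ge> - ?inf")
proof -
  have main: "- ?L \<le> ereal \<rho>" if x: "(a, s) \<in> G" and \<rho>: "rate_fun k g (a, s) < ereal \<rho>" for a s \<rho>
  proof -
    obtain T where T: "open T" "G = ({0..} \<times> {0..}) \<inter> T" using G openin_open by metis
    have a: "a \<ge> 0" using x T by auto
    obtain \<gamma> where \<gamma>: "g a = ereal \<gamma>"
      using \<rho> g[of a] J_nonneg[of "a / real k" "s / real k"]
      by (cases "g a") (auto simp: rate_fun_def)
    have "J (a / real k) (s / real k) < ereal ((\<rho> - \<gamma>) / real k)"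
      using \<rho> k J_nonneg[of "a / real k" "s / real k"]
      by (cases "J (a / real k) (s / real k)") (auto simp: rate_fun_def \<gamma> field_simps)
    then obtain \<mu> where \<mu>: "moments \<mu> (a / real k) (s / real k)" "rel_entropy \<mu> \<nu> < ereal ((\<rho> - \<gamma>) / real k)"
      unfolding J_def Inf_less_iff by auto
    obtain h where h: "rel_entropy \<mu> \<nu> = ereal h"
      using \<mu>(2) rel_entropy_nonneg[of \<mu> \<nu>] by (cases "rel_entropy \<mu> \<nu>") auto
    have slack: "real k * h + \<gamma> < \<rho>" using \<mu>(2) k by (simp add: h field_simps)
    obtain \<delta> where \<delta>: "\<delta> > 0" "ball (a, s) \<delta> \<subseteq> T" using T x open_contains_ball by (metis IntD2)
    define \<epsilon> where "\<epsilon> = min ((\<rho> - (real k * h + \<gamma>)) / (real k + 2)) (\<delta> / (2 * (real k + 1)))"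
    have \<epsilon>: "\<epsilon> > 0" unfolding \<epsilon>_def using slack \<delta> by simp
    have "\<epsilon> \<le> (\<rho> - (real k * h + \<gamma>)) / (real k + 2)" "\<epsilon> \<le> \<delta> / (2 * (real k + 1))" unfolding \<epsilon>_def by auto
    then have \<epsilon>1: "real k * (h + \<epsilon>) + \<epsilon> + (\<gamma> + \<epsilon>) \<le> \<rho>" and \<epsilon>2: "(real k + 1) * \<epsilon> \<le> \<delta> / 2"
      by (simp_all add: field_simps)
    obtain \<Gamma> m where \<Gamma>: "finite \<Gamma>" "\<Gamma> \<subseteq> set_pmf \<nu>" and m: "\<And>g. m g \<ge> 0" "(\<Sum>g\<in>\<Gamma>. m g) = 1"
      "(\<Sum>g\<in>\<Gamma>. m g * real (sz g)) = a / real k" "\<bar>(\<Sum>g\<in>\<Gamma>. m g * real (sc g)) - s / real k\<bar> < \<epsilon>"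
      "(\<Sum>g\<in>\<Gamma>. m g * ln (m g / pmf \<nu> g)) < h + \<epsilon>"
      using finite_support_approximation[OF \<mu>(1) h \<epsilon>] by blast
    define y where "y = (\<Sum>g\<in>\<Gamma>. m g * real (sc g))"
    define H where "H = (\<Sum>g\<in>\<Gamma>. m g * ln (m g / pmf \<nu> g))"
    have ka: "real (k * N) * (a / real k) = a * real N" for N using k by simp
    obtain \<Gamma>' where \<Gamma>': "finite \<Gamma>'" "\<Gamma>' \<subseteq> set_pmf \<nu>" and ev: "\<forall>\<^sub>F N in sequentially. \<exists>C.
      (\<forall>w\<in>C. (\<forall>t\<in>I N. w t \<in> \<Gamma>') \<and> total sz N w = nat \<lfloor>a * real N\<rfloor> \<and> \<bar>real (total sc N w) / real N - real k * y\<bar> < \<epsilon>) \<and>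
      measure_pmf.prob (iid N) C \<ge> exp (- ((real k * H + \<epsilon>) * real N))"
      using type_class_lower_bound[OF \<Gamma> m(1,2,3) y_def[symmetric] k I \<epsilon>, of d, folded H_def, unfolded ka]
      by (elim exE conjE) (rule that)
    have ev_a: "\<forall>\<^sub>F N in sequentially. \<bar>real_of_int \<lfloor>a * real N\<rfloor> / real N - a\<bar> < \<delta> / 2"
      using floor_mult_over_nat_tendsto[of a, unfolded tendsto_iff dist_real_def, rule_format, OF half_gt_zero[OF \<delta>(1)]] .
    have "\<forall>\<^sub>F N in sequentially. measure_pmf.prob (W N) (event G N) \<ge> exp (- (\<rho> * real N))"
      using ev ev_a density_lower[OF a \<gamma> \<epsilon> \<Gamma>']
    proof eventually_elim
      case (elim N)
      from elim(1) obtain C where C1: "\<forall>w\<in>C. (\<forall>t\<in>I N. w t \<in> \<Gamma>') \<and> total sz N w = nat \<lfloor>a * real N\<rfloor> \<and> \<bar>real (total sc N w) / real N - real k * y\<bar> < \<epsilon>"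
        and C2: "measure_pmf.prob (iid N) C \<ge> exp (- ((real k * H + \<epsilon>) * real N))"
        by (elim exE conjE) (rule that)
      note C = bspec[OF C1] C2
      have "w \<in> event G N" if w: "w \<in> C" for w
      proof -
        have "real (total sz N w) = real_of_int \<lfloor>a * real N\<rfloor>" using C(1)[OF w] a by simp
        then have 1: "\<bar>real (total sz N w) / real N - a\<bar> < \<delta> / 2" using elim(2) by simp
        have "\<bar>real k * y - s\<bar> = real k * \<bar>y - s / real k\<bar>"
          using k by (simp add: abs_mult[of "real k", simplified, symmetric] right_diff_distrib)
        also have "\<dots> \<le> real k * \<epsilon>" using m(4) unfolding y_def by (intro mult_left_mono) auto
        finally have "\<bar>real (total sc N w) / real N - s\<bar> < \<epsilon> + real k * \<epsilon>" using C(1)[OF w] by linarith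
        also have "\<dots> = (real k + 1) * \<epsilon>" by (simp add: algebra_simps)
        finally have 2: "\<bar>real (total sc N w) / real N - s\<bar> < \<delta> / 2" using \<epsilon>2 by linarith
        have "dist (a, s) (real (total sz N w) / real N, real (total sc N w) / real N) \<le>
            \<bar>a - real (total sz N w) / real N\<bar> + \<bar>s - real (total sc N w) / real N\<bar>"
          unfolding dist_prod_def fst_conv snd_conv dist_real_def by (rule sqrt_sum_squares_le_sum_abs[THEN order_trans]) simp
        then have "dist (a, s) (real (total sz N w) / real N, real (total sc N w) / real N) < \<delta>"
          using 1 2 by linarith
        then have "(real (total sz N w) / real N, real (total sc N w) / real N) \<in> T" using \<delta>(2) by auto
        moreover have "real (total sz N w) / real N \<ge> 0" "real (total sc N w) / real N \<ge> 0" by (rule divide_nonneg_nonneg, rule of_nat_0_le_iff, rule of_nat_0_le_iff)+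
        ultimately show ?thesis unfolding T(2) mem_Collect_eq Int_iff mem_Times_iff fst_conv snd_conv atLeast_iff by blast
      qed
      then have sub: "C \<subseteq> event G N" by blast
      have "exp (- ((real k * H + \<epsilon>) * real N)) \<le> measure_pmf.prob (iid N) C" by (rule C2)
      also have "\<dots> \<le> exp ((\<gamma> + \<epsilon>) * real N) * measure_pmf.prob (W N) C"
        by (rule prob_le_of_pmf_le) (simp add: C1 elim(3))
      also have "\<dots> \<le> exp ((\<gamma> + \<epsilon>) * real N) * measure_pmf.prob (W N) (event G N)"
        using sub by (intro mult_left_mono measure_pmf.finite_measure_mono) auto
      finally have "exp (- ((real k * H + \<epsilon>) * real N)) * exp (- ((\<gamma> + \<epsilon>) * real N)) \<le>
          exp ((\<gamma> + \<epsilon>) * real N) * measure_pmf.prob (W N) (event G N) * exp (- ((\<gamma> + \<epsilon>) * real N))"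
        by (rule mult_right_mono) simp
      also have "\<dots> = measure_pmf.prob (W N) (event G N)" by (simp only: exp_minus) simp
      finally have "exp (- ((real k * H + \<epsilon>) * real N)) * exp (- ((\<gamma> + \<epsilon>) * real N)) \<le> measure_pmf.prob (W N) (event G N)" .
      moreover have "exp (- (\<rho> * real N)) \<le> exp (- ((real k * H + \<epsilon>) * real N)) * exp (- ((\<gamma> + \<epsilon>) * real N))"
      proof -
        have "real k * H \<le> real k * (h + \<epsilon>)" using m(5) unfolding H_def by (intro mult_left_mono) auto
        then have "(real k * H + \<epsilon> + (\<gamma> + \<epsilon>)) * real N \<le> \<rho> * real N" using \<epsilon>1 by (intro mult_right_mono) linarith+
        then have "- (\<rho> * real N) \<le> - ((real k * H + \<epsilon>) * real N) + - ((\<gamma> + \<epsilon>) * real N)"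
          by (simp add: distrib_right)
        then show ?thesis unfolding exp_add[symmetric] exp_le_cancel_iff .
      qed
      ultimately show ?case by (rule order_trans[rotated])
    qed
    then have "\<forall>\<^sub>F N in sequentially. ereal (- \<rho>) \<le> elog (measure_pmf.prob (W N) (event G N)) / ereal (real N)"
      using eventually_gt_at_top[of 0]
    proof eventually_elim
      case (elim N)
      have "ereal (- \<rho>) = ereal (- (\<rho> * real N)) / ereal (real N)" using elim(2) by simp
      also have "\<dots> \<le> elog (measure_pmf.prob (W N) (event G N)) / ereal (real N)"
        using elim by (intro ereal_divide_right_mono elog_ge) auto
      finally show ?case .
    qed
    then have "ereal (- \<rho>) \<le> ?L" by (rule Liminf_bounded)
    then have "- ?L \<le> - ereal (- \<rho>)" unfolding ereal_minus_le_minus .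
    then show ?thesis by (simp only: uminus_ereal.simps minus_minus)
  qed
  have "- ?L \<le> ?inf"
  proof (rule INF_greatest)
    fix x assume x: "x \<in> G"
    show "- ?L \<le> rate_fun k g x"
    proof (rule dense_ge)
      fix z assume z: "rate_fun k g x < z"
      show "- ?L \<le> z"
      proof (cases z)
        case (real \<rho>)
        show ?thesis unfolding real by (rule main[of "fst x" "snd x"]) (use x z real in simp_all)
      qed (use z in auto)
    qed
  qed
  then have "- ?inf \<le> - (- ?L)" unfolding ereal_minus_le_minus .
  then show ?thesis unfolding ereal_uminus_uminus .
qed

end

section \<open>Occupation numbers of the access model\<close>

text \<open>
  The decision of one participant: \<open>None\<close> is no attempt, \<open>Some b\<close> an attempt in box \<open>b\<close>.
\<close>

definition choice_pmf :: "real \<Rightarrow> 'b pmf \<Rightarrow> 'b option pmf" where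
  "choice_pmf q \<mu> = bind_pmf (bernoulli_pmf q) (\<lambda>d. if d then map_pmf Some \<mu> else return_pmf None)"

definition counts :: "'i set \<Rightarrow> ('i \<Rightarrow> 'b option) \<Rightarrow> 'b \<Rightarrow> nat" where
  "counts I F b = card {i\<in>I. F i = Some b}"

text \<open>
  The number of attempts in each box (slot, channel).
\<close>

definition occ :: "outcome \<Rightarrow> nat \<times> nat \<Rightarrow> nat" where
  "occ = (\<lambda>(T, c) (t, k). card {x\<in>T. snd x = t \<and> c x = k})"

lemma pmf_choice:
  assumes "0 \<le> q" "q \<le> 1"
  shows "pmf (choice_pmf q \<mu>) None = 1 - q" "pmf (choice_pmf q \<mu>) (Some b) = q * pmf \<mu> b"
  using assms by (auto simp: choice_pmf_def pmf_bind pmf_map_inj' pmf_map_outside)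

text \<open>
  Deciding first who makes an attempt, and then choosing the boxes of these participants only,
  is how the access model is defined; independent decisions are easier to count.
\<close>

lemma Pi_pmf_choice:
  assumes "finite I"
  shows "Pi_pmf I None (\<lambda>_. choice_pmf q \<mu>) =
    bind_pmf (Pi_pmf I False (\<lambda>_. bernoulli_pmf q)) (\<lambda>d.
      map_pmf (\<lambda>h i. if i \<in> {i\<in>I. d i} then Some (h i) else None) (Pi_pmf {i\<in>I. d i} z (\<lambda>_. \<mu>)))"
proof -
  have "Pi_pmf I None (\<lambda>_. choice_pmf q \<mu>) = bind_pmf (Pi_pmf I False (\<lambda>_. bernoulli_pmf q))
      (\<lambda>d. Pi_pmf I None (\<lambda>i. if d i then map_pmf Some \<mu> else return_pmf None))"
    unfolding choice_pmf_def using assms by (rule Pi_pmf_bind)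
  also have "\<dots> = bind_pmf (Pi_pmf I False (\<lambda>_. bernoulli_pmf q))
      (\<lambda>d. Pi_pmf {i\<in>I. d i} None (\<lambda>_. map_pmf Some \<mu>))"
    using assms by (simp add: Pi_pmf_if_set)
  also have "(\<lambda>d. Pi_pmf {i\<in>I. d i} None (\<lambda>_. map_pmf Some \<mu>)) =
      (\<lambda>d. map_pmf (\<lambda>h i. if i \<in> {i\<in>I. d i} then Some (h i) else None) (Pi_pmf {i\<in>I. d i} z (\<lambda>_. \<mu>)))"
  proof
    fix d :: "'a \<Rightarrow> bool"
    let ?J = "{i\<in>I. d i}"
    have J: "finite ?J" using assms by simp
    have "Pi_pmf ?J None (\<lambda>_. map_pmf Some \<mu>) =
        map_pmf (\<lambda>f i. if i \<in> ?J then f i else None) (Pi_pmf ?J (Some z) (\<lambda>_. map_pmf Some \<mu>))"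
      by (rule Pi_pmf_default_swap[OF J, symmetric])
    also have "Pi_pmf ?J (Some z) (\<lambda>_. map_pmf Some \<mu>) = map_pmf (\<lambda>h. Some \<circ> h) (Pi_pmf ?J z (\<lambda>_. \<mu>))"
      by (rule Pi_pmf_map[OF J]) simp
    finally show "Pi_pmf ?J None (\<lambda>_. map_pmf Some \<mu>) =
        map_pmf (\<lambda>h i. if i \<in> ?J then Some (h i) else None) (Pi_pmf ?J z (\<lambda>_. \<mu>))"
      by (simp add: map_pmf_comp o_def)
  qed
  finally show ?thesis .
qed

text \<open>
  The density of the occupation numbers of \<open>m\<close> participants, at total \<open>n\<close>, with respect to
  independent Poisson variables. Here \<open>\<alpha>\<close> is the mean of the total number of balls for the Poisson
  variables and \<open>\<beta>\<close> the quotient of the probability \<open>q\<close> to make an attempt and \<open>\<alpha>\<close>. It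
  vanishes for \<open>n > m\<close>, since then one factor of the falling factorial is 0.
\<close>

definition poisson_ratio :: "nat \<Rightarrow> real \<Rightarrow> real \<Rightarrow> real \<Rightarrow> nat \<Rightarrow> real" where
  "poisson_ratio m q \<alpha> \<beta> n = (\<Prod>j<n. real (m - j)) * (1 - q) ^ (m - n) * \<beta> ^ n * exp \<alpha>"

lemma falling_fact: "n \<le> m \<Longrightarrow> (\<Prod>j<n. real (m - j)) * fact (m - n) = fact m"
proof (induction n)
  case (Suc n)
  have "fact (m - n) = real (m - n) * fact (m - Suc n)"
    using Suc.prems by (subst fact_reduce) auto
  then show ?case using Suc by (simp add: mult_ac)
qed simp

lemma falling_zero: "n > m \<Longrightarrow> (\<Prod>j<n. real (m - j)) = 0"
  by (rule prod_zero) (auto intro!: bexI[of _ m])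

text \<open>
  In both laws the probability of the occupation numbers \<open>x\<close> is a function of their sum divided by
  the product of the factorials of \<open>x\<close>, so the quotient depends on the sum only.
\<close>

lemma pmf_counts:
  assumes I: "finite I" and B: "finite B" "B \<noteq> {}" and q: "0 \<le> q" "q \<le> 1" and l: "l > 0"
    and \<mu>: "set_pmf \<mu> \<subseteq> B" "\<And>b. b \<in> B \<Longrightarrow> pmf \<mu> b = 1 / real (card B)"
  shows "pmf (map_pmf (counts I) (Pi_pmf I None (\<lambda>_. choice_pmf q \<mu>))) x =
    poisson_ratio (card I) q (l * real (card B)) (q / (real (card B) * l)) (\<Sum>b\<in>B. x b) *
    pmf (Pi_pmf B 0 (\<lambda>_. poisson_pmf l)) x"
proof -
  let ?P = "Pi_pmf I None (\<lambda>_. choice_pmf q \<mu>)"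
  define n where "n = (\<Sum>b\<in>B. x b)"
  define m where "m = card I"
  have pmf_eq: "pmf (map_pmf (counts I) ?P) x = measure_pmf.prob ?P {F. counts I F = x}"
    by (simp add: pmf_map vimage_def)
  have supp: "F i \<in> insert None (Some ` B)" if "F \<in> set_pmf ?P" "i \<in> I" for F i
  proof -
    have "F i \<in> set_pmf (choice_pmf q \<mu>)" using that I by (auto simp: set_Pi_pmf PiE_dflt_def)
    then show ?thesis using \<mu>(1) by (auto simp: choice_pmf_def split: if_splits)
  qed
  have counts_out: "counts I F b = 0" if "F \<in> set_pmf ?P" "b \<notin> B" for F b
  proof -
    have "{i\<in>I. F i = Some b} = {}" using supp[OF that(1)] that(2) by force
    then show ?thesis unfolding counts_def by (simp only: card.empty)
  qed
  have counts_sum: "(\<Sum>b\<in>B. counts I F b) + card {i\<in>I. F i = None} = m" if F: "F \<in> set_pmf ?P" for F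
  proof -
    have "(\<Sum>b\<in>insert None (Some ` B). card {i\<in>I. F i = b}) = card (\<Union>b\<in>insert None (Some ` B). {i\<in>I. F i = b})"
      using I B by (intro card_UN_disjoint[symmetric]) auto
    also have "(\<Union>b\<in>insert None (Some ` B). {i\<in>I. F i = b}) = I" using supp[OF F] by blast
    also have "(\<Sum>b\<in>insert None (Some ` B). card {i\<in>I. F i = b}) =
        card {i\<in>I. F i = None} + (\<Sum>b\<in>B. counts I F b)"
      using B(1) by (simp add: sum.reindex counts_def o_def)
    finally show ?thesis unfolding m_def by simp
  qed
  show ?thesis
  proof (cases "\<forall>b. b \<notin> B \<longrightarrow> x b = 0")
    case False
    then obtain b where b: "b \<notin> B" "x b \<noteq> 0" by blast
    have "set_pmf ?P \<inter> {F. counts I F = x} = {}"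
      using counts_out[OF _ b(1)] b(2) by auto
    then have "pmf (map_pmf (counts I) ?P) x = 0"
      unfolding pmf_eq by (simp add: measure_pmf_zero_iff)
    moreover have "pmf (Pi_pmf B 0 (\<lambda>_. poisson_pmf l)) x = 0"
      using b B by (intro pmf_Pi_outside) auto
    ultimately show ?thesis by simp
  next
    case out: True
    show ?thesis
    proof (cases "n \<le> m")
      case False
      have "set_pmf ?P \<inter> {F. counts I F = x} = {}"
        using counts_sum False by (fastforce simp: n_def)
      then have "pmf (map_pmf (counts I) ?P) x = 0"
        unfolding pmf_eq by (simp add: measure_pmf_zero_iff)
      moreover have "poisson_ratio (card I) q (l * real (card B)) (q / (real (card B) * l)) (\<Sum>b\<in>B. x b) = 0"
        using falling_zero[of m n] False unfolding poisson_ratio_def n_def m_def by simp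
      ultimately show ?thesis by simp
    next
      case True
      let ?\<Gamma> = "insert None (Some ` B)"
      define x' where "x' o' = (case o' of None \<Rightarrow> m - n | Some b \<Rightarrow> x b)" for o'
      have \<Gamma>: "finite ?\<Gamma>" using B by simp
      have sum_x': "(\<Sum>b\<in>?\<Gamma>. x' b) = card I"
        using B True by (simp add: sum.reindex x'_def o_def n_def[symmetric] m_def)
      have "measure_pmf.prob ?P {F. counts I F = x} =
          measure_pmf.prob ?P {F. \<forall>b\<in>?\<Gamma>. card {i\<in>I. F i = b} = x' b}"
      proof (rule measure_eq_AE)
        show "AE F in ?P. (F \<in> {F. counts I F = x}) = (F \<in> {F. \<forall>b\<in>?\<Gamma>. card {i\<in>I. F i = b} = x' b})"
        proof (rule AE_pmfI)
          fix F assume F: "F \<in> set_pmf ?P"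
          have "counts I F = x \<longleftrightarrow> (\<forall>b\<in>B. counts I F b = x b)"
            using counts_out[OF F] out by (auto simp: fun_eq_iff)
          moreover have "card {i\<in>I. F i = None} = m - n" if "\<forall>b\<in>B. counts I F b = x b"
            using counts_sum[OF F] that by (simp add: n_def)
          ultimately show "(F \<in> {F. counts I F = x}) = (F \<in> {F. \<forall>b\<in>?\<Gamma>. card {i\<in>I. F i = b} = x' b})"
            by (auto simp: x'_def counts_def)
        qed
      qed auto
      moreover have "measure_pmf.prob ?P {F. \<forall>b\<in>?\<Gamma>. card {i\<in>I. F i = b} = x' b} * (fact (m - n) * (\<Prod>b\<in>B. fact (x b))) =
          fact m * ((1 - q) ^ (m - n) * (q / real (card B)) ^ n)"
      proof -
        have "(\<Prod>b\<in>?\<Gamma>. fact (x' b) :: real) = fact (m - n) * (\<Prod>b\<in>B. fact (x b))"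
          using B(1) by (simp add: prod.reindex x'_def o_def)
        moreover have "(\<Prod>b\<in>?\<Gamma>. pmf (choice_pmf q \<mu>) b ^ x' b) = (1 - q) ^ (m - n) * (q / real (card B)) ^ n"
          using B(1) by (simp add: prod.reindex x'_def o_def pmf_choice[OF q] \<mu>(2) n_def power_sum)
        ultimately show ?thesis
          using multinomial_law[OF I \<Gamma> sum_x', of None "choice_pmf q \<mu>"] unfolding m_def by simp
      qed
      ultimately have 1: "pmf (map_pmf (counts I) ?P) x * (fact (m - n) * (\<Prod>b\<in>B. fact (x b))) =
          fact m * ((1 - q) ^ (m - n) * (q / real (card B)) ^ n)"
        unfolding pmf_eq by simp
      have 2: "pmf (Pi_pmf B 0 (\<lambda>_. poisson_pmf l)) x * (\<Prod>b\<in>B. fact (x b)) = l ^ n * exp (- (l * real (card B)))"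
      proof -
        have "pmf (Pi_pmf B 0 (\<lambda>_. poisson_pmf l)) x = (\<Prod>b\<in>B. l ^ x b / fact (x b) * exp (- l))"
          using B out l by (subst pmf_Pi') auto
        also have "\<dots> = l ^ n * exp (- (l * real (card B))) / (\<Prod>b\<in>B. fact (x b))"
          by (simp add: prod.distrib prod_dividef n_def power_sum mult.commute flip: exp_of_nat_mult)
        finally show ?thesis using B(1) by simp
      qed
      have card: "real (card B) > 0" using B by (simp add: card_gt_0_iff)
      have ratio: "poisson_ratio m q (l * real (card B)) (q / (real (card B) * l)) n * fact (m - n) *
          (l ^ n * exp (- (l * real (card B)))) = fact m * ((1 - q) ^ (m - n) * (q / real (card B)) ^ n)"
        using l card falling_fact[OF True] unfolding poisson_ratio_def
        by (simp add: exp_minus power_divide power_mult_distrib field_simps)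
      have "pmf (map_pmf (counts I) ?P) x * (fact (m - n) * (\<Prod>b\<in>B. fact (x b))) =
          poisson_ratio m q (l * real (card B)) (q / (real (card B) * l)) n *
          pmf (Pi_pmf B 0 (\<lambda>_. poisson_pmf l)) x * (fact (m - n) * (\<Prod>b\<in>B. fact (x b)))"
        unfolding 1 ratio[symmetric] 2[symmetric] by (simp only: mult_ac)
      moreover have "fact (m - n) * (\<Prod>b\<in>B. fact (x b)) \<noteq> (0::real)" using B(1) by simp
      ultimately show ?thesis unfolding n_def m_def by (rule mult_right_cancel[THEN iffD1, rotated])
    qed
  qed
qed

lemma Pi_pmf_pair:
  assumes "finite J"
  shows "Pi_pmf J (0, 0) (\<lambda>_. pair_pmf P Q) =
    bind_pmf (Pi_pmf J (0::nat) (\<lambda>_. P)) (\<lambda>t. map_pmf (\<lambda>e i. if i \<in> J then (t i, e i) else (0, 0)) (Pi_pmf J (0::nat) (\<lambda>_. Q)))"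
  unfolding pair_pmf_def map_pmf_def
  by (simp add: Pi_pmf_bind[OF assms, where d' = 0] assms)

text \<open>
  Under local access this groups the independent decisions by slots.
\<close>

lemma Pi_pmf_flip:
  assumes "finite A" "finite B"
  shows "Pi_pmf A (\<lambda>_. z) (\<lambda>_. Pi_pmf B z (\<lambda>_. P)) = map_pmf (\<lambda>F t i. F (i, t)) (Pi_pmf (B \<times> A) z (\<lambda>_. P))"
proof (rule pmf_eqI)
  fix G :: "'a \<Rightarrow> 'b \<Rightarrow> 'c"
  let ?f = "\<lambda>F t i. F (i, t)" and ?F = "\<lambda>(i, t). G t i"
  have inj: "inj (?f :: ('b \<times> 'a \<Rightarrow> 'c) \<Rightarrow> _)" by (auto simp: inj_def fun_eq_iff)
  have "pmf (map_pmf ?f (Pi_pmf (B \<times> A) z (\<lambda>_. P))) G = pmf (map_pmf ?f (Pi_pmf (B \<times> A) z (\<lambda>_. P))) (?f ?F)" by simp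
  also have "\<dots> = pmf (Pi_pmf (B \<times> A) z (\<lambda>_. P)) ?F" by (rule pmf_map_inj'[OF inj])
  also have "\<dots> = pmf (Pi_pmf A (\<lambda>_. z) (\<lambda>_. Pi_pmf B z (\<lambda>_. P))) G"
  proof (cases "\<forall>t i. t \<notin> A \<or> i \<notin> B \<longrightarrow> G t i = z")
    case True
    then have "pmf (Pi_pmf (B \<times> A) z (\<lambda>_. P)) ?F = (\<Prod>(i, t)\<in>B \<times> A. pmf P (G t i))"
      using assms by (subst pmf_Pi') (auto intro!: prod.cong)
    also have "\<dots> = (\<Prod>t\<in>A. \<Prod>i\<in>B. pmf P (G t i))"
      by (subst prod.cartesian_product[symmetric]) (rule prod.swap)
    also have "\<dots> = pmf (Pi_pmf A (\<lambda>_. z) (\<lambda>_. Pi_pmf B z (\<lambda>_. P))) G"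
      using assms True by (subst pmf_Pi') (auto intro!: prod.cong simp: pmf_Pi')
    finally show ?thesis .
  next
    case False
    then obtain t i where ti: "t \<notin> A \<or> i \<notin> B" "G t i \<noteq> z" by blast
    have "pmf (Pi_pmf (B \<times> A) z (\<lambda>_. P)) ?F = 0"
      using assms ti by (intro pmf_Pi_outside) auto
    moreover have "pmf (Pi_pmf A (\<lambda>_. z) (\<lambda>_. Pi_pmf B z (\<lambda>_. P))) G = 0"
    proof (cases "t \<in> A")
      case True
      then have "pmf (Pi_pmf B z (\<lambda>_. P)) (G t) = 0" using ti assms by (intro pmf_Pi_outside) auto
      then show ?thesis using True assms by (subst pmf_Pi) (auto intro!: prod_zero bexI[of _ t])
    next
      case False
      then show ?thesis using ti assms by (intro pmf_Pi_outside) auto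
    qed
    ultimately show ?thesis by simp
  qed
  finally show "pmf (Pi_pmf A (\<lambda>_. z) (\<lambda>_. Pi_pmf B z (\<lambda>_. P))) G = pmf (map_pmf ?f (Pi_pmf (B \<times> A) z (\<lambda>_. P))) G" ..
qed

text \<open>
  An attempt is successful iff it is alone in its box, so the successful attempts correspond to the
  boxes that contain exactly one attempt.
\<close>

lemma attempts_successes_occ:
  assumes T: "finite T" "\<And>x. x \<in> T \<Longrightarrow> snd x < N" "\<And>x. x \<in> T \<Longrightarrow> c x < \<kappa>"
  shows "attempts (T, c) = (\<Sum>b\<in>{..<N} \<times> {..<\<kappa>}. occ (T, c) b)"
    "successes (T, c) = (\<Sum>b\<in>{..<N} \<times> {..<\<kappa>}. of_bool (occ (T, c) b = 1))"
proof -
  let ?B = "{..<N} \<times> {..<\<kappa>}"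
  let ?f = "\<lambda>x. (snd x, c x)"
  have occ: "occ (T, c) b = card {x\<in>T. ?f x = b}" for b
    by (cases b) (simp add: occ_def)
  have "(\<Sum>b\<in>?B. occ (T, c) b) = (\<Sum>b\<in>?B. \<Sum>x\<in>{x\<in>T. ?f x = b}. 1)" by (simp add: occ)
  also have "\<dots> = (\<Sum>x\<in>T. 1)" using T by (intro sum.group) auto
  finally show "attempts (T, c) = (\<Sum>b\<in>?B. occ (T, c) b)" by (simp add: attempts_def)
  let ?S = "{x \<in> T. \<forall>y \<in> T. y \<noteq> x \<longrightarrow> snd y = snd x \<longrightarrow> c y \<noteq> c x}"
  have "bij_betw ?f ?S {b\<in>?B. occ (T, c) b = 1}"
  proof (rule bij_betw_imageI)
    show "inj_on ?f ?S" by (auto simp: inj_on_def)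
    show "?f ` ?S = {b\<in>?B. occ (T, c) b = 1}"
    proof (intro equalityI subsetI)
      fix b assume "b \<in> ?f ` ?S"
      then obtain x where x: "x \<in> ?S" "b = ?f x" by blast
      then have "{y\<in>T. ?f y = b} = {x}" by auto
      then show "b \<in> {b\<in>?B. occ (T, c) b = 1}" using x T by (auto simp: occ)
    next
      fix b assume "b \<in> {b\<in>?B. occ (T, c) b = 1}"
      then have "card {x\<in>T. ?f x = b} = 1" by (simp add: occ)
      then obtain x where x: "{x\<in>T. ?f x = b} = {x}" by (auto simp: card_1_singleton_iff)
      then have "x \<in> T" "?f x = b" by blast+
      moreover have "y = x" if "y \<in> T" "snd y = snd x" "c y = c x" for y
        using x that \<open>?f x = b\<close> by blast
      ultimately show "b \<in> ?f ` ?S" by blast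
    qed
  qed
  then have "successes (T, c) = card {b\<in>?B. occ (T, c) b = 1}"
    unfolding successes_def by (simp add: bij_betw_same_card)
  also have "\<dots> = (\<Sum>b\<in>?B. of_bool (occ (T, c) b = 1))"
    by (simp add: of_bool_def sum.If_cases Int_def)
  finally show "successes (T, c) = (\<Sum>b\<in>?B. of_bool (occ (T, c) b = 1))" .
qed

lemma set_MC_pmf:
  assumes "N \<ge> 1" "\<kappa> \<ge> 1" "(T, c) \<in> set_pmf (MC_pmf D b p \<kappa> N)"
  shows "finite T" "\<And>x. x \<in> T \<Longrightarrow> snd x < N" "\<And>x. x \<in> T \<Longrightarrow> c x < \<kappa>"
proof -
  have ne: "{..<N} \<noteq> {}" "{..<\<kappa>} \<noteq> {}" using assms by (auto simp: lessThan_empty_iff)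
  have T: "T \<in> set_pmf (access D b p N)" and c: "c \<in> set_pmf (Pi_pmf T 0 (\<lambda>_. pmf_of_set {..<\<kappa>}))"
    using assms(3) by (auto simp: MC_pmf_def)
  have "finite T \<and> (\<forall>x\<in>T. snd x < N)"
  proof (cases D)
    case Local
    then show ?thesis using T by (auto simp: local_access_def intro: finite_subset[of _ "{..<participants b N} \<times> {..<N}"])
  next
    case Global
    then show ?thesis using T ne
      by (auto simp: global_access_def Let_def set_Pi_pmf PiE_dflt_def)
  qed
  then show "finite T" "\<And>x. x \<in> T \<Longrightarrow> snd x < N" by auto
  then show "\<And>x. x \<in> T \<Longrightarrow> c x < \<kappa>" using c ne by (auto simp: set_Pi_pmf PiE_dflt_def)
qed

lemma prob_MC_eq_occ:
  assumes "N \<ge> 1" "\<kappa> \<ge> 1"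
  shows "measure_pmf.prob (MC_pmf D b p \<kappa> N) {\<omega>. empirical_pair N \<omega> \<in> F} =
    measure_pmf.prob (map_pmf occ (MC_pmf D b p \<kappa> N)) {x.
      (real (\<Sum>b\<in>{..<N} \<times> {..<\<kappa>}. x b) / real N,
       real (\<Sum>b\<in>{..<N} \<times> {..<\<kappa>}. of_bool (x b = 1)) / real N) \<in> F}"
  unfolding measure_map_pmf
proof (rule measure_eq_AE, rule AE_pmfI)
  fix \<omega> assume "\<omega> \<in> set_pmf (MC_pmf D b p \<kappa> N)"
  moreover obtain T c where \<omega>: "\<omega> = (T, c)" by (cases \<omega>)
  ultimately have "(T, c) \<in> set_pmf (MC_pmf D b p \<kappa> N)" by simp
  note supp = set_MC_pmf[OF assms this]
  have eqs: "attempts (T, c) = (\<Sum>b\<in>{..<N} \<times> {..<\<kappa>}. occ (T, c) b)"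
    "successes (T, c) = (\<Sum>b\<in>{..<N} \<times> {..<\<kappa>}. of_bool (occ (T, c) b = 1))"
    by (rule attempts_successes_occ; use supp in blast)+
  show "(\<omega> \<in> {\<omega>. empirical_pair N \<omega> \<in> F}) = (\<omega> \<in> occ -` {x.
      (real (\<Sum>b\<in>{..<N} \<times> {..<\<kappa>}. x b) / real N,
       real (\<Sum>b\<in>{..<N} \<times> {..<\<kappa>}. of_bool (x b = 1)) / real N) \<in> F})"
    unfolding \<omega> mem_Collect_eq vimage_eq empirical_pair_def eqs ..
qed auto

lemma occ_Local:
  fixes b p :: real and N \<kappa> :: nat
  assumes "N \<ge> 1" "\<kappa> \<ge> 1"
  defines "E \<equiv> {..<participants b N} \<times> {..<N}"
  shows "map_pmf occ (MC_pmf Local b p \<kappa> N) =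
    map_pmf (\<lambda>F (t, k). card {i\<in>{..<participants b N}. F (i, t) = Some k})
      (Pi_pmf E None (\<lambda>_. choice_pmf (p / real N) (pmf_of_set {..<\<kappa>})))"
proof -
  have E: "finite E" by (simp add: E_def)
  have *: "(\<lambda>(t, k). card {i\<in>{..<participants b N}.
      (if (i, t) \<in> {x\<in>E. f x} then Some (c (i, t)) else None) = Some k}) = occ ({x\<in>E. f x}, c)" for f c
  proof (rule ext, clarify)
    fix t k
    have "bij_betw (\<lambda>i. (i, t)) {i\<in>{..<participants b N}.
      (if (i, t) \<in> {x\<in>E. f x} then Some (c (i, t)) else None) = Some k} {x\<in>{x\<in>E. f x}. snd x = t \<and> c x = k}"
      by (rule bij_betwI[where g = fst]) (auto simp: E_def split: if_splits)
    then show "card {i\<in>{..<participants b N}.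
      (if (i, t) \<in> {x\<in>E. f x} then Some (c (i, t)) else None) = Some k} = occ ({x\<in>E. f x}, c) (t, k)"
      by (simp add: occ_def bij_betw_same_card)
  qed
  show ?thesis
    unfolding MC_pmf_def access.simps local_access_def Pi_pmf_choice[OF E, where z = 0] E_def[symmetric]
      bind_map_pmf map_bind_pmf map_pmf_comp * ..
qed

text \<open>
  Since each participant makes at most one attempt, the channels may be attached to participants
  instead of attempts; then slot and channel together form one uniform box.
\<close>

lemma occ_Global:
  assumes "N \<ge> 1" "\<kappa> \<ge> 1"
  shows "map_pmf occ (MC_pmf Global b p \<kappa> N) =
    map_pmf (counts {..<participants b N}) (Pi_pmf {..<participants b N} None
      (\<lambda>_. choice_pmf p (pair_pmf (pmf_of_set {..<N}) (pmf_of_set {..<\<kappa>}))))"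
proof -
  let ?I = "{..<participants b N}" and ?U = "pmf_of_set {..<N}" and ?V = "pmf_of_set {..<\<kappa>}"
  have counts: "counts ?I (\<lambda>i. if i \<in> {i\<in>?I. d i} then Some (h i) else None) = (\<lambda>b. card {i\<in>{i\<in>?I. d i}. h i = b})"
    for d and h :: "nat \<Rightarrow> nat \<times> nat"
    by (auto simp: counts_def fun_eq_iff intro!: arg_cong[where f = card])
  have inner: "map_pmf (\<lambda>c. occ ((\<lambda>i. (i, t i)) ` J, c)) (Pi_pmf ((\<lambda>i. (i, t i)) ` J) 0 (\<lambda>_. ?V)) =
      map_pmf (\<lambda>e b. card {i\<in>J. (if i \<in> J then (t i, e i) else (0, 0)) = b}) (Pi_pmf J 0 (\<lambda>_. ?V))"
    if J: "finite J" for J :: "nat set" and t :: "nat \<Rightarrow> nat"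
  proof -
    let ?h = "\<lambda>i. (i, t i)"
    have bij: "bij_betw ?h J (?h ` J)" by (auto simp: bij_betw_def inj_on_def)
    have P: "Pi_pmf J 0 (\<lambda>_. ?V) = map_pmf (\<lambda>g. g \<circ> ?h) (Pi_pmf (?h ` J) 0 (\<lambda>_. ?V))"
      by (rule Pi_pmf_bij_betw[OF J bij]) auto
    have "occ (?h ` J, c) = (\<lambda>b. card {i\<in>J. (if i \<in> J then (t i, (c \<circ> ?h) i) else (0, 0)) = b})" for c
    proof (rule ext, clarify)
      fix s k
      have "bij_betw ?h {i\<in>J. (if i \<in> J then (t i, (c \<circ> ?h) i) else (0, 0)) = (s, k)} {x\<in>?h ` J. snd x = s \<and> c x = k}"
        by (rule bij_betwI[where g = fst]) (auto split: if_splits)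
      then show "occ (?h ` J, c) (s, k) = card {i\<in>J. (if i \<in> J then (t i, (c \<circ> ?h) i) else (0, 0)) = (s, k)}"
        by (simp add: occ_def bij_betw_same_card)
    qed
    then show ?thesis unfolding P map_pmf_comp by simp
  qed
  have "map_pmf occ (MC_pmf Global b p \<kappa> N) = bind_pmf (Pi_pmf ?I False (\<lambda>_. bernoulli_pmf p)) (\<lambda>d.
      bind_pmf (Pi_pmf {i\<in>?I. d i} 0 (\<lambda>_. ?U)) (\<lambda>t.
        map_pmf (\<lambda>c. occ ((\<lambda>i. (i, t i)) ` {i\<in>?I. d i}, c)) (Pi_pmf ((\<lambda>i. (i, t i)) ` {i\<in>?I. d i}) 0 (\<lambda>_. ?V))))"
    unfolding MC_pmf_def access.simps global_access_def Let_def
    by (simp add: bind_assoc_pmf bind_map_pmf map_bind_pmf map_pmf_comp)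
  also have "\<dots> = bind_pmf (Pi_pmf ?I False (\<lambda>_. bernoulli_pmf p)) (\<lambda>d.
      map_pmf (\<lambda>h b. card {i\<in>{i\<in>?I. d i}. h i = b}) (Pi_pmf {i\<in>?I. d i} (0, 0) (\<lambda>_. pair_pmf ?U ?V)))"
    by (simp add: inner Pi_pmf_pair map_bind_pmf map_pmf_comp)
  also have "\<dots> = map_pmf (counts ?I) (Pi_pmf ?I None (\<lambda>_. choice_pmf p (pair_pmf ?U ?V)))"
    unfolding Pi_pmf_choice[OF finite_lessThan, where z = "(0, 0)"] map_bind_pmf map_pmf_comp counts ..
  finally show ?thesis .
qed

section \<open>The two rate functions\<close>

lemma poisson_exp_moment:
  assumes "l > 0"
  shows "(\<lambda>g. pmf (poisson_pmf l) g * exp (\<theta> * real g)) summable_on UNIV"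
proof (rule norm_summable_imp_summable_on)
  have "summable (\<lambda>g. exp (- l) * ((l * exp \<theta>) ^ g /\<^sub>R fact g))"
    by (intro summable_mult sums_summable[OF exp_converges])
  also have "(\<lambda>g. exp (- l) * ((l * exp \<theta>) ^ g /\<^sub>R fact g)) = (\<lambda>g. norm (pmf (poisson_pmf l) g * exp (\<theta> * real g)))"
  proof
    fix g :: nat
    have "exp (\<theta> * real g) = exp \<theta> ^ g" by (simp add: mult.commute flip: exp_of_nat_mult)
    then show "exp (- l) * ((l * exp \<theta>) ^ g /\<^sub>R fact g) = norm (pmf (poisson_pmf l) g * exp (\<theta> * real g))"
      using assms by (simp add: power_mult_distrib divide_inverse)
  qed
  finally show "summable (\<lambda>g. norm (pmf (poisson_pmf l) g * exp (\<theta> * real g)))" .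
qed

lemma letters_poisson:
  assumes "l > 0"
  shows "letters (poisson_pmf l) (\<lambda>g. g) (\<lambda>g. of_bool (g = 1)) (\<lambda>n. n)"
  by standard (use assms poisson_exp_moment in auto)

lemma set_M_pmf_subset: "set_pmf (M_pmf b p \<kappa>) \<subseteq> Xi \<kappa>"
proof
  fix x assume "x \<in> set_pmf (M_pmf b p \<kappa>)"
  then obtain X :: "nat \<Rightarrow> nat" where x: "x = (\<Sum>k<\<kappa>. X k, \<Sum>k<\<kappa>. of_bool (X k = 1))" by (auto simp: M_pmf_def)
  have "(\<Sum>k<\<kappa>. of_bool (X k = 1)) \<le> (\<Sum>k<\<kappa>. X k)" by (intro sum_mono) auto
  moreover have "(\<Sum>k<\<kappa>. of_bool (X k = 1)) \<le> (\<Sum>k<\<kappa>. 1 :: nat)" by (intro sum_mono) auto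
  ultimately show "x \<in> Xi \<kappa>" unfolding x Xi_def by simp
qed

text \<open>
  A total of \<open>n\<close> attempts in a slot is realised by placing all of them in channel 0, with one
  success iff \<open>n = 1\<close>.
\<close>

lemma letters_M_pmf:
  assumes "b > 0" "p > 0" "\<kappa> \<ge> 1"
  shows "letters (M_pmf b p \<kappa>) fst snd (\<lambda>n. (n, of_bool (n = 1)))"
proof
  let ?l = "b * p / real \<kappa>"
  have l: "?l > 0" using assms by simp
  show "finite {g \<in> set_pmf (M_pmf b p \<kappa>). fst g \<le> n}" for n
    by (rule finite_subset[of _ "{..n} \<times> {..n}"]) (use set_M_pmf_subset[of b p \<kappa>] in \<open>auto simp: Xi_def\<close>)
  show "snd g \<le> fst g" if "g \<in> set_pmf (M_pmf b p \<kappa>)" for g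
    using that set_M_pmf_subset[of b p \<kappa>] by (auto simp: Xi_def)
  show "(n, of_bool (n = 1)) \<in> set_pmf (M_pmf b p \<kappa>)" for n
  proof -
    let ?X = "\<lambda>k::nat. if k = 0 then n else 0"
    have X: "?X \<in> set_pmf (Pi_pmf {..<\<kappa>} 0 (\<lambda>_. poisson_pmf ?l))"
      using assms(3) l by (auto simp: set_Pi_pmf PiE_dflt_def)
    have sum: "(\<Sum>k<\<kappa>. ?X k) = n" using assms(3) by simp
    have "(\<Sum>k<\<kappa>. of_bool (?X k = 1) :: nat) = (\<Sum>k<\<kappa>. if k = 0 then of_bool (n = 1) else 0)"
      by (intro sum.cong) auto
    also have "\<dots> = of_bool (n = 1)" using assms(3) by simp
    finally show ?thesis
      unfolding M_pmf_def set_map_pmf by (intro image_eqI[OF _ X]) (simp only: sum)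
  qed
  show "fst (n, of_bool (n = 1)) = n" for n by simp
  show "(\<lambda>g. pmf (M_pmf b p \<kappa>) g * exp (\<theta> * real (fst g))) summable_on UNIV" for \<theta>
  proof -
    have "integrable (measure_pmf (Pi_pmf {..<\<kappa>} 0 (\<lambda>_. poisson_pmf ?l))) (\<lambda>X. \<Prod>k<\<kappa>. exp (\<theta> * real (X k)))"
      by (intro integrable_prod_Pi_pmf) (simp_all only: integrable_measure_pmf_iff poisson_exp_moment[OF l] finite_lessThan)
    then have "integrable (measure_pmf (M_pmf b p \<kappa>)) (\<lambda>g. exp (\<theta> * real (fst g)))"
      by (simp add: M_pmf_def integrable_map_pmf_eq sum_distrib_left exp_sum)
    then show ?thesis by (simp only: integrable_measure_pmf_iff)
  qed
qed

lemma rate_L_eq: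
  assumes "b > 0" "p > 0" "\<kappa> \<ge> 1"
  shows "rate_L b p \<kappa> = letters.rate_fun (M_pmf b p \<kappa>) fst snd 1 (\<lambda>_. 0)"
proof
  interpret letters "M_pmf b p \<kappa>" fst snd "\<lambda>n. (n, of_bool (n = 1))"
    using assms by (rule letters_M_pmf)
  fix x :: "real \<times> real"
  obtain a s where x: "x = (a, s)" by (cases x)
  have mom: "((\<lambda>(i, j). pmf \<mu> (i, j) * real i) has_sum a) (Xi \<kappa>) \<and>
      ((\<lambda>(i, j). pmf \<mu> (i, j) * real j) has_sum s) (Xi \<kappa>) \<longleftrightarrow> moments \<mu> a s"
    if "set_pmf \<mu> \<subseteq> Xi \<kappa>" for \<mu>
  proof -
    have "((\<lambda>(i, j). pmf \<mu> (i, j) * f (i, j)) has_sum c) (Xi \<kappa>) \<longleftrightarrow>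
        ((\<lambda>g. pmf \<mu> g * f g) has_sum c) UNIV" for f :: "nat \<times> nat \<Rightarrow> real" and c
      by (rule has_sum_cong_neutral) (use that in \<open>auto simp: set_pmf_iff\<close>)
    from this[of "\<lambda>g. real (fst g)" a] this[of "\<lambda>g. real (snd g)" s]
    show ?thesis unfolding moments_def by simp
  qed
  have "rate_L b p \<kappa> (a, s) = J a s"
    unfolding rate_L_def J_def prod.case
  proof (intro antisym)
    let ?A = "{rel_entropy \<mu> (M_pmf b p \<kappa>) |\<mu>. set_pmf \<mu> \<subseteq> Xi \<kappa> \<and>
      ((\<lambda>(i, j). pmf \<mu> (i, j) * real i) has_sum a) (Xi \<kappa>) \<and> ((\<lambda>(i, j). pmf \<mu> (i, j) * real j) has_sum s) (Xi \<kappa>)}"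
    let ?B = "{rel_entropy \<mu> (M_pmf b p \<kappa>) |\<mu>. moments \<mu> a s}"
    have "?A \<subseteq> ?B" using mom by auto
    then show "Inf ?B \<le> Inf ?A" by (rule Inf_superset_mono)
    show "Inf ?A \<le> Inf ?B"
    proof (rule Inf_greatest)
      fix z assume "z \<in> ?B"
      then obtain \<mu> where \<mu>: "z = rel_entropy \<mu> (M_pmf b p \<kappa>)" "moments \<mu> a s" by blast
      show "Inf ?A \<le> z"
      proof (cases "set_pmf \<mu> \<subseteq> Xi \<kappa>")
        case True
        then have "z \<in> ?A" using \<mu> mom by blast
        then show ?thesis by (rule Inf_lower)
      next
        case False
        then have "z = \<infinity>" using \<mu>(1) set_M_pmf_subset[of b p \<kappa>] by (auto simp: rel_entropy_def)
        then show ?thesis by simp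
      qed
    qed
  qed
  then show "rate_L b p \<kappa> x = rate_fun 1 (\<lambda>_. 0) x"
    unfolding x rate_fun_def prod.case
    by (simp only: of_nat_1 one_ereal_def[symmetric] div_by_1 mult_1_left add_0_right)
qed

text \<open>
  The rate function of the binomial number of attempts minus that of a Poisson variable with the same
  mean.
\<close>

definition access_cost :: "real \<Rightarrow> real \<Rightarrow> real \<Rightarrow> ereal" where
  "access_cost b p a = (if a > b then \<infinity> else ereal (a - b * p) + idle_cost b p a)"

lemma rate_G_eq:
  assumes "b > 0" "p > 0" "\<kappa> \<ge> 1"
  shows "rate_G b p \<kappa> = letters.rate_fun (poisson_pmf (b * p / real \<kappa>)) (\<lambda>g. g) (\<lambda>g. of_bool (g = 1))
           \<kappa> (access_cost b p)"
proof
  let ?l = "b * p / real \<kappa>"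
  interpret letters "poisson_pmf ?l" "\<lambda>g. g" "\<lambda>g. of_bool (g = 1)" "\<lambda>n. n"
    by (rule letters_poisson) (use assms in simp)
  fix x :: "real \<times> real"
  obtain a s where x: "x = (a, s)" by (cases x)
  have eq: "((\<lambda>g. pmf \<mu> g * real (of_bool (g = 1))) has_sum y) UNIV \<longleftrightarrow> pmf \<mu> 1 = y" for \<mu> :: "nat pmf" and y
  proof -
    have "((\<lambda>g. pmf \<mu> g * real (of_bool (g = 1))) has_sum pmf \<mu> 1) UNIV"
      by (rule has_sum_finite_neutralI[of "{1}"]) simp_all
    note h = this
    show ?thesis
    proof
      assume "((\<lambda>g. pmf \<mu> g * real (of_bool (g = 1))) has_sum y) UNIV"
      then show "pmf \<mu> 1 = y" by (rule has_sum_unique[OF h])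
    next
      assume "pmf \<mu> 1 = y"
      then show "((\<lambda>g. pmf \<mu> g * real (of_bool (g = 1))) has_sum y) UNIV" using h by (simp only:)
    qed
  qed
  have J_eq: "Inf {rel_entropy \<mu> (poisson_pmf ?l) | \<mu>.
        ((\<lambda>g. pmf \<mu> g * real g) has_sum (a / real \<kappa>)) UNIV \<and> pmf \<mu> 1 = s / real \<kappa>} = J (a / real \<kappa>) (s / real \<kappa>)"
    unfolding J_def moments_def eq ..
  have inf: "y + \<infinity> = \<infinity>" for y :: ereal by simp
  have G: "rate_G b p \<kappa> (a, s) = (if a > b then \<infinity> else
      ereal (real \<kappa>) * J (a / real \<kappa>) (s / real \<kappa>) + ereal (a - b * p) + idle_cost b p a)"
    unfolding rate_G_def prod.case J_eq ..
  have R: "rate_fun \<kappa> (access_cost b p) (a, s) = ereal (real \<kappa>) * J (a / real \<kappa>) (s / real \<kappa>) +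
      (if a > b then \<infinity> else ereal (a - b * p) + idle_cost b p a)"
    unfolding rate_fun_def prod.case access_cost_def ..
  have "rate_G b p \<kappa> (a, s) = rate_fun \<kappa> (access_cost b p) (a, s)"
  proof (cases "a > b")
    case True
    then show ?thesis unfolding G R by simp
  next
    case False
    show ?thesis unfolding G R if_not_P[OF False] add.assoc by (rule refl)
  qed
  then show "rate_G b p \<kappa> x = rate_fun \<kappa> (access_cost b p) x" unfolding x .
qed

section \<open>Asymptotics of the density for global access\<close>

lemma participants_over_nat_tendsto:
  assumes "b > 0"
  shows "(\<lambda>N. real (participants b N) / real N) \<longlonglongrightarrow> b"
  using floor_mult_over_nat_tendsto[of b] assms by (simp add: participants_def)

lemma participants_bounds:
  assumes "b > 0"
  shows "real (participants b N) \<le> b * real N" "real (participants b N) \<ge> b * real N - 1"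
proof -
  have "real (participants b N) = real_of_int \<lfloor>b * real N\<rfloor>" using assms by (simp add: participants_def)
  then show "real (participants b N) \<le> b * real N" "real (participants b N) \<ge> b * real N - 1" by linarith+
qed

lemma falling_le:
  assumes "b > 0" "N \<ge> 1"
  shows "(\<Prod>j<n. real (participants b N - j)) * (1 / (b * real N)) ^ n \<le> 1"
proof -
  have "(\<Prod>j<n. real (participants b N - j)) * (1 / (b * real N)) ^ n =
      (\<Prod>j<n. real (participants b N - j) * (1 / (b * real N)))"
    by (simp only: prod.distrib prod_constant card_lessThan)
  also have "\<dots> \<le> (\<Prod>j<n. 1)"
  proof (rule prod_mono)
    fix j
    have "real (participants b N - j) \<le> b * real N"
      using participants_bounds(1)[OF assms(1), of N] by (simp add: order_trans[rotated])
    then show "0 \<le> real (participants b N - j) * (1 / (b * real N)) \<and> real (participants b N - j) * (1 / (b * real N)) \<le> 1"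
      using assms by simp
  qed
  finally show ?thesis by simp
qed

lemma falling_nonneg: "(\<Prod>j<n. real (m - j)) \<ge> 0"
  by (intro prod_nonneg) auto

lemma ln_mult_power:
  assumes "c > 0" "q > (0::real)"
  shows "ln (c * q ^ k) = ln c + real k * ln q"
proof -
  have "ln (c * q ^ k) = ln c + ln (q ^ k)" using assms by (subst ln_mult) auto
  then show ?thesis using ln_realpow[of q k] by simp
qed

lemma rescale_difference:
  fixes b N :: real
  assumes "b > 0" "N > 0" "n = m - k"
  shows "b * ((x / (b * N) - m / (b * N) * t) - (y / (b * N) - k / (b * N) * t)) + b * p =
    (x - y - n * t + b * p * N) / N"
proof -
  have m: "m = n + k" using assms(3) by simp
  show ?thesis using assms(1,2) unfolding m by (simp add: field_simps)
qed

text \<open>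
  Stirling's formula for \<open>m!\<close> and \<open>(m - n)!\<close>, both on the scale \<open>b N\<close>. The factor
  \<open>(1 - p) ^ (m - n)\<close> of the density is treated separately, because it may vanish
  for \<open>p = 1\<close>.
\<close>

lemma ln_falling_limit:
  fixes N n :: "'i \<Rightarrow> nat"
  assumes b: "b > 0" and a: "a \<le> b" and N: "filterlim N at_top F"
    and n: "((\<lambda>i. real (n i) / real (N i)) \<longlongrightarrow> a) F"
    and le: "\<forall>\<^sub>F i in F. n i \<le> participants b (N i)"
  shows "((\<lambda>i. ln ((\<Prod>j<n i. real (participants b (N i) - j)) * (1 / (b * real (N i))) ^ n i * exp (b * p * real (N i))) / real (N i))
           \<longlongrightarrow> b * p - a - (b - a) * ln (1 - a / b)) F"
proof -
  let ?m = "\<lambda>i. participants b (N i)" and ?T = "\<lambda>i. b * real (N i)"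
  let ?A = "\<lambda>j i. ln (fact (j i)) / ?T i - real (j i) / ?T i * ln (?T i)"
  have T: "filterlim ?T at_top F"
    using b by (intro filterlim_tendsto_pos_mult_at_top[OF tendsto_const] filterlim_compose[OF filterlim_real_sequentially N]) auto
  have m: "((\<lambda>i. real (?m i) / real (N i)) \<longlongrightarrow> b) F"
    by (rule filterlim_compose[OF participants_over_nat_tendsto[OF b] N])
  have "((\<lambda>i. (real (?m i) / real (N i)) / b) \<longlongrightarrow> b / b) F"
    using b by (intro tendsto_intros m) auto
  then have mT: "((\<lambda>i. real (?m i) / ?T i) \<longlongrightarrow> 1) F" using b by (simp add: mult.commute)
  have "((\<lambda>i. (real (?m i) / real (N i) - real (n i) / real (N i)) / b) \<longlongrightarrow> (b - a) / b) F"
    using b by (intro tendsto_intros m n) auto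
  moreover have "\<forall>\<^sub>F i in F. (real (?m i) / real (N i) - real (n i) / real (N i)) / b = real (?m i - n i) / ?T i"
    using le by eventually_elim (simp add: of_nat_diff diff_divide_distrib mult.commute)
  ultimately have "((\<lambda>i. real (?m i - n i) / ?T i) \<longlongrightarrow> (b - a) / b) F" by (rule Lim_transform_eventually)
  then have mnT: "((\<lambda>i. real (?m i - n i) / ?T i) \<longlongrightarrow> 1 - a / b) F" using b by (simp add: diff_divide_distrib)
  have "((\<lambda>i. b * (?A ?m i - ?A (\<lambda>i. ?m i - n i) i) + b * p) \<longlongrightarrow>
      b * ((1 * ln 1 - 1) - ((1 - a / b) * ln (1 - a / b) - (1 - a / b))) + b * p) F"
    by (intro tendsto_add tendsto_mult tendsto_const tendsto_diff[OF stirling_scaled[OF T mT] stirling_scaled[OF T mnT]])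
  also have "b * ((1 * ln 1 - 1) - ((1 - a / b) * ln (1 - a / b) - (1 - a / b))) + b * p =
      b * p - a - (b - a) * ln (1 - a / b)"
    using b by (simp add: field_simps)
  finally have lim: "((\<lambda>i. b * (?A ?m i - ?A (\<lambda>i. ?m i - n i) i) + b * p) \<longlongrightarrow> b * p - a - (b - a) * ln (1 - a / b)) F" .
  have "\<forall>\<^sub>F i in F. N i \<ge> 1" using N by (simp add: filterlim_at_top)
  then have "\<forall>\<^sub>F i in F. b * (?A ?m i - ?A (\<lambda>i. ?m i - n i) i) + b * p =
      ln ((\<Prod>j<n i. real (?m i - j)) * (1 / ?T i) ^ n i * exp (b * p * real (N i))) / real (N i)"
    using le
  proof eventually_elim
    case (elim i)
    have T_pos: "?T i > 0" using b elim by simp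
    have fall: "(\<Prod>j<n i. real (?m i - j)) = fact (?m i) / fact (?m i - n i)"
      using falling_fact[OF elim(2)] by (simp add: field_simps)
    have L: "ln ((\<Prod>j<n i. real (?m i - j)) * (1 / ?T i) ^ n i * exp (b * p * real (N i))) =
        ln (fact (?m i)) - ln (fact (?m i - n i)) - real (n i) * ln (?T i) + b * p * real (N i)"
    proof -
      let ?f = "fact (?m i) / fact (?m i - n i) :: real"
      have "ln (?f * (1 / ?T i) ^ n i * exp (b * p * real (N i))) = ln (?f * (1 / ?T i) ^ n i) + b * p * real (N i)"
        using T_pos b elim by (subst ln_mult) auto
      also have "ln (?f * (1 / ?T i) ^ n i) = ln ?f + real (n i) * ln (1 / ?T i)"
        by (rule ln_mult_power) (use T_pos b elim in auto)
      also have "ln (1 / ?T i) = - ln (?T i)" using T_pos b elim by (subst ln_div) auto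
      also have "ln ?f = ln (fact (?m i)) - ln (fact (?m i - n i))" by (simp add: ln_div)
      finally show ?thesis unfolding fall by simp
    qed
    show ?case unfolding L by (rule rescale_difference) (use b elim in auto)
  qed
  with lim show ?thesis by (rule Lim_transform_eventually)
qed

text \<open>
  The filter of all pairs \<open>(N, n)\<close> with \<open>N \<rightarrow> \<infinity>\<close> and \<open>n / N \<rightarrow> a\<close>. A limit along it
  is a limit that is locally uniform in \<open>n / N\<close>.
\<close>

definition near_filter :: "real \<Rightarrow> (nat \<times> nat) filter" where
  "near_filter a = inf (filtercomap fst at_top) (filtercomap (\<lambda>(N, n). real n / real N) (nhds a))"

lemma near_filter_limits:
  "filterlim fst at_top (near_filter a)" "((\<lambda>(N, n). real n / real N) \<longlongrightarrow> a) (near_filter a)"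
  unfolding near_filter_def
  by (auto intro: filterlim_mono[OF filterlim_filtercomap order_refl])

lemma eventually_near_filter:
  assumes "\<forall>\<^sub>F (N, n) in near_filter a. P N n"
  shows "\<exists>\<delta>>0. \<forall>\<^sub>F N in sequentially. \<forall>n. \<bar>real n / real N - a\<bar> < \<delta> \<longrightarrow> P N n"
proof -
  obtain P' Q' where P': "eventually P' (filtercomap fst at_top)"
    and Q': "eventually Q' (filtercomap (\<lambda>(N::nat, n::nat). real n / real N) (nhds a))"
    and PQ: "\<forall>i. P' i \<and> Q' i \<longrightarrow> (case i of (N, n) \<Rightarrow> P N n)"
    using assms unfolding near_filter_def eventually_inf by (elim exE conjE) (rule that)
  obtain A where A: "eventually A sequentially" "\<And>i. A (fst i) \<Longrightarrow> P' i"
    using P' unfolding eventually_filtercomap by blast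
  obtain B where B: "eventually B (nhds a)" "\<And>i. B (case i of (N, n) \<Rightarrow> real n / real N) \<Longrightarrow> Q' i"
    using Q' unfolding eventually_filtercomap by blast
  have AB: "P N n" if "A N" "B (real n / real N)" for N n
    using PQ[rule_format, of "(N, n)"] A(2)[of "(N, n)"] B(2)[of "(N, n)"] that by simp
  obtain \<delta> where \<delta>: "\<delta> > 0" "\<And>y. dist y a < \<delta> \<Longrightarrow> B y" using B(1) unfolding eventually_nhds_metric by blast
  have "\<forall>\<^sub>F N in sequentially. \<forall>n. \<bar>real n / real N - a\<bar> < \<delta> \<longrightarrow> P N n"
    using A(1)
  proof (eventually_elim, intro allI impI)
    fix N n assume "A N" "\<bar>real n / real N - a\<bar> < \<delta>"
    then show "P N n" by (intro AB \<delta>(2)) (simp_all add: dist_real_def)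
  qed
  with \<delta>(1) show ?thesis by blast
qed

abbreviation global_ratio :: "real \<Rightarrow> real \<Rightarrow> nat \<Rightarrow> nat \<Rightarrow> real" where
  "global_ratio b p N n \<equiv> poisson_ratio (participants b N) p (b * p * real N) (1 / (b * real N)) n"

lemma global_ratio_eq:
  "global_ratio b p N n = ((\<Prod>j<n. real (participants b N - j)) * (1 / (b * real N)) ^ n * exp (b * p * real N)) *
     (1 - p) ^ (participants b N - n)"
  by (simp add: poisson_ratio_def mult_ac)

lemma ln_global_ratio_limit:
  fixes N n :: "'i \<Rightarrow> nat"
  assumes b: "b > 0" and a: "a \<le> b" and p: "0 < p" "p < 1" and N: "filterlim N at_top F"
    and n: "((\<lambda>i. real (n i) / real (N i)) \<longlongrightarrow> a) F"
    and le: "\<forall>\<^sub>F i in F. n i \<le> participants b (N i)"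
  shows "((\<lambda>i. ln (global_ratio b p (N i) (n i)) / real (N i)) \<longlongrightarrow>
           b * p - a - (b - a) * ln (1 - a / b) + (b - a) * ln (1 - p)) F"
proof -
  let ?m = "\<lambda>i. participants b (N i)"
  let ?c = "\<lambda>i. (\<Prod>j<n i. real (?m i - j)) * (1 / (b * real (N i))) ^ n i * exp (b * p * real (N i))"
  have m: "((\<lambda>i. real (?m i) / real (N i)) \<longlongrightarrow> b) F"
    by (rule filterlim_compose[OF participants_over_nat_tendsto[OF b] N])
  have lim: "((\<lambda>i. ln (?c i) / real (N i) + (real (?m i) / real (N i) - real (n i) / real (N i)) * ln (1 - p)) \<longlongrightarrow>
      (b * p - a - (b - a) * ln (1 - a / b)) + (b - a) * ln (1 - p)) F"
    by (intro tendsto_add tendsto_mult tendsto_diff tendsto_const m n ln_falling_limit[OF b a N n le])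
  have "\<forall>\<^sub>F i in F. N i \<ge> 1" using N by (simp add: filterlim_at_top)
  then have "\<forall>\<^sub>F i in F. ln (?c i) / real (N i) + (real (?m i) / real (N i) - real (n i) / real (N i)) * ln (1 - p) =
      ln (global_ratio b p (N i) (n i)) / real (N i)"
    using le
  proof eventually_elim
    case (elim i)
    have "(\<Prod>j<n i. real (?m i - j)) > 0" using elim(2) by (intro prod_pos) auto
    then have c: "?c i > 0" using b elim(1) by (intro mult_pos_pos zero_less_power) auto
    have "ln (global_ratio b p (N i) (n i)) = ln (?c i) + real (?m i - n i) * ln (1 - p)"
      unfolding global_ratio_eq using c p by (intro ln_mult_power) auto
    then show ?case using elim by (simp add: of_nat_diff add_divide_distrib left_diff_distrib diff_divide_distrib)
  qed
  with lim show ?thesis by (rule Lim_transform_eventually)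
qed

lemma access_cost_regular:
  assumes "b > 0" "p < 1" "a \<le> b"
  shows "access_cost b p a = ereal (a - b * p + (b - a) * ln (1 - a / b) - (b - a) * ln (1 - p))"
proof (cases "a = b")
  case False
  then have "1 - a / b > 0" using assms by simp
  then show ?thesis using False assms by (simp add: access_cost_def idle_cost_def ln_div algebra_simps)
qed (simp add: access_cost_def idle_cost_def)

text \<open>
  For \<open>a > b\<close> more attempts than participants would be needed, and for \<open>p = 1\<close> and \<open>a < b\<close> some
  participant would have to be idle; in both cases the density vanishes near \<open>a N\<close>. For
  \<open>p = 1\<close> and \<open>a = b\<close> the idle factor is bounded by 1.
\<close>

lemma global_ratio_upper:
  assumes b: "b > 0" and p: "0 < p" "p \<le> 1" and a: "a \<ge> 0" and u: "ereal u < access_cost b p a"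
  shows "\<exists>\<delta>>0. \<forall>\<^sub>F N in sequentially. \<forall>n. \<bar>real n / real N - a\<bar> < \<delta> \<longrightarrow>
           global_ratio b p N n \<le> exp (- (u * real N))"
proof (rule eventually_near_filter)
  let ?F = "near_filter a"
  note N = near_filter_limits(1)[of a] and nlim = near_filter_limits(2)[of a]
  have n: "((\<lambda>i. real (snd i) / real (fst i)) \<longlongrightarrow> a) ?F"
    using nlim by (simp add: case_prod_beta')
  have m: "((\<lambda>i. real (participants b (fst i)) / real (fst i)) \<longlongrightarrow> b) ?F"
    by (rule filterlim_compose[OF participants_over_nat_tendsto[OF b] N])
  have N1: "\<forall>\<^sub>F i in ?F. fst i \<ge> 1" using N by (simp add: filterlim_at_top)
  have "\<forall>\<^sub>F i in ?F. global_ratio b p (fst i) (snd i) \<le> exp (- (u * real (fst i)))"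
  proof (cases "a > b")
    case True
    have "\<forall>\<^sub>F i in ?F. real (snd i) / real (fst i) > b" using order_tendstoD(1)[OF n True] .
    then show ?thesis using N1
    proof eventually_elim
      case (elim i)
      then have "real (snd i) > b * real (fst i)" by (simp add: less_divide_eq)
      then have "snd i > participants b (fst i)" using participants_bounds(1)[OF b, of "fst i"] by linarith
      then show ?case by (simp add: poisson_ratio_def falling_zero)
    qed
  next
    case False
    then have ab: "a \<le> b" by simp
    show ?thesis
    proof (cases "p = 1 \<and> a < b")
      case True
      have "((\<lambda>i. real (participants b (fst i)) / real (fst i) - real (snd i) / real (fst i)) \<longlongrightarrow> b - a) ?F"
        by (intro tendsto_diff m n)
      then have "\<forall>\<^sub>F i in ?F. real (participants b (fst i)) / real (fst i) - real (snd i) / real (fst i) > 0"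
        using True by (intro order_tendstoD(1)) auto
      then show ?thesis using N1
      proof eventually_elim
        case (elim i)
        then have "snd i < participants b (fst i)" by (simp add: divide_less_cancel)
        then have "(1 - p) ^ (participants b (fst i) - snd i) = 0" using True by (simp add: zero_power)
        then show ?case by (simp only: global_ratio_eq mult_zero_right exp_ge_zero)
      qed
    next
      case reg: False
      define F' where "F' = inf ?F (principal {i. snd i \<le> participants b (fst i)})"
      have F': "F' \<le> ?F" by (simp add: F'_def)
      have N': "filterlim fst at_top F'" by (rule filterlim_mono[OF N order_refl F'])
      have n': "((\<lambda>i. real (snd i) / real (fst i)) \<longlongrightarrow> a) F'" by (rule tendsto_mono[OF F' n])
      have le: "\<forall>\<^sub>F i in F'. snd i \<le> participants b (fst i)" by (simp add: F'_def eventually_inf_principal)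
      have N1': "\<forall>\<^sub>F i in F'. fst i \<ge> 1" using N' by (simp add: filterlim_at_top)
      have "\<forall>\<^sub>F i in F'. global_ratio b p (fst i) (snd i) \<le> exp (- (u * real (fst i)))"
      proof (cases "p = 1")
        case True
        then have "a = b" using reg ab by auto
        then have "u < a - b * p" using u by (simp add: access_cost_def idle_cost_def)
        let ?c = "\<lambda>i. (\<Prod>j<snd i. real (participants b (fst i) - j)) * (1 / (b * real (fst i))) ^ snd i * exp (b * p * real (fst i))"
        have "\<forall>\<^sub>F i in F'. ln (?c i) / real (fst i) < - u"
          using ln_falling_limit[OF b ab N' n' le, of p] \<open>u < a - b * p\<close> \<open>a = b\<close>
          by (intro order_tendstoD(2)) auto
        then show ?thesis using N1' le
        proof eventually_elim
          case (elim i)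
          have "(\<Prod>j<snd i. real (participants b (fst i) - j)) > 0" using elim(3) by (intro prod_pos) auto
          then have c: "?c i > 0" using b elim(2) by (intro mult_pos_pos zero_less_power) auto
          have "global_ratio b p (fst i) (snd i) \<le> ?c i * 1"
            unfolding global_ratio_eq using c p by (intro mult_left_mono power_le_one) auto
          also have "ln (?c i) \<le> - (u * real (fst i))" using elim(1,2) by (simp add: divide_less_eq)
          then have "?c i * 1 \<le> exp (- (u * real (fst i)))"
            unfolding mult_1_right by (rule le_exp_of_ln_le[OF c])
          finally show ?case .
        qed
      next
        case False
        then have p': "0 < p" "p < 1" using p by auto
        have cost: "access_cost b p a = ereal (a - b * p + (b - a) * ln (1 - a / b) - (b - a) * ln (1 - p))"
          by (rule access_cost_regular[OF b p'(2) ab])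
        then have u': "u < a - b * p + (b - a) * ln (1 - a / b) - (b - a) * ln (1 - p)" using u by simp
        have "\<forall>\<^sub>F i in F'. ln (global_ratio b p (fst i) (snd i)) / real (fst i) < - u"
          using ln_global_ratio_limit[OF b ab p' N' n' le] u' by (intro order_tendstoD(2)) auto
        then show ?thesis using N1' le
        proof eventually_elim
          case (elim i)
          have "(\<Prod>j<snd i. real (participants b (fst i) - j)) > 0" using elim(3) by (intro prod_pos) auto
          then have c: "global_ratio b p (fst i) (snd i) > 0"
            unfolding global_ratio_eq using b elim(2) p' by (intro mult_pos_pos zero_less_power) auto
          have "ln (global_ratio b p (fst i) (snd i)) \<le> - (u * real (fst i))" using elim(1,2) by (simp add: divide_less_eq)
          then show ?case by (rule le_exp_of_ln_le[OF c])
        qed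
      qed
      then have "\<forall>\<^sub>F i in ?F. snd i \<le> participants b (fst i) \<longrightarrow> global_ratio b p (fst i) (snd i) \<le> exp (- (u * real (fst i)))"
        by (simp add: F'_def eventually_inf_principal)
      then show ?thesis
      proof eventually_elim
        case (elim i)
        then show ?case
          by (cases "snd i \<le> participants b (fst i)") (auto simp: poisson_ratio_def falling_zero)
      qed
    qed
  qed
  then show "\<forall>\<^sub>F (N, n) in ?F. global_ratio b p N n \<le> exp (- (u * real N))"
    by (simp add: case_prod_beta')
qed

text \<open>
  For \<open>p = 1\<close> finite cost forces \<open>a = b\<close>, so that \<open>\<lfloor>a N\<rfloor>\<close> is exactly the number of
  participants and the idle factor is \<open>0 ^ 0 = 1\<close>.
\<close>

lemma global_ratio_lower:
  assumes b: "b > 0" and p: "0 < p" "p \<le> 1" and a: "a \<ge> 0" and cost: "access_cost b p a = ereal \<gamma>" and \<epsilon>: "\<epsilon> > 0"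
  shows "\<forall>\<^sub>F N in sequentially. global_ratio b p N (nat \<lfloor>a * real N\<rfloor>) \<ge> exp (- ((\<gamma> + \<epsilon>) * real N))"
proof -
  let ?n = "\<lambda>N. nat \<lfloor>a * real N\<rfloor>"
  have ab: "a \<le> b" using cost by (auto simp: access_cost_def split: if_splits)
  have reg: "p < 1 \<or> a = b" using cost p ab by (auto simp: access_cost_def idle_cost_def split: if_splits)
  have N: "filterlim (\<lambda>N. N) at_top sequentially" by (rule filterlim_ident)
  have n: "(\<lambda>N. real (?n N) / real N) \<longlonglongrightarrow> a"
    using floor_mult_over_nat_tendsto[of a] a by simp
  have le0: "?n N \<le> participants b N" for N
    unfolding participants_def using ab by (intro nat_mono floor_mono mult_right_mono) auto
  then have le: "\<forall>\<^sub>F N in sequentially. ?n N \<le> participants b N" by simp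
  let ?c = "\<lambda>N. (\<Prod>j<?n N. real (participants b N - j)) * (1 / (b * real N)) ^ ?n N * exp (b * p * real N)"
  have c_pos: "?c N > 0" if "N \<ge> 1" for N
  proof -
    have "(\<Prod>j<?n N. real (participants b N - j)) > 0" using le0[of N] by (intro prod_pos) auto
    then show ?thesis using b that by (intro mult_pos_pos zero_less_power) auto
  qed
  have "\<forall>\<^sub>F N in sequentially. ln (global_ratio b p N (?n N)) / real N > - (\<gamma> + \<epsilon>)"
  proof (cases "p < 1")
    case True
    have "access_cost b p a = ereal (a - b * p + (b - a) * ln (1 - a / b) - (b - a) * ln (1 - p))"
      by (rule access_cost_regular[OF b True ab])
    then have "\<gamma> = a - b * p + (b - a) * ln (1 - a / b) - (b - a) * ln (1 - p)" using cost by simp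
    then show ?thesis
      using ln_global_ratio_limit[OF b ab p(1) True N n le] \<epsilon> by (intro order_tendstoD(1)) auto
  next
    case False
    then have p1: "p = 1" and "a = b" using reg p by auto
    then have "\<gamma> = a - b * p" using cost by (simp add: access_cost_def idle_cost_def)
    then have "\<forall>\<^sub>F N in sequentially. ln (?c N) / real N > - (\<gamma> + \<epsilon>)"
      using ln_falling_limit[OF b ab N n le, of p] \<epsilon> \<open>a = b\<close> by (intro order_tendstoD(1)) auto
    moreover have "global_ratio b p N (?n N) = ?c N" for N
      unfolding global_ratio_eq \<open>a = b\<close> by (simp add: participants_def)
    ultimately show ?thesis by simp
  qed
  then show ?thesis using eventually_ge_at_top[of 1]
  proof eventually_elim
    case (elim N)
    have pos: "global_ratio b p N (?n N) > 0"
    proof (cases "p < 1")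
      case True
      then show ?thesis unfolding global_ratio_eq using c_pos[OF elim(2)] by simp
    next
      case False
      then have "p = 1" "a = b" using reg p by auto
      then show ?thesis unfolding global_ratio_eq using c_pos[OF elim(2)] by (simp add: participants_def)
    qed
    have "ln (global_ratio b p N (?n N)) > - (\<gamma> + \<epsilon>) * real N"
      using elim pos_less_divide_eq[of "real N" "- (\<gamma> + \<epsilon>)" "ln (global_ratio b p N (?n N))"] by linarith
    then have "ln (global_ratio b p N (?n N)) \<ge> - ((\<gamma> + \<epsilon>) * real N)" unfolding mult_minus_left by (rule less_imp_le)
    then show ?case by (rule exp_le_of_le_ln[OF pos])
  qed
qed

section \<open>Global access\<close>

lemma pmf_occ_Global:
  assumes "b > 0" "0 < p" "p \<le> 1" "\<kappa> \<ge> 1" "N \<ge> 1"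
  shows "pmf (map_pmf occ (MC_pmf Global b p \<kappa> N)) x =
    global_ratio b p N (\<Sum>t\<in>{..<N} \<times> {..<\<kappa>}. x t) *
    pmf (Pi_pmf ({..<N} \<times> {..<\<kappa>}) 0 (\<lambda>_. poisson_pmf (b * p / real \<kappa>))) x"
proof -
  let ?B = "{..<N} \<times> {..<\<kappa>}" and ?l = "b * p / real \<kappa>"
  let ?\<mu> = "pair_pmf (pmf_of_set {..<N}) (pmf_of_set {..<\<kappa>})"
  have ne: "{..<N} \<noteq> {}" "{..<\<kappa>} \<noteq> {}" using assms by (auto simp: lessThan_empty_iff)
  have "pmf (map_pmf occ (MC_pmf Global b p \<kappa> N)) x =
      poisson_ratio (card {..<participants b N}) p (?l * real (card ?B)) (p / (real (card ?B) * ?l)) (\<Sum>t\<in>?B. x t) *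
      pmf (Pi_pmf ?B 0 (\<lambda>_. poisson_pmf ?l)) x"
    unfolding occ_Global[OF assms(5,4)]
  proof (rule pmf_counts)
    show "?B \<noteq> {}" using ne by blast
    show "set_pmf ?\<mu> \<subseteq> ?B" using ne by simp
    show "pmf ?\<mu> t = 1 / real (card ?B)" if "t \<in> ?B" for t
      using that ne by (cases t) (simp add: pmf_pair)
  qed (use assms in auto)
  also have "?l * real (card ?B) = b * p * real N" using assms by simp
  also have "p / (real (card ?B) * ?l) = 1 / (b * real N)" using assms by (simp add: field_simps)
  finally show ?thesis by simp
qed

lemma global_ratio_le:
  assumes "b > 0" "0 < p" "p \<le> 1" "N \<ge> 1"
  shows "global_ratio b p N n \<le> exp (b * p * (real N + real n))"
proof -
  have "global_ratio b p N n = ((\<Prod>j<n. real (participants b N - j)) * (1 / (b * real N)) ^ n) *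
      ((1 - p) ^ (participants b N - n) * exp (b * p * real N))"
    by (simp add: poisson_ratio_def)
  also have "\<dots> \<le> 1 * (1 * exp (b * p * (real N + real n)))"
    using assms by (intro mult_mono falling_le power_le_one mult_nonneg_nonneg falling_nonneg) (auto simp: distrib_left)
  finally show ?thesis by simp
qed

lemma ldp_Global:
  assumes b: "b > 0" and p: "0 < p" "p \<le> 1" and \<kappa>: "\<kappa> \<ge> 1"
  shows "closedin (top_of_set ({0..} \<times> {0..})) F \<Longrightarrow>
      limsup (\<lambda>N. elog (measure_pmf.prob (MC_pmf Global b p \<kappa> N) {\<omega>. empirical_pair N \<omega> \<in> F}) / ereal (real N))
        \<le> - (INF x\<in>F. rate_G b p \<kappa> x)"
    and "openin (top_of_set ({0..} \<times> {0..})) G \<Longrightarrow>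
      liminf (\<lambda>N. elog (measure_pmf.prob (MC_pmf Global b p \<kappa> N) {\<omega>. empirical_pair N \<omega> \<in> G}) / ereal (real N))
        \<ge> - (INF x\<in>G. rate_G b p \<kappa> x)"
proof -
  let ?l = "b * p / real \<kappa>" and ?I = "\<lambda>N. {..<N} \<times> {..<\<kappa>}"
  have l: "?l > 0" using b p \<kappa> by simp
  let ?W = "\<lambda>N. map_pmf occ (MC_pmf Global b p \<kappa> N)"
  let ?Q = "\<lambda>N. Pi_pmf (?I N) 0 (\<lambda>_. poisson_pmf ?l)"
  have N1: "\<forall>\<^sub>F N in sequentially. N \<ge> (1::nat)" by (rule eventually_ge_at_top)
  interpret comparable_laws "poisson_pmf ?l" "\<lambda>g. g" "\<lambda>g. of_bool (g = 1)" "\<lambda>n. n" \<kappa> ?I 0 ?W "access_cost b p" "b * p"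
  proof (intro comparable_laws.intro letters_poisson[OF l] comparable_laws_axioms.intro \<kappa>)
    show "finite (?I N)" "card (?I N) = \<kappa> * N" for N by auto
    show "access_cost b p a \<noteq> -\<infinity>" for a unfolding access_cost_def idle_cost_def by auto
    show "\<exists>\<delta>>0. \<forall>\<^sub>F N in sequentially. \<forall>w. \<bar>real (\<Sum>t\<in>?I N. w t) / real N - a\<bar> < \<delta> \<longrightarrow>
        pmf (?W N) w \<le> exp (- (u * real N)) * pmf (?Q N) w"
      if au: "a \<ge> 0" "ereal u < access_cost b p a" for a u
    proof -
      obtain \<delta> where \<delta>: "\<delta> > 0" "\<forall>\<^sub>F N in sequentially. \<forall>n. \<bar>real n / real N - a\<bar> < \<delta> \<longrightarrow>
           global_ratio b p N n \<le> exp (- (u * real N))"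
        using global_ratio_upper[OF b p au] by blast
      have "\<forall>\<^sub>F N in sequentially. \<forall>w. \<bar>real (\<Sum>t\<in>?I N. w t) / real N - a\<bar> < \<delta> \<longrightarrow>
        pmf (?W N) w \<le> exp (- (u * real N)) * pmf (?Q N) w"
        using \<delta>(2) N1
      proof (eventually_elim, intro allI impI)
        fix N :: nat and w :: "nat \<times> nat \<Rightarrow> nat"
        assume h: "\<forall>n. \<bar>real n / real N - a\<bar> < \<delta> \<longrightarrow> global_ratio b p N n \<le> exp (- (u * real N))"
          and N: "1 \<le> N" and w: "\<bar>real (\<Sum>t\<in>?I N. w t) / real N - a\<bar> < \<delta>"
        show "pmf (?W N) w \<le> exp (- (u * real N)) * pmf (?Q N) w"
          unfolding pmf_occ_Global[OF b p \<kappa> N] by (intro mult_right_mono h[rule_format] w) simp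
      qed
      with \<delta>(1) show ?thesis by blast
    qed
    show "\<forall>\<^sub>F N in sequentially. \<forall>w. pmf (?W N) w \<le>
        exp (b * p * (real N + real (\<Sum>t\<in>?I N. w t))) * pmf (?Q N) w"
      using N1
    proof (eventually_elim, intro allI)
      fix N :: nat and w :: "nat \<times> nat \<Rightarrow> nat" assume N: "1 \<le> N"
      show "pmf (?W N) w \<le> exp (b * p * (real N + real (\<Sum>t\<in>?I N. w t))) * pmf (?Q N) w"
        unfolding pmf_occ_Global[OF b p \<kappa> N] by (intro mult_right_mono global_ratio_le b p N) simp
    qed
    show "\<forall>\<^sub>F N in sequentially. \<forall>w. (\<forall>t\<in>?I N. w t \<in> \<Gamma>) \<longrightarrow> (\<Sum>t\<in>?I N. w t) = nat \<lfloor>a * real N\<rfloor> \<longrightarrow>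
          pmf (?Q N) w \<le> exp ((\<gamma> + \<epsilon>) * real N) * pmf (?W N) w"
      if "a \<ge> 0" "access_cost b p a = ereal \<gamma>" "\<epsilon> > 0" for a \<gamma> \<epsilon> and \<Gamma> :: "nat set"
      using global_ratio_lower[OF b p that] N1
    proof (eventually_elim, intro allI impI)
      fix N :: nat and w :: "nat \<times> nat \<Rightarrow> nat"
      assume r: "exp (- ((\<gamma> + \<epsilon>) * real N)) \<le> global_ratio b p N (nat \<lfloor>a * real N\<rfloor>)"
        and N: "1 \<le> N" and w: "(\<Sum>t\<in>?I N. w t) = nat \<lfloor>a * real N\<rfloor>"
      have "1 = exp ((\<gamma> + \<epsilon>) * real N) * exp (- ((\<gamma> + \<epsilon>) * real N))" by (simp only: exp_minus) simp
      also have "\<dots> \<le> exp ((\<gamma> + \<epsilon>) * real N) * global_ratio b p N (nat \<lfloor>a * real N\<rfloor>)"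
        by (intro mult_left_mono r) simp
      finally have "1 * pmf (?Q N) w \<le> exp ((\<gamma> + \<epsilon>) * real N) * global_ratio b p N (nat \<lfloor>a * real N\<rfloor>) * pmf (?Q N) w"
        by (intro mult_right_mono) simp_all
      then show "pmf (?Q N) w \<le> exp ((\<gamma> + \<epsilon>) * real N) * pmf (?W N) w"
        unfolding pmf_occ_Global[OF b p \<kappa> N] w by (simp only: mult_1_left mult.assoc)
    qed
  qed
  have ev: "\<forall>\<^sub>F N in sequentially. elog (measure_pmf.prob (MC_pmf Global b p \<kappa> N) {\<omega>. empirical_pair N \<omega> \<in> A}) / ereal (real N) =
      elog (measure_pmf.prob (?W N) (event A N)) / ereal (real N)" for A
    using N1 by eventually_elim (simp only: prob_MC_eq_occ[OF _ \<kappa>])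
  show "closedin (top_of_set ({0..} \<times> {0..})) F \<Longrightarrow> limsup (\<lambda>N. elog (measure_pmf.prob (MC_pmf Global b p \<kappa> N)
      {\<omega>. empirical_pair N \<omega> \<in> F}) / ereal (real N)) \<le> - (INF x\<in>F. rate_G b p \<kappa> x)"
    unfolding Limsup_eq[OF ev] rate_G_eq[OF b p(1) \<kappa>] by (rule ldp_upper_bound)
  show "openin (top_of_set ({0..} \<times> {0..})) G \<Longrightarrow> liminf (\<lambda>N. elog (measure_pmf.prob (MC_pmf Global b p \<kappa> N)
      {\<omega>. empirical_pair N \<omega> \<in> G}) / ereal (real N)) \<ge> - (INF x\<in>G. rate_G b p \<kappa> x)"
    unfolding Liminf_eq[OF ev] rate_G_eq[OF b p(1) \<kappa>] by (rule ldp_lower_bound)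
qed

section \<open>Local access\<close>

text \<open>
  The joint law of the numbers of attempts and successes in one slot under local access; it converges
  to \<open>M\<close>.
\<close>

definition slot_pmf :: "real \<Rightarrow> real \<Rightarrow> nat \<Rightarrow> nat \<Rightarrow> (nat \<times> nat) pmf" where
  "slot_pmf b p \<kappa> N = map_pmf (\<lambda>x. (\<Sum>k<\<kappa>. x k, \<Sum>k<\<kappa>. of_bool (x k = 1)))
     (map_pmf (counts {..<participants b N}) (Pi_pmf {..<participants b N} None
       (\<lambda>_. choice_pmf (p / real N) (pmf_of_set {..<\<kappa>}))))"

abbreviation local_ratio :: "real \<Rightarrow> real \<Rightarrow> nat \<Rightarrow> nat \<Rightarrow> real" where
  "local_ratio b p N i \<equiv> poisson_ratio (participants b N) (p / real N) (b * p) (1 / (b * real N)) i"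

lemma pmf_slot:
  assumes "b > 0" "0 < p" "\<kappa> \<ge> 1" "N \<ge> 1" "p \<le> real N"
  shows "pmf (slot_pmf b p \<kappa> N) g = local_ratio b p N (fst g) * pmf (M_pmf b p \<kappa>) g"
proof -
  let ?f = "\<lambda>x::nat \<Rightarrow> nat. (\<Sum>k<\<kappa>. x k, \<Sum>k<\<kappa>. of_bool (x k = 1) :: nat)"
  let ?l = "b * p / real \<kappa>" and ?B = "{..<\<kappa>}"
  let ?P = "map_pmf (counts {..<participants b N}) (Pi_pmf {..<participants b N} None
       (\<lambda>_. choice_pmf (p / real N) (pmf_of_set ?B)))"
  have ne: "?B \<noteq> {}" using assms by (auto simp: lessThan_empty_iff)
  have pmf: "pmf ?P x = local_ratio b p N (\<Sum>k\<in>?B. x k) * pmf (Pi_pmf ?B 0 (\<lambda>_. poisson_pmf ?l)) x" for x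
  proof -
    have "pmf ?P x = poisson_ratio (card {..<participants b N}) (p / real N) (?l * real (card ?B))
        ((p / real N) / (real (card ?B) * ?l)) (\<Sum>k\<in>?B. x k) * pmf (Pi_pmf ?B 0 (\<lambda>_. poisson_pmf ?l)) x"
      by (rule pmf_counts) (use assms ne in auto)
    also have "?l * real (card ?B) = b * p" using assms by simp
    also have "(p / real N) / (real (card ?B) * ?l) = 1 / (b * real N)" using assms by (simp add: field_simps)
    finally show ?thesis by simp
  qed
  have "pmf (slot_pmf b p \<kappa> N) g = measure_pmf.prob ?P (?f -` {g})"
    unfolding slot_pmf_def by (rule pmf_map)
  also have "\<dots> = local_ratio b p N (fst g) * measure_pmf.prob (Pi_pmf ?B 0 (\<lambda>_. poisson_pmf ?l)) (?f -` {g})"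
    by (rule prob_scale) (auto simp: pmf)
  also have "measure_pmf.prob (Pi_pmf ?B 0 (\<lambda>_. poisson_pmf ?l)) (?f -` {g}) = pmf (M_pmf b p \<kappa>) g"
    unfolding M_pmf_def by (rule pmf_map[symmetric])
  finally show ?thesis .
qed

text \<open>
  Under local access different slots use disjoint sets of independent decisions.
\<close>

lemma prob_MC_Local:
  assumes "\<kappa> \<ge> 1" "N \<ge> 1"
  shows "measure_pmf.prob (MC_pmf Local b p \<kappa> N) {\<omega>. empirical_pair N \<omega> \<in> A} =
    measure_pmf.prob (Pi_pmf {..<N} (0, 0) (\<lambda>_. slot_pmf b p \<kappa> N))
      {w. (real (\<Sum>t<N. fst (w t)) / real N, real (\<Sum>t<N. snd (w t)) / real N) \<in> A}"
proof -
  let ?m = "participants b N" and ?ch = "choice_pmf (p / real N) (pmf_of_set {..<\<kappa>})"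
  let ?f = "\<lambda>x::nat \<Rightarrow> nat. (\<Sum>k<\<kappa>. x k, \<Sum>k<\<kappa>. of_bool (x k = 1) :: nat)"
  let ?h = "?f \<circ> counts {..<?m}"
  have "Pi_pmf {..<N} (0, 0) (\<lambda>_. slot_pmf b p \<kappa> N) =
      Pi_pmf {..<N} (0, 0) (\<lambda>_. map_pmf ?h (Pi_pmf {..<?m} None (\<lambda>_. ?ch)))"
    by (simp add: slot_pmf_def map_pmf_comp o_def)
  also have "\<dots> = map_pmf (\<lambda>H. ?h \<circ> H) (Pi_pmf {..<N} (\<lambda>_. None) (\<lambda>_. Pi_pmf {..<?m} None (\<lambda>_. ?ch)))"
    by (rule Pi_pmf_map) (simp_all add: counts_def)
  also have "\<dots> = map_pmf (\<lambda>F t. ?h (\<lambda>i. F (i, t))) (Pi_pmf ({..<?m} \<times> {..<N}) None (\<lambda>_. ?ch))"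
    by (simp add: Pi_pmf_flip map_pmf_comp o_def)
  finally have W: "Pi_pmf {..<N} (0, 0) (\<lambda>_. slot_pmf b p \<kappa> N) =
      map_pmf (\<lambda>F t. ?h (\<lambda>i. F (i, t))) (Pi_pmf ({..<?m} \<times> {..<N}) None (\<lambda>_. ?ch))" .
  have sums: "(\<Sum>c\<in>{..<N} \<times> {..<\<kappa>}. \<phi> ((\<lambda>(t, k). card {i\<in>{..<?m}. F (i, t) = Some k}) c)) =
      (\<Sum>t<N. \<Sum>k<\<kappa>. \<phi> (counts {..<?m} (\<lambda>i. F (i, t)) k))" for F and \<phi> :: "nat \<Rightarrow> nat"
    unfolding sum.cartesian_product by (intro sum.cong refl) (auto simp: counts_def)
  show ?thesis
    unfolding prob_MC_eq_occ[OF assms(2,1)] occ_Local[OF assms(2,1)] W measure_map_pmf vimage_def mem_Collect_eq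
      sums[where \<phi> = "\<lambda>x. x"] sums[where \<phi> = "\<lambda>x. of_bool (x = 1)"] o_def fst_conv snd_conv ..
qed

text \<open>
  The falling factorial is at most \<open>(b N) ^ i\<close>, and \<open>(1 - p / N) ^ (m - i)\<close> is at most
  \<open>exp (- p (m - i) / N)\<close> with \<open>m \<ge> b N - 1\<close>. The exponent is small enough to stay bounded when
  it is summed over all \<open>N\<close> slots.
\<close>

lemma local_ratio_le:
  assumes b: "b > 0" and p: "0 < p" "p \<le> real N" and N: "N \<ge> 1"
  shows "local_ratio b p N i \<le> exp (p / real N + p * real i / real N)"
proof (cases "i \<le> participants b N")
  case True
  have q: "1 - p / real N \<ge> 0" using p N by simp
  have "(1 - p / real N) ^ (participants b N - i) \<le> exp (- (p / real N)) ^ (participants b N - i)"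
    using exp_ge_add_one_self[of "- (p / real N)"] by (intro power_mono q) simp
  also have "\<dots> = exp (- (p * (real (participants b N) - real i) / real N))"
    using True by (simp add: of_nat_diff mult_ac flip: exp_of_nat_mult)
  finally have pow: "(1 - p / real N) ^ (participants b N - i) \<le> exp (- (p * (real (participants b N) - real i) / real N))" .
  have "local_ratio b p N i = ((\<Prod>j<i. real (participants b N - j)) * (1 / (b * real N)) ^ i) *
      ((1 - p / real N) ^ (participants b N - i) * exp (b * p))"
    by (simp add: poisson_ratio_def)
  also have "\<dots> \<le> 1 * (exp (- (p * (real (participants b N) - real i) / real N)) * exp (b * p))"
    using b q by (intro mult_mono pow falling_le[OF b N] mult_nonneg_nonneg falling_nonneg) auto
  also have "\<dots> = exp (b * p - p * (real (participants b N) - real i) / real N)"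
    by (simp flip: exp_add)
  also have "\<dots> \<le> exp (p / real N + p * real i / real N)"
  proof -
    have "p * (b * real N - 1) \<le> p * real (participants b N)"
      using participants_bounds(2)[OF b, of N] p by (intro mult_left_mono) auto
    then have "p * (b * real N - 1) / real N \<le> p * real (participants b N) / real N"
      using N by (intro divide_right_mono) auto
    moreover have "p * (b * real N - 1) / real N = b * p - p / real N" using N by (simp add: field_simps)
    ultimately show ?thesis by (simp add: right_diff_distrib diff_divide_distrib)
  qed
  finally show ?thesis .
qed (simp add: poisson_ratio_def falling_zero)

lemma local_ratio_limit:
  assumes b: "b > 0" and p: "0 < p"
  shows "(\<lambda>N. local_ratio b p N i) \<longlonglongrightarrow> 1"
proof -
  let ?m = "participants b"
  have m: "(\<lambda>N. real (?m N) / real N) \<longlonglongrightarrow> b" by (rule participants_over_nat_tendsto[OF b])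
  have m_minus: "(\<lambda>N. real (?m N - j) / real N) \<longlonglongrightarrow> b" for j
  proof (rule Lim_transform_eventually)
    have "(\<lambda>N. real (?m N) / real N - real j * (1 / real N)) \<longlonglongrightarrow> b - real j * 0"
      by (intro tendsto_intros m lim_1_over_n)
    then show "(\<lambda>N. real (?m N) / real N - real j * (1 / real N)) \<longlonglongrightarrow> b" by simp
    have "\<forall>\<^sub>F N in sequentially. real j / b + 1 / b < real N"
      using filterlim_real_sequentially by (simp add: filterlim_at_top_dense)
    then show "\<forall>\<^sub>F N in sequentially. real (?m N) / real N - real j * (1 / real N) = real (?m N - j) / real N"
    proof eventually_elim
      case (elim N)
      then have "real j \<le> b * real N - 1" using b by (simp add: field_simps)
      then have "j \<le> ?m N" using participants_bounds(2)[OF b, of N] by linarith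
      then show ?case by (simp add: of_nat_diff diff_divide_distrib)
    qed
  qed
  have fall: "(\<lambda>N. (\<Prod>j<i. real (?m N - j)) * (1 / (b * real N)) ^ i) \<longlonglongrightarrow> 1"
  proof -
    have "(\<lambda>N. \<Prod>j<i. real (?m N - j) / real N * (1 / b)) \<longlonglongrightarrow> (\<Prod>j<i. b * (1 / b))"
      by (intro tendsto_intros m_minus)
    moreover have "(\<Prod>j<i. real (?m N - j) / real N * (1 / b)) = (\<Prod>j<i. real (?m N - j)) * (1 / (b * real N)) ^ i" for N
    proof -
      have "(\<Prod>j<i. real (?m N - j) / real N * (1 / b)) = (\<Prod>j<i. real (?m N - j) * (1 / (b * real N)))"
        by (intro prod.cong refl) simp
      then show ?thesis by (simp only: prod.distrib prod_constant card_lessThan)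
    qed
    ultimately show ?thesis using b by simp
  qed
  have pow: "(\<lambda>N. (1 - p / real N) ^ (?m N - i) * exp (b * p)) \<longlonglongrightarrow> 1"
  proof (rule Lim_transform_eventually)
    have "(\<lambda>N. exp ((real (?m N - i) / real N) * (real N * ln (1 - p / real N)) + b * p)) \<longlonglongrightarrow> exp (b * (- p) + b * p)"
    proof (intro tendsto_intros m_minus)
      show "(\<lambda>N. real N * ln (1 - p / real N)) \<longlonglongrightarrow> - p" by real_asymp
    qed
    then show "(\<lambda>N. exp ((real (?m N - i) / real N) * (real N * ln (1 - p / real N)) + b * p)) \<longlonglongrightarrow> 1" by simp
    have "\<forall>\<^sub>F N in sequentially. p < real N"
      using filterlim_real_sequentially by (simp add: filterlim_at_top_dense)
    then show "\<forall>\<^sub>F N in sequentially. exp ((real (?m N - i) / real N) * (real N * ln (1 - p / real N)) + b * p) =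
        (1 - p / real N) ^ (?m N - i) * exp (b * p)"
    proof eventually_elim
      case (elim N)
      then have "1 - p / real N > 0" "real N > 0" using p by auto
      moreover from this have "exp (real (?m N - i) * ln (1 - p / real N)) = (1 - p / real N) ^ (?m N - i)"
        by (simp only: exp_of_nat_mult exp_ln)
      ultimately show ?case by (simp add: exp_add)
    qed
  qed
  have "(\<lambda>N. ((\<Prod>j<i. real (?m N - j)) * (1 / (b * real N)) ^ i) * ((1 - p / real N) ^ (?m N - i) * exp (b * p))) \<longlonglongrightarrow> 1 * 1"
    by (intro tendsto_mult fall pow)
  then show ?thesis by (simp add: poisson_ratio_def mult_ac)
qed

lemma ldp_Local:
  assumes b: "b > 0" and p: "0 < p" and \<kappa>: "\<kappa> \<ge> 1"
  shows "closedin (top_of_set ({0..} \<times> {0..})) F \<Longrightarrow>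
      limsup (\<lambda>N. elog (measure_pmf.prob (MC_pmf Local b p \<kappa> N) {\<omega>. empirical_pair N \<omega> \<in> F}) / ereal (real N))
        \<le> - (INF x\<in>F. rate_L b p \<kappa> x)"
    and "openin (top_of_set ({0..} \<times> {0..})) G \<Longrightarrow>
      liminf (\<lambda>N. elog (measure_pmf.prob (MC_pmf Local b p \<kappa> N) {\<omega>. empirical_pair N \<omega> \<in> G}) / ereal (real N))
        \<ge> - (INF x\<in>G. rate_L b p \<kappa> x)"
proof -
  let ?I = "\<lambda>N::nat. {..<N}"
  let ?W = "\<lambda>N. Pi_pmf (?I N) (0, 0) (\<lambda>_. slot_pmf b p \<kappa> N)"
  let ?Q = "\<lambda>N. Pi_pmf (?I N) (0, 0) (\<lambda>_. M_pmf b p \<kappa>)"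
  have large: "\<forall>\<^sub>F N in sequentially. N \<ge> 1 \<and> p \<le> real N"
    using filterlim_real_sequentially by (intro eventually_conj eventually_ge_at_top) (simp add: filterlim_at_top)
  have W: "pmf (?W N) w = (\<Prod>t\<in>?I N. local_ratio b p N (fst (w t))) * pmf (?Q N) w"
    if "N \<ge> 1 \<and> p \<le> real N" for N w
    using that pmf_slot[OF b p \<kappa>, of N] by (auto simp: pmf_Pi prod.distrib)
  have ratio_nonneg: "local_ratio b p N i \<ge> 0" if "N \<ge> 1 \<and> p \<le> real N" for N i
    unfolding poisson_ratio_def using that b by (intro mult_nonneg_nonneg falling_nonneg zero_le_power) auto
  have ratio_le: "(\<Prod>t\<in>?I N. local_ratio b p N (fst (w t))) \<le> exp (p + p * (real (\<Sum>t\<in>?I N. fst (w t)) / real N))"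
    if N: "N \<ge> 1 \<and> p \<le> real N" for N and w :: "nat \<Rightarrow> nat \<times> nat"
  proof -
    have "(\<Prod>t\<in>?I N. local_ratio b p N (fst (w t))) \<le> (\<Prod>t\<in>?I N. exp (p / real N + p * real (fst (w t)) / real N))"
      using N by (intro prod_mono conjI ratio_nonneg local_ratio_le b p) auto
    also have "\<dots> = exp (\<Sum>t\<in>?I N. p / real N + p * real (fst (w t)) / real N)" by (simp add: exp_sum)
    also have "(\<Sum>t\<in>?I N. p / real N + p * real (fst (w t)) / real N) = p + p * (real (\<Sum>t\<in>?I N. fst (w t)) / real N)"
      using N by (simp add: sum.distrib sum_distrib_left sum_divide_distrib)
    finally show ?thesis .
  qed
  interpret comparable_laws "M_pmf b p \<kappa>" fst snd "\<lambda>n. (n, of_bool (n = 1))" 1 ?I "(0, 0)" ?W "\<lambda>_. 0" p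
  proof (intro comparable_laws.intro letters_M_pmf b p \<kappa> comparable_laws_axioms.intro)
    show "finite (?I N)" "card (?I N) = 1 * N" for N by auto
    show "\<exists>\<delta>>0. \<forall>\<^sub>F N in sequentially. \<forall>w. \<bar>real (\<Sum>t\<in>?I N. fst (w t)) / real N - a\<bar> < \<delta> \<longrightarrow>
        pmf (?W N) w \<le> exp (- (u * real N)) * pmf (?Q N) w"
      if "a \<ge> 0" "ereal u < 0" for a u
    proof -
      have "u < 0" using that(2) by simp
      then have "filterlim (\<lambda>N. (- u) * real N) at_top sequentially"
        by (intro filterlim_tendsto_pos_mult_at_top[OF tendsto_const] filterlim_real_sequentially) auto
      then have "\<forall>\<^sub>F N in sequentially. p + p * (a + 1) \<le> (- u) * real N" by (simp add: filterlim_at_top)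
      then have "\<forall>\<^sub>F N in sequentially. \<forall>w. \<bar>real (\<Sum>t\<in>?I N. fst (w t)) / real N - a\<bar> < 1 \<longrightarrow>
        pmf (?W N) w \<le> exp (- (u * real N)) * pmf (?Q N) w"
        using large
      proof (eventually_elim, intro allI impI)
        fix N :: nat and w :: "nat \<Rightarrow> nat \<times> nat"
        assume u: "p + p * (a + 1) \<le> (- u) * real N" and N: "N \<ge> 1 \<and> p \<le> real N"
          and w: "\<bar>real (\<Sum>t\<in>?I N. fst (w t)) / real N - a\<bar> < 1"
        have "p * (real (\<Sum>t\<in>?I N. fst (w t)) / real N) \<le> p * (a + 1)"
          by (intro mult_left_mono) (use w p in linarith)+
        then have "exp (p + p * (real (\<Sum>t\<in>?I N. fst (w t)) / real N)) \<le> exp (- (u * real N))"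
          using u by simp
        then have "(\<Prod>t\<in>?I N. local_ratio b p N (fst (w t))) \<le> exp (- (u * real N))"
          using ratio_le[OF N, of w] by (rule order_trans[rotated])
        then show "pmf (?W N) w \<le> exp (- (u * real N)) * pmf (?Q N) w"
          unfolding W[OF N] by (intro mult_right_mono) simp_all
      qed
      then show ?thesis by (intro exI[of _ 1]) simp
    qed
    show "\<forall>\<^sub>F N in sequentially. \<forall>w. pmf (?W N) w \<le>
        exp (p * (real N + real (\<Sum>t\<in>?I N. fst (w t)))) * pmf (?Q N) w"
      using large
    proof (eventually_elim, intro allI)
      fix N :: nat and w :: "nat \<Rightarrow> nat \<times> nat" assume N: "N \<ge> 1 \<and> p \<le> real N"
      let ?S = "real (\<Sum>t\<in>?I N. fst (w t))"
      have "?S * 1 \<le> ?S * real N" using N by (intro mult_left_mono) (simp_all only: of_nat_0_le_iff, simp)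
      then have "?S / real N \<le> ?S" using N by (simp add: divide_le_eq del: of_nat_sum)
      moreover have "1 \<le> real N" using N by simp
      ultimately have "p * (1 + ?S / real N) \<le> p * (real N + ?S)" using p by (intro mult_left_mono) linarith+
      then have "exp (p + p * (?S / real N)) \<le> exp (p * (real N + ?S))" by (simp add: distrib_left)
      then have "(\<Prod>t\<in>?I N. local_ratio b p N (fst (w t))) \<le> exp (p * (real N + ?S))"
        using ratio_le[OF N, of w] by (rule order_trans[rotated])
      then show "pmf (?W N) w \<le> exp (p * (real N + ?S)) * pmf (?Q N) w"
        unfolding W[OF N] by (intro mult_right_mono) simp_all
    qed
    show "\<forall>\<^sub>F N in sequentially. \<forall>w. (\<forall>t\<in>?I N. w t \<in> \<Gamma>) \<longrightarrow> (\<Sum>t\<in>?I N. fst (w t)) = nat \<lfloor>a * real N\<rfloor> \<longrightarrow>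
          pmf (?Q N) w \<le> exp ((\<gamma> + \<epsilon>) * real N) * pmf (?W N) w"
      if "(0::ereal) = ereal \<gamma>" "\<epsilon> > 0" "finite \<Gamma>" for a \<gamma> \<epsilon> and \<Gamma> :: "(nat \<times> nat) set"
    proof -
      have \<gamma>: "\<gamma> = 0" using that(1) by simp
      have "\<forall>\<^sub>F N in sequentially. local_ratio b p N (fst g) > exp (- \<epsilon>)" for g :: "nat \<times> nat"
        using \<open>\<epsilon> > 0\<close> by (intro order_tendstoD(1)[OF local_ratio_limit[OF b p]]) simp
      then have "\<forall>\<^sub>F N in sequentially. \<forall>g\<in>\<Gamma>. local_ratio b p N (fst g) > exp (- \<epsilon>)"
        using \<open>finite \<Gamma>\<close> by (intro eventually_ball_finite) auto
      then show ?thesis using large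
      proof (eventually_elim, intro allI impI)
        fix N :: nat and w :: "nat \<Rightarrow> nat \<times> nat"
        assume r: "\<forall>g\<in>\<Gamma>. local_ratio b p N (fst g) > exp (- \<epsilon>)" and N: "N \<ge> 1 \<and> p \<le> real N"
          and w: "\<forall>t\<in>?I N. w t \<in> \<Gamma>"
        have "exp (- \<epsilon>) ^ N = (\<Prod>t\<in>?I N. exp (- \<epsilon>))" by simp
        also have "\<dots> \<le> (\<Prod>t\<in>?I N. local_ratio b p N (fst (w t)))"
          using r w by (intro prod_mono) (auto intro: less_imp_le)
        finally have "exp (- (\<epsilon> * real N)) \<le> (\<Prod>t\<in>?I N. local_ratio b p N (fst (w t)))"
          by (simp add: mult.commute flip: exp_of_nat_mult)
        then have "exp (\<epsilon> * real N) * exp (- (\<epsilon> * real N)) \<le> exp (\<epsilon> * real N) * (\<Prod>t\<in>?I N. local_ratio b p N (fst (w t)))"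
          by (intro mult_left_mono) simp_all
        also have "exp (\<epsilon> * real N) * exp (- (\<epsilon> * real N)) = 1" by (simp only: exp_minus) simp
        finally have "1 * pmf (?Q N) w \<le> exp (\<epsilon> * real N) * (\<Prod>t\<in>?I N. local_ratio b p N (fst (w t))) * pmf (?Q N) w"
          by (intro mult_right_mono) simp_all
        then show "pmf (?Q N) w \<le> exp ((\<gamma> + \<epsilon>) * real N) * pmf (?W N) w"
          unfolding W[OF N] \<gamma> by (simp only: mult_1_left mult.assoc add_0_left)
      qed
    qed
  qed simp_all
  have ev: "\<forall>\<^sub>F N in sequentially. elog (measure_pmf.prob (MC_pmf Local b p \<kappa> N) {\<omega>. empirical_pair N \<omega> \<in> A}) / ereal (real N) =
      elog (measure_pmf.prob (?W N) (event A N)) / ereal (real N)" for A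
    using eventually_ge_at_top[of 1] by eventually_elim (simp only: prob_MC_Local[OF \<kappa>])
  show "closedin (top_of_set ({0..} \<times> {0..})) F \<Longrightarrow> limsup (\<lambda>N. elog (measure_pmf.prob (MC_pmf Local b p \<kappa> N)
      {\<omega>. empirical_pair N \<omega> \<in> F}) / ereal (real N)) \<le> - (INF x\<in>F. rate_L b p \<kappa> x)"
    unfolding Limsup_eq[OF ev] rate_L_eq[OF b p \<kappa>] by (rule ldp_upper_bound)
  show "openin (top_of_set ({0..} \<times> {0..})) G \<Longrightarrow> liminf (\<lambda>N. elog (measure_pmf.prob (MC_pmf Local b p \<kappa> N)
      {\<omega>. empirical_pair N \<omega> \<in> G}) / ereal (real N)) \<ge> - (INF x\<in>G. rate_L b p \<kappa> x)"
    unfolding Liminf_eq[OF ev] rate_L_eq[OF b p \<kappa>] by (rule ldp_lower_bound)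
qed

section \<open>The large-deviation principle\<close>

theorem theorem1p7:
  fixes b p :: real and \<kappa> :: nat and D :: access_rule
  assumes "b > 0" and "p > 0" and "\<kappa> \<ge> 1"
    and "D = Global \<Longrightarrow> p \<le> 1"
  shows "(\<forall>F. closedin (top_of_set ({0..} \<times> {0..})) F \<longrightarrow>
            limsup (\<lambda>N. elog (measure_pmf.prob (MC_pmf D b p \<kappa> N) {\<omega>. empirical_pair N \<omega> \<in> F})
                          / ereal (real N))
              \<le> - (INF x\<in>F. rate D b p \<kappa> x)) \<and>
         (\<forall>G. openin (top_of_set ({0..} \<times> {0..})) G \<longrightarrow>
            liminf (\<lambda>N. elog (measure_pmf.prob (MC_pmf D b p \<kappa> N) {\<omega>. empirical_pair N \<omega> \<in> G})
                          / ereal (real N))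
              \<ge> - (INF x\<in>G. rate D b p \<kappa> x))"
proof (cases D)
  case Local
  show ?thesis unfolding Local rate.simps
    by (intro conjI allI impI ldp_Local assms(1-3))
next
  case Global
  show ?thesis unfolding Global rate.simps
    by (intro conjI allI impI ldp_Global assms(1-3) assms(4)[OF Global])
qed

end
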